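(* Suppose there exists a polynomial $e(d)$ such that $\operatorname{edc}(\operatorname{perm}_m)\le e(\operatorname{dc}(\operatorname{perm}_m))$ for all $m$. Then Valiant's conjecture holds: if $n(m)$ is a function of $m$ such that for every $m$ there exists an affine linear map $\tilde A_m:\mathbb{C}^{m^2}\to\mathbb{C}^{n(m)^2}$ with $\operatorname{perm}_m=\det_{n(m)}\circ\tilde A_m$, then $n(m)$ grows faster than any polynomial in $m$ (that is, for every polynomial $p$, $n(m)>p(m)$ for all sufficiently large $m$).
   Context: All spaces are over $\mathbb{C}$. $\mathcal{M}_n(\mathbb{C})\simeq\mathbb{C}^{n^2}$ is the space of $n\times n$ complex matrices and $\det_n$ the determinant polynomial on it. The permanent $\operatorname{perm}_m(y)=\sum_{\sigma\in\mathfrak{S}_m}\prod_{i=1}^m y^i_{\sigma(i)}$ is a homogeneous polynomial of degree $m$ on $\mathcal{M}_m(\mathbb{C})$. For a nonzero homogeneous polynomial $P$ on a finite-dimensional vector space $V$, the projective symmetry group is $\mathbb{G}_P=\{g\in \mathrm{GL}(V): \exists c\in\mathbb{C}^*,\ P(g^{-1}y)=cP(y)\ \forall y\in V\}$; in particular $\mathbb{G}_{\det_n}\subset \mathrm{GL}(\mathcal{M}_n(\mathbb{C}))$ is defined. A determinantal representation of $P$ of size $n$ is an affine linear map $\tilde A=\Lambda+A:V\to\mathcal{M}_n(\mathbb{C})$, with $\Lambda\in\mathcal{M}_n(\mathbb{C})$ fixed and $A$ linear, such that $P=\det_n\circ\tilde A$. The determinantal complexity $\operatorname{dc}(P)$ is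 the smallest size of a determinantal representation of $P$. Put $\mathbb{G}_A=\{g\in\mathbb{G}_{\det_n}: g\cdot\Lambda=\Lambda,\ g\cdot A(V)=A(V)\}$. Assume $P$ cannot be expressed using $\dim V-1$ variables (true for $\operatorname{perm}_m$); then $A:V\to A(V)$ is bijective. Let $\bar\rho_A:\mathbb{G}_A\to \mathrm{GL}(V)$ be $\bar\rho_A(g)=A^{-1}\circ (g|_{A(V)})\circ A$; its image lies in $\mathbb{G}_P$. The representation $\tilde A$ is called equivariant if $\bar\rho_A(\mathbb{G}_A)=\mathbb{G}_P$. The equivariant determinantal complexity $\operatorname{edc}(P)$ is the smallest $n$ such that $P$ has an equivariant determinantal representation of size $n$. *)

theory Defs
  imports
    "Jordan_Normal_Form.VS_Connect"
    "HOL-Library.Extended_Nat"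
    "HOL-Computational_Algebra.Polynomial"
begin

abbreviation Mat_space :: "nat \<Rightarrow> (complex, complex mat) module" where
  "Mat_space n \<equiv> module_mat TYPE(complex) n n"

definition perm :: "complex mat \<Rightarrow> complex" where
  "perm y = (\<Sum>\<sigma> | \<sigma> permutes {0..<dim_row y}. \<Prod>i = 0..<dim_row y. y $$ (i, \<sigma> i))"

text \<open>Linear automorphisms are total HOL functions that matter only on the carrier. Requiring them
  to be extensional gives each element of the general linear group a unique representative, so that
  equality of sets of such functions is equality of subgroups of the general linear group.\<close>

definition GL :: "(complex, 'v) module \<Rightarrow> ('v \<Rightarrow> 'v) set" where
  "GL V = {g \<in> extensional (carrier V).
     g \<in> LinearCombinations.module_hom class_ring V V \<and> bij_betw g (carrier V) (carrier V)}"

definition proj_sym_group :: "(complex, 'v) module \<Rightarrow> ('v \<Rightarrow> complex) \<Rightarrow> ('v \<Rightarrow> 'v) set" where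
  "proj_sym_group V P = {g \<in> GL V. \<exists>c. c \<noteq> 0 \<and>
     (\<forall>y \<in> carrier V. P (inv_into (carrier V) g y) = c * P y)}"

text \<open>The affine linear map \<open>y \<mapsto> \<Lambda> + A y\<close> is given by the pair of its
  constant part \<open>\<Lambda>\<close> and its linear part \<open>A\<close>.\<close>

definition det_rep ::
    "(complex, 'v) module \<Rightarrow> ('v \<Rightarrow> complex) \<Rightarrow> nat \<Rightarrow> complex mat \<Rightarrow> ('v \<Rightarrow> complex mat) \<Rightarrow> bool" where
  "det_rep V P n \<Lambda> A \<longleftrightarrow>
     \<Lambda> \<in> carrier_mat n n \<and> A \<in> LinearCombinations.module_hom class_ring V (Mat_space n) \<and>
     (\<forall>y \<in> carrier V. P y = det (\<Lambda> + A y))"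

definition rep_group ::
    "(complex, 'v) module \<Rightarrow> nat \<Rightarrow> complex mat \<Rightarrow> ('v \<Rightarrow> complex mat) \<Rightarrow> (complex mat \<Rightarrow> complex mat) set" where
  "rep_group V n \<Lambda> A = {g \<in> proj_sym_group (Mat_space n) det.
     g \<Lambda> = \<Lambda> \<and> g ` (A ` carrier V) = A ` carrier V}"

text \<open>The inverse of \<open>A\<close> on its image is meaningful for injective \<open>A\<close>. This is automatic for a
  determinantal representation of a polynomial that cannot be expressed in fewer than
  \<open>dim V\<close> variables, such as the permanent.\<close>

definition rho_bar ::
    "(complex, 'v) module \<Rightarrow> ('v \<Rightarrow> complex mat) \<Rightarrow> (complex mat \<Rightarrow> complex mat) \<Rightarrow> 'v \<Rightarrow> 'v" where
  "rho_bar V A g = restrict (inv_into (carrier V) A \<circ> g \<circ> A) (carrier V)"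

definition equivariant_det_rep ::
    "(complex, 'v) module \<Rightarrow> ('v \<Rightarrow> complex) \<Rightarrow> nat \<Rightarrow> complex mat \<Rightarrow> ('v \<Rightarrow> complex mat) \<Rightarrow> bool" where
  "equivariant_det_rep V P n \<Lambda> A \<longleftrightarrow>
     det_rep V P n \<Lambda> A \<and> rho_bar V A ` rep_group V n \<Lambda> A = proj_sym_group V P"

text \<open>Both complexities are minima over sets of sizes, with value \<open>\<infinity>\<close> when there is no such
  representation.\<close>

definition dc :: "(complex, 'v) module \<Rightarrow> ('v \<Rightarrow> complex) \<Rightarrow> enat" where
  "dc V P = Inf {enat n | n. \<exists>\<Lambda> A. det_rep V P n \<Lambda> A}"

definition edc :: "(complex, 'v) module \<Rightarrow> ('v \<Rightarrow> complex) \<Rightarrow> enat" where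
  "edc V P = Inf {enat n | n. \<exists>\<Lambda> A. equivariant_det_rep V P n \<Lambda> A}"

end

theory Submission
  imports Defs
    "HOL-Library.FuncSet"
    "HOL-Computational_Algebra.Primes"
    "Jordan_Normal_Form.Jordan_Normal_Form_Existence"
    "HOL-Real_Asymp.Real_Asymp"
begin

text \<open>By the hypothesis it suffices to bound the size \<open>n\<close> of an equivariant representation from below by
  a binomial coefficient. Equivariance is used for one element only: scaling the variable
  \<open>y\<^bsub>ij\<^esub>\<close> by the product of two primes attached to row \<open>i\<close> and column \<open>j\<close>. The square of a lift of this
  scaling is \<open>X \<mapsto> B X C\<close> by Frobenius' theorem, and the eigenvalues of \<open>B\<close> and of the inverse of \<open>C\<close>
  are weights for the rows and columns: in suitable bases every entry of \<open>\<Lambda> + A y\<close> is a constant or a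
  multiple of the one variable that carries the row weight to the column weight, and \<open>\<Lambda>\<close> is a diagonal
  projection. Evaluating at the permutation matrix of \<open>\<sigma>\<close> yields a nonzero Leibniz term, whose orbits
  are paths of variables \<open>y\<^bsub>i,\<sigma> i\<^esub>\<close>, and by unique factorization the weight reached by a path
  determines the set \<open>I\<close> of rows used so far and its image under \<open>\<sigma>\<close>. Counting the permutations with given
  \<open>I\<close> and \<open>\<sigma> ` I\<close> shows that the corank of \<open>\<Lambda>\<close> is \<open>1\<close> or \<open>m\<close>. Corank \<open>m\<close> would
  express the permanent as a determinant with rescaled entries, which fails already for three rows.
  In corank \<open>1\<close> a single path uses all variables, and the weights it reaches after \<open>l\<close> steps, for
  varying \<open>\<sigma>\<close>, number at least \<open>m choose l\<close>.\<close>

text \<open>Why one element is enough: distinct primes are multiplicatively independent, so this one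
  scaling separates the same weights as the whole torus of row and column scalings, and no lift of
  that torus is needed. Why its square: a lift may involve a transposition, and then it carries no
  separate row and column weights. \<open>B\<close> and \<open>C\<close> need not be diagonalizable,
  but a relation \<open>B M C = x M\<close> respects generalized eigenspaces, so Jordan bases serve
  as well as eigenbases. Why permutation matrices: the permanent is 1 there and only m variables
  survive, so one nonzero determinant yields a Leibniz term. The obstacle is the corank of
  \<Lambda>: at an index outside the identity block the row and column weights are unrelated, so a
  path can be followed only up to the next such index, and with several of them it may stop before
  all variables are used. Hence the corank has to be settled before the subsets of a given size can
  be counted. In corank 1 one may take half of the m steps, and the central binomial coefficient, at
  least 2^m / (m + 1), outgrows every polynomial.\<close>

section \<open>Counting permutations with a prescribed image\<close>

text \<open>Such a permutation is determined by two bijections, from \<open>I\<close> onto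
  \<open>J\<close> and from the complement of \<open>I\<close> onto the complement of
  \<open>J\<close>.\<close>

lemma card_permutes_image_le:
  assumes I: "I \<subseteq> U" and U: "finite U"
  shows "card {\<sigma>. \<sigma> permutes U \<and> \<sigma> ` I = J} \<le> fact (card I) * fact (card U - card I)"
proof (cases "\<exists>\<sigma>. \<sigma> permutes U \<and> \<sigma> ` I = J")
  case True
  then obtain \<sigma>0 where s0: "\<sigma>0 permutes U" "\<sigma>0 ` I = J" by blast
  have cJ: "card J = card I" using s0 by (metis card_image inj_on_subset permutes_inj subset_UNIV)
  have JU: "J \<subseteq> U" using s0 I permutes_image[OF s0(1)] by blast
  have fI: "finite I" and fJ: "finite J" using I JU U finite_subset by auto
  let ?F = "\<lambda>A B. {f \<in> A \<rightarrow>\<^sub>E B. inj_on f A}"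
  let ?h = "\<lambda>\<sigma>. (restrict \<sigma> I, restrict \<sigma> (U - I))"
  have cU: "card (U - I) = card U - card I" "card (U - J) = card U - card I"
    using I JU U fI fJ cJ by (auto simp: card_Diff_subset)
  have cards: "card (?F I J) = fact (card I)" "card (?F (U - I) (U - J)) = fact (card U - card I)"
    using card_inj_on_subset_funcset[of I J I] card_inj_on_subset_funcset[of "U - I" "U - J" "U - I"]
      fI fJ U cJ cU by (simp_all add: fact_prod_rev)
  have fin: "finite (?F I J)" "finite (?F (U - I) (U - J))"
    using finite_PiE[of I "\<lambda>_. J"] finite_PiE[of "U-I" "\<lambda>_. U-J"] fI fJ U by auto
  have inj: "inj_on ?h {\<sigma>. \<sigma> permutes U \<and> \<sigma> ` I = J}"
  proof (rule inj_onI)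
    fix \<sigma> \<tau> assume s: "\<sigma> \<in> {\<sigma>. \<sigma> permutes U \<and> \<sigma> ` I = J}" and t: "\<tau> \<in> {\<sigma>. \<sigma> permutes U \<and> \<sigma> ` I = J}"
      and e: "?h \<sigma> = ?h \<tau>"
    show "\<sigma> = \<tau>"
    proof
      fix x
      consider "x \<in> I" | "x \<in> U - I" | "x \<notin> U" using I by blast
      then show "\<sigma> x = \<tau> x"
      proof cases
        case 1 then show ?thesis using e by (metis prod.inject restrict_apply')
      next
        case 2 then show ?thesis using e by (metis prod.inject restrict_apply')
      next
        case 3 then show ?thesis using s t by (simp add: permutes_def)
      qed
    qed
  qed
  have im: "?h ` {\<sigma>. \<sigma> permutes U \<and> \<sigma> ` I = J} \<subseteq> ?F I J \<times> ?F (U - I) (U - J)"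
  proof
    fix z assume "z \<in> ?h ` {\<sigma>. \<sigma> permutes U \<and> \<sigma> ` I = J}"
    then obtain \<sigma> where s: "\<sigma> permutes U" "\<sigma> ` I = J" and z: "z = ?h \<sigma>" by blast
    have inj: "inj_on \<sigma> A" for A using permutes_inj[OF s(1)] by (meson inj_on_subset subset_UNIV)
    have "\<sigma> ` (U - I) = U - J" using s permutes_inj[OF s(1)] permutes_image[OF s(1)]
      by (simp add: image_set_diff)
    then show "z \<in> ?F I J \<times> ?F (U - I) (U - J)" using z s inj by (auto simp: inj_on_def)
  qed
  have "card {\<sigma>. \<sigma> permutes U \<and> \<sigma> ` I = J} \<le> card (?F I J \<times> ?F (U - I) (U - J))"
    by (rule card_inj_on_le[OF inj im]) (use fin in auto)
  then show ?thesis using cards by (simp add: card_cartesian_product)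
next
  case False
  then have "{\<sigma>. \<sigma> permutes U \<and> \<sigma> ` I = J} = {}" by blast
  then show ?thesis by (metis card.empty le0)
qed

text \<open>Both counting arguments run through this: \<open>f\<close> will be the index at which a
  path is observed and \<open>I\<close> the rows used up to there. On a fibre of \<open>f\<close>
  both \<open>I\<close> and its image are constant, so the fibre has at most \<open>N\<close>
  elements.\<close>

lemma fact_le_card_mult:
  fixes I :: "(nat \<Rightarrow> nat) \<Rightarrow> nat set" and f :: "(nat \<Rightarrow> nat) \<Rightarrow> 'a"
  assumes R: "finite R"
    and f: "\<And>\<sigma>. \<sigma> permutes {0..<m} \<Longrightarrow> f \<sigma> \<in> R"
    and I: "\<And>\<sigma>. \<sigma> permutes {0..<m} \<Longrightarrow> I \<sigma> \<subseteq> {0..<m}"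
    and N: "\<And>\<sigma>. \<sigma> permutes {0..<m} \<Longrightarrow> fact (card (I \<sigma>)) * fact (m - card (I \<sigma>)) \<le> N"
    and eq: "\<And>\<sigma> \<tau>. \<sigma> permutes {0..<m} \<Longrightarrow> \<tau> permutes {0..<m} \<Longrightarrow> f \<sigma> = f \<tau> \<Longrightarrow>
               I \<sigma> = I \<tau> \<and> \<sigma> ` I \<sigma> = \<tau> ` I \<tau>"
  shows "fact m \<le> card R * N"
proof -
  let ?S = "{\<sigma>. \<sigma> permutes {0..<m}}"
  let ?fib = "\<lambda>r. {\<sigma> \<in> ?S. f \<sigma> = r}"
  have fib: "card (?fib r) \<le> N" for r
  proof (cases "?fib r = {}")
    case True then show ?thesis by (metis card.empty le0)
  next
    case False
    then obtain \<sigma> where s: "\<sigma> permutes {0..<m}" "f \<sigma> = r" by blast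
    have "?fib r \<subseteq> {\<tau>. \<tau> permutes {0..<m} \<and> \<tau> ` I \<sigma> = \<sigma> ` I \<sigma>}"
    proof
      fix \<tau> assume "\<tau> \<in> ?fib r"
      then have t: "\<tau> permutes {0..<m}" "f \<tau> = r" by auto
      then show "\<tau> \<in> {\<tau>. \<tau> permutes {0..<m} \<and> \<tau> ` I \<sigma> = \<sigma> ` I \<sigma>}" using eq[OF t(1) s(1)] s(2) by auto
    qed
    then have "card (?fib r) \<le> card {\<tau>. \<tau> permutes {0..<m} \<and> \<tau> ` I \<sigma> = \<sigma> ` I \<sigma>}"
      by (intro card_mono) (auto simp: finite_permutations)
    also have "\<dots> \<le> fact (card (I \<sigma>)) * fact (m - card (I \<sigma>))"
      using card_permutes_image_le[OF I[OF s(1)], of "\<sigma> ` I \<sigma>"] by simp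
    also have "\<dots> \<le> N" by (rule N[OF s(1)])
    finally show ?thesis .
  qed
  have U: "?S = (\<Union>r\<in>R. ?fib r)" using f by blast
  have "card ?S \<le> (\<Sum>r\<in>R. card (?fib r))" by (subst U) (rule card_UN_le[OF R])
  also have "\<dots> \<le> card R * N" using sum_bounded_above[of R "\<lambda>r. card (?fib r)" N] fib by simp
  finally show ?thesis by (simp add: card_permutations)
qed

text \<open>Equivalent to \<open>m choose k\<close> being at least \<open>m\<close> away from the
  two ends of the row, which is what the induction proves.\<close>

lemma fact_mult_fact_le:
  assumes "1 \<le> k" "k < m"
  shows "fact k * fact (m - k) \<le> (fact (m - 1) :: nat)"
proof -
  have "m \<le> m choose k"
  proof -
    obtain j where m: "m = Suc j" using assms by (cases m) auto
    show ?thesis using assms unfolding m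
    proof (induction j arbitrary: k)
      case 0 then show ?case by simp
    next
      case (Suc j)
      show ?case
      proof (cases "k = Suc j")
        case True then show ?thesis using binomial_symmetric[of k "Suc (Suc j)"] by simp
      next
        case False
        obtain k' where k: "k = Suc k'" using Suc.prems by (cases k) auto
        have "Suc j \<le> Suc j choose k" using Suc.IH[of k] Suc.prems False by simp
        moreover have "1 \<le> Suc j choose k'" using Suc.prems k by (simp add: Suc_leI zero_less_binomial)
        ultimately show ?thesis unfolding k binomial_Suc_Suc[of "Suc j" k'] by simp
      qed
    qed
  qed
  then have "m * (fact k * fact (m - k)) \<le> (m choose k) * (fact k * fact (m - k))" by simp
  also have "\<dots> = fact m" using binomial_fact_lemma[of k m] assms by (simp add: ac_simps)
  also have "\<dots> = m * fact (m - 1)" using assms by (simp add: fact_reduce)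
  finally show ?thesis using assms by simp
qed

section \<open>Weights of variables and unique factorization\<close>

locale distinct_primes =
  fixes p :: "nat \<Rightarrow> nat"
  assumes inj: "inj p" and prime: "prime (p i)"
begin

text \<open>Squared because the argument uses the square of a lift. The shift by \<open>m\<close>
  keeps the primes of the columns apart from those of the rows.\<close>

definition wt :: "nat \<Rightarrow> nat \<Rightarrow> nat \<Rightarrow> nat" where
  "wt m i j = (p i * p (m + j))\<^sup>2"

lemma dvd_wt: "p k dvd wt m i j \<longleftrightarrow> k = i \<or> k = m + j"
proof -
  have "p k dvd p l \<longleftrightarrow> k = l" for l
    using primes_dvd_imp_eq[OF prime prime, of k l] inj by (auto simp: inj_eq)
  then show ?thesis
    unfolding wt_def using prime[of k] by (simp add: prime_dvd_power_iff prime_dvd_mult_iff)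
qed

text \<open>The prime divisors of the product recover its factors: those with index below
  \<open>m\<close> give the rows, the others give the columns. Divisibility suffices because
  \<open>I\<close> and \<open>I'\<close> are sets, so that no row is repeated.\<close>

lemma wt_prod_eq_imp:
  assumes I: "I \<subseteq> {0..<m}" "I' \<subseteq> {0..<m}"
    and e: "(\<Prod>i\<in>I. of_nat (wt m i (\<sigma> i)) :: complex) = (\<Prod>i\<in>I'. of_nat (wt m i (\<tau> i)))"
  shows "I = I' \<and> \<sigma> ` I = \<tau> ` I'"
proof -
  have fin: "finite I" "finite I'" using I finite_subset by blast+
  have e: "(\<Prod>i\<in>I. wt m i (\<sigma> i)) = (\<Prod>i\<in>I'. wt m i (\<tau> i))"
    using e unfolding of_nat_prod[symmetric] of_nat_eq_iff .
  have "(k \<in> I \<or> (\<exists>i\<in>I. k = m + \<sigma> i)) = (k \<in> I' \<or> (\<exists>i\<in>I'. k = m + \<tau> i))" for k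
  proof -
    have "p k dvd (\<Prod>i\<in>I. wt m i (\<sigma> i)) \<longleftrightarrow> k \<in> I \<or> (\<exists>i\<in>I. k = m + \<sigma> i)"
      using fin prime[of k] by (auto simp: prime_dvd_prod_iff dvd_wt)
    moreover have "p k dvd (\<Prod>i\<in>I'. wt m i (\<tau> i)) \<longleftrightarrow> k \<in> I' \<or> (\<exists>i\<in>I'. k = m + \<tau> i)"
      using fin prime[of k] by (auto simp: prime_dvd_prod_iff dvd_wt)
    ultimately show ?thesis using e by simp
  qed
  note K = this
  have "k \<in> I \<longleftrightarrow> k \<in> I'" for k
    using K[of k] I by (cases "k < m") auto
  moreover have "j \<in> \<sigma> ` I \<longleftrightarrow> j \<in> \<tau> ` I'" for j
    using K[of "m + j"] I by (auto simp: image_iff subset_iff)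
  ultimately show ?thesis by blast
qed

text \<open>Here a row might occur repeatedly, so multiplicities are compared: \<open>p k\<close>
  occurs twice for each \<open>a\<close> with label \<open>k\<close> on the left, and exactly twice
  on the right.\<close>

lemma wt_prod_eq_imp_bij:
  assumes S: "finite S" and l: "\<And>a. a \<in> S \<Longrightarrow> l a < m"
    and e: "(\<Prod>a\<in>S. of_nat (wt m (l a) (\<sigma> (l a))) :: complex) = (\<Prod>i=0..<m. of_nat (wt m i i))"
  shows "bij_betw l S {0..<m}"
proof -
  have e: "(\<Prod>a\<in>S. wt m (l a) (\<sigma> (l a))) = (\<Prod>i=0..<m. wt m i i)"
    using e unfolding of_nat_prod[symmetric] of_nat_eq_iff .
  have mult: "multiplicity (p k) (wt m i j) = (if i = k then 2 else 0)" if "k < m" for i j k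
  proof -
    have ne: "p (m + j) \<noteq> p k" using inj that by (auto simp: inj_def)
    have "multiplicity (p k) (wt m i j) = 2 * (multiplicity (p k) (p i) + multiplicity (p k) (p (m + j)))"
      unfolding wt_def using prime[of k] prime[of i] prime[of "m+j"]
      by (subst prime_elem_multiplicity_power_distrib)
        (auto simp: prime_elem_multiplicity_mult_distrib prime_gt_0_nat)
    moreover have "multiplicity (p k) (p (m + j)) = 0"
      using ne prime_multiplicity_other[OF prime prime, of k "m + j"] by simp
    moreover have "multiplicity (p k) (p i) = (if i = k then 1 else 0)"
      using prime[of i] prime[of k] inj prime_multiplicity_other[OF prime prime, of k i]
      by (auto simp: inj_eq multiplicity_prime)
    ultimately show ?thesis by simp
  qed
  have ne0: "wt m i j \<noteq> 0" for i j using prime prime_gt_0_nat unfolding wt_def by simp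
  have card1: "card {a \<in> S. l a = k} = 1" if k: "k < m" for k
  proof -
    have "multiplicity (p k) (\<Prod>a\<in>S. wt m (l a) (\<sigma> (l a))) = (\<Sum>a\<in>S. if l a = k then 2 else 0)"
      using S prime[of k] ne0 mult[OF k] by (subst prime_elem_multiplicity_prod_distrib) (auto simp del: neq0_conv)
    also have "\<dots> = 2 * card {a \<in> S. l a = k}" using S
      by (simp add: sum.If_cases Int_def)
    finally have 1: "multiplicity (p k) (\<Prod>a\<in>S. wt m (l a) (\<sigma> (l a))) = 2 * card {a \<in> S. l a = k}" .
    have "multiplicity (p k) (\<Prod>i=0..<m. wt m i i) = (\<Sum>i=0..<m. if i = k then 2 else 0)"
      using prime[of k] ne0 mult[OF k] by (subst prime_elem_multiplicity_prod_distrib) (auto simp del: neq0_conv)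
    also have "\<dots> = 2" using k by simp
    finally show ?thesis using 1 e by simp
  qed
  have "inj_on l S"
  proof (rule inj_onI)
    fix a b assume ab: "a \<in> S" "b \<in> S" "l a = l b"
    obtain c where "{x \<in> S. l x = l a} = {c}" using card1[OF l[OF ab(1)]] card_1_singletonE by blast
    then have "a \<in> {c}" "b \<in> {c}" using ab by auto
    then show "a = b" by simp
  qed
  moreover have "l ` S = {0..<m}"
  proof
    show "{0..<m} \<subseteq> l ` S"
    proof
      fix k assume "k \<in> {0..<m}"
      then have "card {a \<in> S. l a = k} = 1" using card1 by simp
      then have "{a \<in> S. l a = k} \<noteq> {}" by force
      then show "k \<in> l ` S" by blast
    qed
  qed (use l in auto)
  ultimately show ?thesis by (simp add: bij_betw_def)
qed

end

section \<open>Pencils graded by weights\<close>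

lemma det_nonzero_ex_term:
  fixes A :: "'a :: idom mat"
  assumes A: "A \<in> carrier_mat n n" and d: "det A \<noteq> 0"
  shows "\<exists>\<pi>. \<pi> permutes {0..<n} \<and> (\<forall>i<n. A $$ (i, \<pi> i) \<noteq> 0)"
proof -
  have "(\<Sum>\<pi> | \<pi> permutes {0..<n}. signof \<pi> * (\<Prod>i = 0..<n. A $$ (i, \<pi> i))) \<noteq> 0"
    using d by (simp add: det_def'[OF A])
  then obtain \<pi> where "\<pi> permutes {0..<n}" "signof \<pi> * (\<Prod>i = 0..<n. A $$ (i, \<pi> i)) \<noteq> 0"
    by (rule sum.not_neutral_contains_not_neutral) blast
  then show ?thesis by (intro exI[of _ \<pi>]) simp
qed

text \<open>The values at permutation matrices of a pencil whose constant part is a diagonal projection of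
  rank \<open>q\<close> and whose coefficient of the variable in row \<open>i\<close> and column \<open>j\<close> is \<open>M i j\<close>.\<close>

locale weighted_pencil = distinct_primes p for p +
  fixes m n q :: nat and \<beta> \<gamma> :: "nat \<Rightarrow> complex" and M :: "nat \<Rightarrow> nat \<Rightarrow> nat \<Rightarrow> nat \<Rightarrow> complex"
    and \<kappa> :: complex
  assumes m: "0 < m" and qn: "q \<le> n"
    and nz: "\<And>a. a < n \<Longrightarrow> \<beta> a \<noteq> 0" "\<And>a. a < n \<Longrightarrow> \<gamma> a \<noteq> 0"
    and graded: "\<And>i j a b. i < m \<Longrightarrow> j < m \<Longrightarrow> a < n \<Longrightarrow> b < n \<Longrightarrow> M i j a b \<noteq> 0 \<Longrightarrow>
                   \<beta> a = of_nat (wt m i j) * \<gamma> b"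
    and const: "\<And>a. a < q \<Longrightarrow> \<beta> a = \<gamma> a"
    and total: "(\<Prod>a=0..<n. \<beta> a) = (\<Prod>i=0..<m. of_nat (wt m i i)) * (\<Prod>a=0..<n. \<gamma> a)"
    and det: "\<And>\<sigma>. \<sigma> permutes {0..<m} \<Longrightarrow>
       det (mat n n (\<lambda>(a,b). (if a = b \<and> a < q then 1 else 0) + (\<Sum>i=0..<m. M i (\<sigma> i) a b))) = \<kappa>"
    and \<kappa>: "\<kappa> \<noteq> 0"
begin

definition X :: "(nat \<Rightarrow> nat) \<Rightarrow> nat \<Rightarrow> nat \<Rightarrow> complex" where
  "X \<sigma> a b = (if a = b \<and> a < q then 1 else 0) + (\<Sum>i=0..<m. M i (\<sigma> i) a b)"

definition supp :: "(nat \<Rightarrow> nat) \<Rightarrow> (nat \<Rightarrow> nat) \<Rightarrow> bool" where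
  "supp \<sigma> \<pi> \<longleftrightarrow> \<pi> permutes {0..<n} \<and> (\<forall>a<n. X \<sigma> a (\<pi> a) \<noteq> 0)"

text \<open>The rows whose entry in the Leibniz term must come from a variable. A fixed point
  outside the identity block counts as moved, since the constant part vanishes there.\<close>

definition moved :: "(nat \<Rightarrow> nat) \<Rightarrow> nat set" where
  "moved \<pi> = {a. a < n \<and> \<not> (\<pi> a = a \<and> a < q)}"

lemma wt_neq_1: "(of_nat (wt m i j) :: complex) \<noteq> 1"
proof
  assume "(of_nat (wt m i j) :: complex) = 1"
  then have "wt m i j = 1" using of_nat_eq_1_iff by blast
  then show False using dvd_wt[of i m i j] prime[of i] by simp
qed

lemma det_eq_sum:
  assumes "\<sigma> permutes {0..<m}"
  shows "\<kappa> = (\<Sum>\<pi> | \<pi> permutes {0..<n}. signof \<pi> * (\<Prod>a = 0..<n. X \<sigma> a (\<pi> a)))"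
proof -
  have "(\<Prod>a = 0..<n. mat n n (\<lambda>(a,b). X \<sigma> a b) $$ (a, \<pi> a)) = (\<Prod>a = 0..<n. X \<sigma> a (\<pi> a))"
    if "\<pi> permutes {0..<n}" for \<pi>
    using permutes_in_image[OF that] by (intro prod.cong) auto
  moreover have "\<kappa> = det (mat n n (\<lambda>(a,b). X \<sigma> a b))" using det[OF assms] by (simp add: X_def)
  ultimately show ?thesis by (subst (asm) det_def'[of _ n]) auto
qed

lemma ex_supp:
  assumes "\<sigma> permutes {0..<m}"
  obtains \<pi> where "supp \<sigma> \<pi>"
proof -
  have "\<exists>\<pi>. \<pi> permutes {0..<n} \<and> signof \<pi> * (\<Prod>a = 0..<n. X \<sigma> a (\<pi> a)) \<noteq> 0"
  proof (rule ccontr)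
    assume "\<not> ?thesis"
    then have "(\<Sum>\<pi> | \<pi> permutes {0..<n}. signof \<pi> * (\<Prod>a = 0..<n. X \<sigma> a (\<pi> a))) = 0"
      by (intro sum.neutral) blast
    then show False using det_eq_sum[OF assms] \<kappa> by simp
  qed
  then obtain \<pi> where "\<pi> permutes {0..<n}" "(\<Prod>a = 0..<n. X \<sigma> a (\<pi> a)) \<noteq> 0" by auto
  then have "supp \<sigma> \<pi>" unfolding supp_def by simp
  then show ?thesis using that by blast
qed

text \<open>A nonzero entry at a moved index contains a variable, which labels the index. In the
  product of all weight relations the unmoved indices cancel by \<open>const\<close> and the column
  weights because \<pi> permutes them. By \<open>total\<close> the labels then multiply to the
  weight of a full set of variables, so every row is used exactly once.\<close>

lemma supp_label:
  assumes \<sigma>: "\<sigma> permutes {0..<m}" and \<pi>: "supp \<sigma> \<pi>"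
  shows "\<exists>l. bij_betw l (moved \<pi>) {0..<m} \<and>
    (\<forall>a\<in>moved \<pi>. \<beta> a = of_nat (wt m (l a) (\<sigma> (l a))) * \<gamma> (\<pi> a))"
proof -
  have pin: "\<pi> a < n" if "a < n" for a using \<pi> that permutes_in_image[of \<pi> "{0..<n}" a] by (auto simp: supp_def)
  have "\<exists>i<m. \<beta> a = of_nat (wt m i (\<sigma> i)) * \<gamma> (\<pi> a)" if a: "a \<in> moved \<pi>" for a
  proof -
    have "X \<sigma> a (\<pi> a) \<noteq> 0" "a < n" using a \<pi> by (auto simp: moved_def supp_def)
    then have "(\<Sum>i=0..<m. M i (\<sigma> i) a (\<pi> a)) \<noteq> 0" using a by (auto simp: X_def moved_def split: if_splits)
    then obtain i where i: "i < m" "M i (\<sigma> i) a (\<pi> a) \<noteq> 0" by (meson sum.neutral atLeastLessThan_iff)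
    moreover have "\<sigma> i < m" using i \<sigma> permutes_in_image[of \<sigma> "{0..<m}" i] by auto
    ultimately show ?thesis using graded[of i "\<sigma> i" a "\<pi> a"] \<open>a < n\<close> pin by blast
  qed
  then obtain l where l: "\<And>a. a \<in> moved \<pi> \<Longrightarrow> l a < m"
     "\<And>a. a \<in> moved \<pi> \<Longrightarrow> \<beta> a = of_nat (wt m (l a) (\<sigma> (l a))) * \<gamma> (\<pi> a)"
    using bchoice[of "moved \<pi>" "\<lambda>a i. i < m \<and> \<beta> a = of_nat (wt m i (\<sigma> i)) * \<gamma> (\<pi> a)"] by auto
  have fin: "finite (moved \<pi>)" by (simp add: moved_def)
  have sub: "moved \<pi> \<subseteq> {0..<n}" by (auto simp: moved_def)
  have pp: "\<pi> permutes {0..<n}" using \<pi> by (simp add: supp_def)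
  have "(\<Prod>a=0..<n. \<beta> a) = (\<Prod>a\<in>moved \<pi>. \<beta> a) * (\<Prod>a\<in>{0..<n} - moved \<pi>. \<beta> a)"
    using prod.subset_diff[OF sub, of \<beta>] by (simp add: mult.commute)
  also have "(\<Prod>a\<in>moved \<pi>. \<beta> a) =
      (\<Prod>a\<in>moved \<pi>. of_nat (wt m (l a) (\<sigma> (l a)))) * (\<Prod>a\<in>moved \<pi>. \<gamma> (\<pi> a))"
    using l(2) by (simp add: prod.distrib)
  also have "(\<Prod>a\<in>{0..<n} - moved \<pi>. \<beta> a) = (\<Prod>a\<in>{0..<n} - moved \<pi>. \<gamma> (\<pi> a))"
    using const by (intro prod.cong) (auto simp: moved_def)
  also have "(\<Prod>a\<in>moved \<pi>. of_nat (wt m (l a) (\<sigma> (l a)))) * (\<Prod>a\<in>moved \<pi>. \<gamma> (\<pi> a)) *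
      (\<Prod>a\<in>{0..<n} - moved \<pi>. \<gamma> (\<pi> a)) =
      (\<Prod>a\<in>moved \<pi>. of_nat (wt m (l a) (\<sigma> (l a)))) * (\<Prod>a=0..<n. \<gamma> (\<pi> a))"
    using prod.subset_diff[OF sub, of "\<lambda>a. \<gamma> (\<pi> a)"] by (simp add: mult_ac)
  also have "(\<Prod>a=0..<n. \<gamma> (\<pi> a)) = (\<Prod>a=0..<n. \<gamma> a)"
    using prod.permute[OF pp, of \<gamma>] by (simp add: comp_def)
  finally have e: "(\<Prod>a\<in>moved \<pi>. of_nat (wt m (l a) (\<sigma> (l a)))) * (\<Prod>a=0..<n. \<gamma> a) =
      (\<Prod>i=0..<m. of_nat (wt m i i)) * (\<Prod>a=0..<n. \<gamma> a)" unfolding total by (rule sym)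
  have "(\<Prod>a=0..<n. \<gamma> a) \<noteq> 0" using nz by simp
  with e have "(\<Prod>a\<in>moved \<pi>. of_nat (wt m (l a) (\<sigma> (l a))) :: complex) = (\<Prod>i=0..<m. of_nat (wt m i i))"
    by simp
  from wt_prod_eq_imp_bij[OF fin l(1) this] l(2) show ?thesis by blast
qed

lemma card_moved:
  assumes \<sigma>: "\<sigma> permutes {0..<m}" and \<pi>: "supp \<sigma> \<pi>"
  shows "card (moved \<pi>) = m"
proof -
  obtain l where "bij_betw l (moved \<pi>) {0..<m}" using supp_label[OF assms] by blast
  then show ?thesis by (metis bij_betw_same_card card_atLeastLessThan minus_nat.diff_0)
qed

text \<open>With full rank, \<open>const\<close> and \<open>total\<close> would make a nonempty
  product of variable weights equal to 1.\<close>

lemma q_less: "q < n"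
proof (rule ccontr)
  assume "\<not> q < n"
  then have "q = n" using qn by simp
  then have "(\<Prod>a=0..<n. \<beta> a) = (\<Prod>a=0..<n. \<gamma> a)" using const by simp
  moreover have "(\<Prod>a=0..<n. \<gamma> a) \<noteq> 0" using nz by simp
  ultimately have "(\<Prod>i\<in>{0..<m}. of_nat (wt m i i) :: complex) = (\<Prod>i\<in>{}. of_nat (wt m i i))"
    using total by simp
  from wt_prod_eq_imp[OF _ _ this] m show False by auto
qed

text \<open>Every index outside the identity block is moved, and exactly \<open>m\<close> indices
  are moved.\<close>

lemma corank_le: "n - q \<le> m"
proof -
  have id: "id permutes {0..<m}" by (rule permutes_id)
  obtain \<pi> where \<pi>: "supp id \<pi>" using ex_supp[OF id] .
  have "{q..<n} \<subseteq> moved \<pi>" by (auto simp: moved_def)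
  then have "card {q..<n} \<le> card (moved \<pi>)" by (intro card_mono) (auto simp: moved_def)
  then show ?thesis using card_moved[OF id \<pi>] by simp
qed

text \<open>The orbit of the last index under \<open>\<pi>\<close>, up to its first return to an index outside the
  identity block, is a path of variables; the row weight at the start and the column weight at each
  later point differ by the product of the variables passed.\<close>

lemma supp_path:
  assumes \<sigma>: "\<sigma> permutes {0..<m}" and \<pi>: "supp \<sigma> \<pi>"
  shows "\<exists>K I. 0 < K \<and> q \<le> (\<pi> ^^ K) (n - 1) \<and> (\<forall>k. (\<pi> ^^ k) (n - 1) < n) \<and> K + card {q..<n} \<le> Suc m \<and>
    (\<forall>k. 0 < k \<longrightarrow> k \<le> K \<longrightarrow> I k \<subseteq> {0..<m} \<and> card (I k) = k \<and>
       \<beta> (n - 1) = (\<Prod>i\<in>I k. of_nat (wt m i (\<sigma> i))) * \<gamma> ((\<pi> ^^ k) (n - 1)))"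
proof -
  define orb where "orb k = (\<pi> ^^ k) (n - 1)" for k
  have pp: "\<pi> permutes {0..<n}" using \<pi> by (simp add: supp_def)
  have n0: "0 < n" using q_less by simp
  have funpow: "(\<pi> ^^ k) permutes {0..<n}" for k
  proof (induction k)
    case 0
    show ?case unfolding funpow.simps by (rule permutes_id)
  next
    case (Suc k)
    show ?case unfolding funpow.simps by (rule permutes_compose[OF Suc pp])
  qed
  have orbn: "orb k < n" for k
    unfolding orb_def using n0 permutes_in_image[OF funpow, of k "n - 1"] by simp
  have inj: "inj (\<pi> ^^ k)" for k by (rule permutes_inj[OF funpow])
  have orb0: "orb 0 = n - 1" by (simp add: orb_def)
  have orbS: "orb (Suc k) = \<pi> (orb k)" for k by (simp add: orb_def)
  have cancel: "orb (j - i) = n - 1" if "orb i = orb j" "i \<le> j" for i j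
  proof -
    have "(\<pi> ^^ i) (orb (j - i)) = orb (i + (j - i))" unfolding orb_def funpow_add by simp
    then have "(\<pi> ^^ i) (orb (j - i)) = (\<pi> ^^ i) (n - 1)" using that unfolding orb_def by simp
    then show ?thesis by (rule injD[OF inj[of i]])
  qed
  have "\<exists>k>0. q \<le> orb k"
  proof -
    have "finite (range orb)" by (rule finite_subset[of _ "{0..<n}"]) (use orbn in auto)
    then have "\<not> inj_on orb UNIV" using finite_imageD infinite_UNIV_nat by blast
    then obtain i j where "orb i = orb j" "i \<noteq> j" by (auto simp: inj_on_def)
    then have "orb i = orb j \<and> i < j \<or> orb j = orb i \<and> j < i" by auto
    then obtain i j where "orb i = orb j" "i < j" by blast
    then have "orb (j - i) = n - 1" "0 < j - i" using cancel by auto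
    moreover have "q \<le> n - 1" using q_less by simp
    ultimately show ?thesis by (intro exI[of _ "j - i"]) simp
  qed
  then have ex: "\<exists>k. 0 < k \<and> q \<le> orb k" by blast
  \<comment> \<open>The first return to an index outside the identity block. It exists since the
    orbit of \<open>n - 1\<close> is finite and comes back to \<open>n - 1\<close>.\<close>
  define K where "K = (LEAST k. 0 < k \<and> q \<le> orb k)"
  have K: "0 < K" "q \<le> orb K" using LeastI_ex[OF ex] unfolding K_def by auto
  have Kmin: "orb k < q" if "0 < k" "k < K" for k
    using not_less_Least[of k "\<lambda>k. 0 < k \<and> q \<le> orb k"] that unfolding K_def by simp
  have inj_orb: "inj_on orb {..<K}"
  proof (rule inj_onI, rule ccontr)
    fix i j assume "i \<in> {..<K}" "j \<in> {..<K}" "orb i = orb j" "i \<noteq> j"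
    then have "\<exists>i j. i < j \<and> j < K \<and> orb i = orb j" by (metis lessThan_iff nat_neq_iff)
    then obtain i j where ij: "i < j" "j < K" "orb i = orb j" by blast
    then have "orb (j - i) = n - 1" using cancel by simp
    moreover have "orb (j - i) < q" using ij by (intro Kmin) auto
    ultimately show False using q_less by simp
  qed
  have moved: "orb k \<in> moved \<pi>" if k: "k < K" for k
  proof (cases "k = 0")
    case True then show ?thesis using orb0 q_less by (auto simp: moved_def)
  next
    case False
    \<comment> \<open>A fixed point on the orbit would make the whole orbit equal to
      \<open>n - 1\<close>, but intermediate points lie inside the identity block.\<close>
    have "\<pi> (orb k) \<noteq> orb k"
    proof
      assume "\<pi> (orb k) = orb k"
      then have "orb (Suc k) = orb k" by (simp add: orbS)
      then have "orb 1 = n - 1" using cancel[of k "Suc k"] by simp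
      then have "orb i = n - 1" for i by (induction i) (simp_all add: orb0 orbS)
      then show False using Kmin[of k] False k q_less by simp
    qed
    then show ?thesis using orbn by (simp add: moved_def)
  qed
  obtain l where l: "bij_betw l (moved \<pi>) {0..<m}"
    "\<And>a. a \<in> moved \<pi> \<Longrightarrow> \<beta> a = of_nat (wt m (l a) (\<sigma> (l a))) * \<gamma> (\<pi> a)"
    using supp_label[OF assms] by blast
  define I where "I k = l ` orb ` {..<k}" for k
  have injl: "inj_on (l \<circ> orb) {..<k}" if "k \<le> K" for k
  proof (rule comp_inj_on)
    show "inj_on orb {..<k}" by (rule inj_on_subset[OF inj_orb]) (use that in auto)
    show "inj_on l (orb ` {..<k})"
      by (rule inj_on_subset[OF bij_betw_imp_inj_on[OF l(1)]]) (use moved that in auto)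
  qed
  \<comment> \<open>The weights telescope: at the points strictly between the ends, row and column
    weight agree by \<open>const\<close>.\<close>
  have path: "\<beta> (n - 1) = (\<Prod>j<k. of_nat (wt m (l (orb j)) (\<sigma> (l (orb j))))) * \<gamma> (orb k)"
    if "k \<le> K" "0 < k" for k using that
  proof (induction k)
    case (Suc k)
    show ?case
    proof (cases "k = 0")
      case True
      then show ?thesis using l(2)[OF moved[of 0]] K orb0 orbS[of 0] by simp
    next
      case False
      then have "\<gamma> (orb k) = \<beta> (orb k)" using Kmin[of k] const Suc.prems by simp
      then show ?thesis using Suc l(2)[OF moved[of k]] False by (simp add: orbS)
    qed
  qed simp
  have I: "I k \<subseteq> {0..<m} \<and> card (I k) = k \<and>
       \<beta> (n - 1) = (\<Prod>i\<in>I k. of_nat (wt m i (\<sigma> i))) * \<gamma> (orb k)" if k: "k \<le> K" "0 < k" for k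
  proof (intro conjI)
    show "I k \<subseteq> {0..<m}" unfolding I_def using l(1) moved k by (auto simp: bij_betw_def)
    show "card (I k) = k" unfolding I_def image_image using card_image[OF injl[OF k(1)]] by (simp add: comp_def)
    have "(\<Prod>i\<in>I k. of_nat (wt m i (\<sigma> i)) :: complex) =
       (\<Prod>j<k. of_nat (wt m (l (orb j)) (\<sigma> (l (orb j)))))"
      unfolding I_def image_image
      using prod.reindex[OF injl[OF k(1)], of "\<lambda>i. of_nat (wt m i (\<sigma> i)) :: complex"] by (simp add: comp_def)
    then show "\<beta> (n - 1) = (\<Prod>i\<in>I k. of_nat (wt m i (\<sigma> i))) * \<gamma> (orb k)" using path[OF k] by simp
  qed
  \<comment> \<open>The \<open>K\<close> path points before the return and the \<open>n - q\<close>
    indices outside the block are all moved, and they share at most the starting point. This is the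
    source of the 1 in \<open>Suc m\<close>.\<close>
  have count: "K + card {q..<n} \<le> Suc m"
  proof -
    have sub: "orb ` {..<K} \<union> {q..<n} \<subseteq> moved \<pi>" using moved by (auto simp: moved_def)
    have int: "orb ` {..<K} \<inter> {q..<n} \<subseteq> {n - 1}"
    proof
      fix a assume "a \<in> orb ` {..<K} \<inter> {q..<n}"
      then obtain k where "a = orb k" "k < K" "q \<le> orb k" by auto
      then have "k = 0" using Kmin[of k] by (cases k) auto
      then show "a \<in> {n - 1}" using \<open>a = orb k\<close> orb0 by simp
    qed
    have "K + card {q..<n} = card (orb ` {..<K}) + card {q..<n}" using card_image[OF inj_orb] by simp
    also have "\<dots> = card (orb ` {..<K} \<union> {q..<n}) + card (orb ` {..<K} \<inter> {q..<n})"
      by (rule card_Un_Int) auto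
    also have "\<dots> \<le> m + 1"
    proof (rule add_mono)
      have "finite (moved \<pi>)" by (simp add: moved_def)
      from card_mono[OF this sub] show "card (orb ` {..<K} \<union> {q..<n}) \<le> m" using card_moved[OF assms] by simp
      show "card (orb ` {..<K} \<inter> {q..<n}) \<le> 1" using card_mono[OF _ int] by simp
    qed
    finally show ?thesis by simp
  qed
  show ?thesis using K orbn I count unfolding orb_def by blast
qed

section \<open>Corank one, and the exclusion of intermediate coranks\<close>

lemma wt_eq_imp:
  assumes "(of_nat (wt m i j) :: complex) = of_nat (wt m i' j')" "i < m" "i' < m"
  shows "i = i' \<and> j = j'"
proof -
  have "{i} = {i'} \<and> (\<lambda>_. j) ` {i} = (\<lambda>_. j') ` {i'}"
    by (rule wt_prod_eq_imp[of _ m]) (use assms in auto)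
  then show ?thesis by simp
qed

lemma wt_prod_mult_eq_imp:
  assumes "I \<subseteq> {0..<m}" "I' \<subseteq> {0..<m}" "a < n"
    and "x = (\<Prod>i\<in>I. of_nat (wt m i (\<sigma> i))) * \<gamma> a" "x = (\<Prod>i\<in>I'. of_nat (wt m i (\<tau> i))) * \<gamma> a"
  shows "I = I' \<and> \<sigma> ` I = \<tau> ` I'"
proof (rule wt_prod_eq_imp[OF assms(1,2)])
  have "(\<Prod>i\<in>I. of_nat (wt m i (\<sigma> i))) * \<gamma> a = (\<Prod>i\<in>I'. of_nat (wt m i (\<tau> i))) * \<gamma> a"
    using assms(4) unfolding assms(5) by (rule sym)
  then show "(\<Prod>i\<in>I. of_nat (wt m i (\<sigma> i)) :: complex) = (\<Prod>i\<in>I'. of_nat (wt m i (\<tau> i)))"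
    using nz(2)[OF assms(3)] by simp
qed

text \<open>The path can only return to its start, and the product identity then forces it to use
  all \<open>m\<close> variables. It can therefore be observed after exactly \<open>k\<close> steps.
  At most k! (m - k)! permutations are observed at the same index, which leaves at least
  \<open>m choose k\<close> indices.\<close>

lemma choose_le_if_corank_1:
  assumes q: "q = n - 1"
  shows "m choose k \<le> n"
proof (cases "0 < k \<and> k \<le> m")
  case True
  have n0: "0 < n" using q_less by simp
  have ex: "\<exists>a I. a < n \<and> I \<subseteq> {0..<m} \<and> card I = k \<and>
      \<beta> (n - 1) = (\<Prod>i\<in>I. of_nat (wt m i (\<sigma> i))) * \<gamma> a" if \<sigma>: "\<sigma> permutes {0..<m}" for \<sigma>
  proof -
    obtain \<pi> where \<pi>: "supp \<sigma> \<pi>" using ex_supp[OF \<sigma>] .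
    obtain K I where path: "0 < K \<and> q \<le> (\<pi> ^^ K) (n - 1) \<and> (\<forall>k. (\<pi> ^^ k) (n - 1) < n) \<and> K + card {q..<n} \<le> Suc m \<and>
      (\<forall>k. 0 < k \<longrightarrow> k \<le> K \<longrightarrow> I k \<subseteq> {0..<m} \<and> card (I k) = k \<and>
        \<beta> (n - 1) = (\<Prod>i\<in>I k. of_nat (wt m i (\<sigma> i))) * \<gamma> ((\<pi> ^^ k) (n - 1)))"
      using supp_path[OF \<sigma> \<pi>] by (elim exE) (rule that)
    then have K: "0 < K" "q \<le> (\<pi> ^^ K) (n - 1)" and orb: "\<And>k. (\<pi> ^^ k) (n - 1) < n"
      and I: "\<And>k. 0 < k \<Longrightarrow> k \<le> K \<Longrightarrow> I k \<subseteq> {0..<m} \<and> card (I k) = k \<and>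
       \<beta> (n - 1) = (\<Prod>i\<in>I k. of_nat (wt m i (\<sigma> i))) * \<gamma> ((\<pi> ^^ k) (n - 1))"
      and c: "K + card {q..<n} \<le> Suc m"
      by simp_all
    have "(\<pi> ^^ K) (n - 1) = n - 1" using K(2) orb[of K] q by simp
    then have 1: "\<beta> (n - 1) = (\<Prod>i\<in>I K. of_nat (wt m i (\<sigma> i))) * \<gamma> (n - 1)" using I[of K] K(1) by simp
    have split: "{0..<n} = insert (n - 1) {0..<n - 1}" using n0 by auto
    \<comment> \<open>Only the last index escapes \<open>const\<close>, so \<open>total\<close>
      collapses to a relation between its two weights.\<close>
    have "\<beta> (n - 1) * (\<Prod>a=0..<n - 1. \<gamma> a) = \<beta> (n - 1) * (\<Prod>a=0..<n - 1. \<beta> a)"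
      using const q by simp
    also have "\<dots> = (\<Prod>a=0..<n. \<beta> a)" unfolding split by simp
    also have "\<dots> = (\<Prod>i=0..<m. of_nat (wt m i i)) * \<gamma> (n - 1) * (\<Prod>a=0..<n - 1. \<gamma> a)"
      unfolding total unfolding split by simp
    finally have "\<beta> (n - 1) = (\<Prod>i=0..<m. of_nat (wt m i i)) * \<gamma> (n - 1)" using nz by simp
    with 1 have "(\<Prod>i\<in>I K. of_nat (wt m i (\<sigma> i)) :: complex) = (\<Prod>i=0..<m. of_nat (wt m i i))"
      using nz n0 by simp
    from wt_prod_eq_imp[OF _ _ this] have "I K = {0..<m}" using I[of K] K(1) by simp
    then have "K = m" using I[of K] K(1) by simp
    then show ?thesis using I[of k] orb[of k] True
      by (intro exI[of _ "(\<pi> ^^ k) (n - 1)"] exI[of _ "I k"]) simp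
  qed
  define W where "W \<sigma> = (SOME z. fst z < n \<and> snd z \<subseteq> {0..<m} \<and> card (snd z) = k \<and>
      \<beta> (n - 1) = (\<Prod>i\<in>snd z. of_nat (wt m i (\<sigma> i))) * \<gamma> (fst z))" for \<sigma>
  define f I where "f \<sigma> = fst (W \<sigma>)" and "I \<sigma> = snd (W \<sigma>)" for \<sigma>
  have fI: "f \<sigma> < n \<and> I \<sigma> \<subseteq> {0..<m} \<and> card (I \<sigma>) = k \<and>
      \<beta> (n - 1) = (\<Prod>i\<in>I \<sigma>. of_nat (wt m i (\<sigma> i))) * \<gamma> (f \<sigma>)" if "\<sigma> permutes {0..<m}" for \<sigma>
    unfolding f_def I_def W_def by (rule someI_ex) (use ex[OF that] in simp)
  have "fact m \<le> card {0..<n} * (fact k * fact (m - k))"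
  proof (rule fact_le_card_mult[where f = f and I = I])
    fix \<sigma> \<tau> assume st: "\<sigma> permutes {0..<m}" "\<tau> permutes {0..<m}" "f \<sigma> = f \<tau>"
    show "I \<sigma> = I \<tau> \<and> \<sigma> ` I \<sigma> = \<tau> ` I \<tau>"
    proof (rule wt_prod_mult_eq_imp[of _ _ "f \<sigma>" "\<beta> (n - 1)"])
      show "\<beta> (n - 1) = (\<Prod>i\<in>I \<tau>. of_nat (wt m i (\<tau> i))) * \<gamma> (f \<sigma>)"
        unfolding st(3) using fI[OF st(2)] by blast
      show "\<beta> (n - 1) = (\<Prod>i\<in>I \<sigma>. of_nat (wt m i (\<sigma> i))) * \<gamma> (f \<sigma>)"
        using fI[OF st(1)] by blast
    qed (use fI[OF st(1)] fI[OF st(2)] in simp_all)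
  next
    fix \<sigma> assume s: "\<sigma> permutes {0..<m}"
    show "f \<sigma> \<in> {0..<n}" "I \<sigma> \<subseteq> {0..<m}" "fact (card (I \<sigma>)) * fact (m - card (I \<sigma>)) \<le> (fact k * fact (m - k) :: nat)"
      using fI[OF s] by simp_all
  qed simp
  then have "fact k * fact (m - k) * (m choose k) \<le> fact k * fact (m - k) * n"
    using binomial_fact_lemma[of k m] True by (simp add: mult.commute)
  then show ?thesis by simp
next
  case False
  then show ?thesis using q_less by (cases "k = 0") (auto simp: binomial_eq_0)
qed

text \<open>For a corank r strictly between, the length of a path is at most m + 1 - r, hence
  between 1 and m - 1. Paths end at one of r indices, and at most (m - 1)! permutations share an
  end, so m! \<le> r (m - 1)!, which contradicts r < m.\<close>

lemma corank_dichotomy: "n - q = 1 \<or> n - q = m"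
proof (rule ccontr)
  assume "\<not> ?thesis"
  then have r: "1 < n - q" "n - q < m" using q_less corank_le by auto
  have n0: "0 < n" using q_less by simp
  have ex: "\<exists>a I. a \<in> {q..<n} \<and> I \<subseteq> {0..<m} \<and> 0 < card I \<and> card I < m \<and>
      \<beta> (n - 1) = (\<Prod>i\<in>I. of_nat (wt m i (\<sigma> i))) * \<gamma> a" if \<sigma>: "\<sigma> permutes {0..<m}" for \<sigma>
  proof -
    obtain \<pi> where \<pi>: "supp \<sigma> \<pi>" using ex_supp[OF \<sigma>] .
    obtain K I where path: "0 < K \<and> q \<le> (\<pi> ^^ K) (n - 1) \<and> (\<forall>k. (\<pi> ^^ k) (n - 1) < n) \<and> K + card {q..<n} \<le> Suc m \<and>
      (\<forall>k. 0 < k \<longrightarrow> k \<le> K \<longrightarrow> I k \<subseteq> {0..<m} \<and> card (I k) = k \<and>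
        \<beta> (n - 1) = (\<Prod>i\<in>I k. of_nat (wt m i (\<sigma> i))) * \<gamma> ((\<pi> ^^ k) (n - 1)))"
      using supp_path[OF \<sigma> \<pi>] by (elim exE) (rule that)
    then have K: "0 < K" "q \<le> (\<pi> ^^ K) (n - 1)" and orb: "\<And>k. (\<pi> ^^ k) (n - 1) < n"
      and I: "\<And>k. 0 < k \<Longrightarrow> k \<le> K \<Longrightarrow> I k \<subseteq> {0..<m} \<and> card (I k) = k \<and>
       \<beta> (n - 1) = (\<Prod>i\<in>I k. of_nat (wt m i (\<sigma> i))) * \<gamma> ((\<pi> ^^ k) (n - 1))"
      and c: "K + card {q..<n} \<le> Suc m"
      by simp_all
    have "K < m" using c r by simp
    then show ?thesis using I[of K] K orb[of K] by (intro exI[of _ "(\<pi> ^^ K) (n - 1)"] exI[of _ "I K"]) auto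
  qed
  define W where "W \<sigma> = (SOME z. fst z \<in> {q..<n} \<and> snd z \<subseteq> {0..<m} \<and> 0 < card (snd z) \<and>
      card (snd z) < m \<and> \<beta> (n - 1) = (\<Prod>i\<in>snd z. of_nat (wt m i (\<sigma> i))) * \<gamma> (fst z))" for \<sigma>
  define f I where "f \<sigma> = fst (W \<sigma>)" and "I \<sigma> = snd (W \<sigma>)" for \<sigma>
  have fI: "f \<sigma> \<in> {q..<n} \<and> I \<sigma> \<subseteq> {0..<m} \<and> 0 < card (I \<sigma>) \<and>
      card (I \<sigma>) < m \<and> \<beta> (n - 1) = (\<Prod>i\<in>I \<sigma>. of_nat (wt m i (\<sigma> i))) * \<gamma> (f \<sigma>)" if "\<sigma> permutes {0..<m}" for \<sigma>
    unfolding f_def I_def W_def by (rule someI_ex) (use ex[OF that] in simp)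
  have "fact m \<le> card {q..<n} * fact (m - 1)"
  proof (rule fact_le_card_mult[where f = f and I = I])
    fix \<sigma> assume "\<sigma> permutes {0..<m}"
    from fI[OF this] show "fact (card (I \<sigma>)) * fact (m - card (I \<sigma>)) \<le> (fact (m - 1) :: nat)"
      by (intro fact_mult_fact_le) auto
  next
    fix \<sigma> \<tau> assume st: "\<sigma> permutes {0..<m}" "\<tau> permutes {0..<m}" "f \<sigma> = f \<tau>"
    show "I \<sigma> = I \<tau> \<and> \<sigma> ` I \<sigma> = \<tau> ` I \<tau>"
    proof (rule wt_prod_mult_eq_imp[of _ _ "f \<sigma>" "\<beta> (n - 1)"])
      show "\<beta> (n - 1) = (\<Prod>i\<in>I \<tau>. of_nat (wt m i (\<tau> i))) * \<gamma> (f \<sigma>)"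
        unfolding st(3) using fI[OF st(2)] by blast
      show "\<beta> (n - 1) = (\<Prod>i\<in>I \<sigma>. of_nat (wt m i (\<sigma> i))) * \<gamma> (f \<sigma>)"
        using fI[OF st(1)] by blast
    qed (use fI[OF st(1)] fI[OF st(2)] in simp_all)
  next
    fix \<sigma> assume s: "\<sigma> permutes {0..<m}"
    show "f \<sigma> \<in> {q..<n}" "I \<sigma> \<subseteq> {0..<m}"
      using fI[OF s] by simp_all
  qed simp
  moreover have "fact m = m * (fact (m - 1) :: nat)" using m by (simp add: fact_reduce)
  ultimately have "m \<le> n - q" by simp
  then show False using r by simp
qed

section \<open>Corank equal to the degree\<close>

lemma supp_corank_max:
  assumes r: "n - q = m" and \<sigma>: "\<sigma> permutes {0..<m}" and \<pi>: "supp \<sigma> \<pi>"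
  shows "moved \<pi> = {q..<n}" "\<pi> permutes {q..<n}"
proof -
  have "{q..<n} = moved \<pi>"
    by (rule card_subset_eq) (use card_moved[OF \<sigma> \<pi>] r in \<open>auto simp: moved_def\<close>)
  then show mv: "moved \<pi> = {q..<n}" by simp
  have "\<pi> permutes {0..<n}" using \<pi> by (simp add: supp_def)
  then show "\<pi> permutes {q..<n}"
  proof (rule permutes_superset)
    fix a assume "a \<in> {0..<n} - {q..<n}"
    then have "a < n" "a \<notin> moved \<pi>" using mv by auto
    then show "\<pi> a = a" by (simp add: moved_def)
  qed
qed

text \<open>The ratio of row weight to column weight at a moved position determines the variable
  standing there. Since the labels exhaust all rows, \<pi> determines \<sigma>.\<close>

lemma supp_inj:
  assumes \<sigma>: "\<sigma> permutes {0..<m}" "\<sigma>' permutes {0..<m}" and \<pi>: "supp \<sigma> \<pi>" "supp \<sigma>' \<pi>"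
  shows "\<sigma> = \<sigma>'"
proof
  fix i
  obtain l where l: "bij_betw l (moved \<pi>) {0..<m}"
    "\<And>a. a \<in> moved \<pi> \<Longrightarrow> \<beta> a = of_nat (wt m (l a) (\<sigma> (l a))) * \<gamma> (\<pi> a)"
    using supp_label[OF \<sigma>(1) \<pi>(1)] by blast
  obtain l' where l': "bij_betw l' (moved \<pi>) {0..<m}"
    "\<And>a. a \<in> moved \<pi> \<Longrightarrow> \<beta> a = of_nat (wt m (l' a) (\<sigma>' (l' a))) * \<gamma> (\<pi> a)"
    using supp_label[OF \<sigma>(2) \<pi>(2)] by blast
  show "\<sigma> i = \<sigma>' i"
  proof (cases "i < m")
    case True
    then have "i \<in> l ` moved \<pi>" using l(1) by (simp add: bij_betw_def)
    then obtain a where a: "a \<in> moved \<pi>" "l a = i" by auto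
    have "a < n" using a by (simp add: moved_def)
    then have "\<pi> a < n" using \<pi>(1) permutes_in_image[of \<pi> "{0..<n}" a] by (auto simp: supp_def)
    then have "(of_nat (wt m i (\<sigma> i)) :: complex) = of_nat (wt m (l' a) (\<sigma>' (l' a)))"
      using l(2)[OF a(1)] l'(2)[OF a(1)] a(2) nz(2)[of "\<pi> a"] by simp
    moreover have "l' a < m" using l'(1) a(1) by (auto simp: bij_betw_def)
    ultimately have "i = l' a \<and> \<sigma> i = \<sigma>' (l' a)" using True wt_eq_imp by blast
    then show ?thesis by auto
  next
    case False
    then show ?thesis using \<sigma> by (simp add: permutes_def)
  qed
qed

text \<open>For indices below \<open>n\<close> the grading leaves at most one nonzero summand, so
  this is the coefficient of the only variable that can occur at the position. Summing over all
  variables makes it independent of \<sigma>.\<close>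

definition entry :: "nat \<Rightarrow> nat \<Rightarrow> complex" where
  "entry a b = (\<Sum>i=0..<m. \<Sum>j=0..<m. M i j a b)"

lemma X_eq_entry:
  assumes \<sigma>: "\<sigma> permutes {0..<m}" and \<pi>: "supp \<sigma> \<pi>" and a: "a \<in> moved \<pi>"
  shows "X \<sigma> a (\<pi> a) = entry a (\<pi> a)"
proof -
  obtain l where l: "bij_betw l (moved \<pi>) {0..<m}"
    "\<And>a. a \<in> moved \<pi> \<Longrightarrow> \<beta> a = of_nat (wt m (l a) (\<sigma> (l a))) * \<gamma> (\<pi> a)"
    using supp_label[OF \<sigma> \<pi>] by blast
  have an: "a < n" using a by (simp add: moved_def)
  then have pn: "\<pi> a < n" using \<pi> permutes_in_image[of \<pi> "{0..<n}" a] by (auto simp: supp_def)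
  have la: "l a < m" using l(1) a by (auto simp: bij_betw_def)
  have sm: "\<sigma> i < m" if "i < m" for i using permutes_in_image[OF \<sigma>, of i] that by simp
  have zero: "M i j a (\<pi> a) = 0" if "i < m" "j < m" "\<not> (i = l a \<and> j = \<sigma> (l a))" for i j
  proof (rule ccontr)
    assume "M i j a (\<pi> a) \<noteq> 0"
    then have "(of_nat (wt m i j) :: complex) = of_nat (wt m (l a) (\<sigma> (l a)))"
      using graded[OF that(1,2) an pn] l(2)[OF a] nz(2)[OF pn] by simp
    then show False using wt_eq_imp[OF _ that(1) la] that(3) by blast
  qed
  have "(\<Sum>i=0..<m. M i (\<sigma> i) a (\<pi> a)) = (\<Sum>i=0..<m. if i = l a then M i (\<sigma> i) a (\<pi> a) else 0)"
    using zero sm by (intro sum.cong) auto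
  moreover have "entry a (\<pi> a) = (\<Sum>i=0..<m. if i = l a then M i (\<sigma> i) a (\<pi> a) else 0)"
    unfolding entry_def
  proof (rule sum.cong)
    fix i assume i: "i \<in> {0..<m}"
    have "(\<Sum>j=0..<m. M i j a (\<pi> a)) = (\<Sum>j=0..<m. if j = \<sigma> i then (if i = l a then M i (\<sigma> i) a (\<pi> a) else 0) else 0)"
      using zero i by (intro sum.cong) auto
    also have "\<dots> = (if i = l a then M i (\<sigma> i) a (\<pi> a) else 0)" using sm i by simp
    finally show "(\<Sum>j=0..<m. M i j a (\<pi> a)) = (if i = l a then M i (\<sigma> i) a (\<pi> a) else 0)" .
  qed simp
  moreover have "\<not> (a = \<pi> a \<and> a < q)" using a by (auto simp: moved_def)
  ultimately show ?thesis by (simp add: X_def)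
qed

text \<open>Equal row and column weight would force a variable occurring there to have weight
  1.\<close>

lemma X_diag:
  assumes \<sigma>: "\<sigma> permutes {0..<m}" and a: "a < q"
  shows "X \<sigma> a a = 1"
proof -
  have an: "a < n" using a q_less by simp
  have "M i (\<sigma> i) a a = 0" if i: "i < m" for i
  proof (rule ccontr)
    assume nz': "M i (\<sigma> i) a a \<noteq> 0"
    have "\<sigma> i < m" using permutes_in_image[OF \<sigma>, of i] i by simp
    from graded[OF i this an an nz'] show False using const[OF a] nz(2)[OF an] wt_neq_1 by simp
  qed
  then show ?thesis using a by (simp add: X_def)
qed

text \<open>Sending \<sigma> to a supporting \<pi> is injective between sets of size m!, hence
  bijective. So every \<pi> belongs to one \<sigma>, whose determinant \<kappa> consists of this
  single Leibniz term. In other words, all m! terms of one fixed m by m matrix are equal once signs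
  are included.\<close>

lemma sign_mult_entries:
  assumes r: "n - q = m" and \<pi>: "\<pi> permutes {q..<n}"
  shows "signof \<pi> * (\<Prod>a=q..<n. entry a (\<pi> a)) = \<kappa>"
proof -
  let ?S = "{\<sigma>. \<sigma> permutes {0..<m}}" and ?P = "{\<pi>. \<pi> permutes {q..<n}}"
  define F where "F \<sigma> = (SOME \<pi>. supp \<sigma> \<pi>)" for \<sigma>
  have F: "supp \<sigma> (F \<sigma>)" if "\<sigma> \<in> ?S" for \<sigma>
  proof -
    have "\<sigma> permutes {0..<m}" using that by simp
    then obtain \<pi> where "supp \<sigma> \<pi>" by (rule ex_supp)
    then show ?thesis unfolding F_def by (rule someI[of "supp \<sigma>"])
  qed
  have "inj_on F ?S"
  proof (rule inj_onI)
    fix \<sigma> \<tau> assume st: "\<sigma> \<in> ?S" "\<tau> \<in> ?S" "F \<sigma> = F \<tau>"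
    then show "\<sigma> = \<tau>" using supp_inj[of \<sigma> \<tau> "F \<sigma>"] F[of \<sigma>] F[of \<tau>] by simp
  qed
  moreover have sub: "F ` ?S \<subseteq> ?P" using F supp_corank_max(2)[OF r] by blast
  ultimately have "F ` ?S = ?P"
    using r by (intro card_subset_eq) (auto simp: card_image card_permutations finite_permutations)
  then have "\<pi> \<in> F ` ?S" using \<pi> by blast
  then obtain \<sigma> where \<sigma>: "\<sigma> permutes {0..<m}" "F \<sigma> = \<pi>" by blast
  have supp: "supp \<sigma> \<pi>" using F[of \<sigma>] \<sigma> by simp
  have uniq: "\<pi>' = \<pi>" if s: "supp \<sigma> \<pi>'" for \<pi>'
  proof -
    have "\<pi>' \<in> F ` ?S" using \<open>F ` ?S = ?P\<close> supp_corank_max(2)[OF r \<sigma>(1) s] by blast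
    then obtain \<tau> where t: "\<tau> permutes {0..<m}" "F \<tau> = \<pi>'" by blast
    have "\<sigma> = \<tau>" using supp_inj[OF \<sigma>(1) t(1) s] F[of \<tau>] t by simp
    then show ?thesis using \<sigma> t by simp
  qed
  have pn: "\<pi> permutes {0..<n}" using supp by (simp add: supp_def)
  have "\<kappa> = (\<Sum>\<pi>' | \<pi>' permutes {0..<n}. signof \<pi>' * (\<Prod>a = 0..<n. X \<sigma> a (\<pi>' a)))"
    by (rule det_eq_sum[OF \<sigma>(1)])
  also have "\<dots> = (\<Sum>\<pi>' \<in> {\<pi>}. signof \<pi>' * (\<Prod>a = 0..<n. X \<sigma> a (\<pi>' a)))"
  proof (rule sum.mono_neutral_right)
    show "\<forall>\<pi>'\<in>{\<pi>'. \<pi>' permutes {0..<n}} - {\<pi>}. signof \<pi>' * (\<Prod>a = 0..<n. X \<sigma> a (\<pi>' a)) = 0"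
    proof
      fix \<pi>' assume p: "\<pi>' \<in> {\<pi>'. \<pi>' permutes {0..<n}} - {\<pi>}"
      then have "\<not> supp \<sigma> \<pi>'" using uniq by blast
      then obtain a where "a < n" "X \<sigma> a (\<pi>' a) = 0" using p by (auto simp: supp_def)
      then have "(\<Prod>a = 0..<n. X \<sigma> a (\<pi>' a)) = 0" by (intro prod_zero) auto
      then show "signof \<pi>' * (\<Prod>a = 0..<n. X \<sigma> a (\<pi>' a)) = 0" by simp
    qed
  qed (use pn in \<open>auto simp: finite_permutations\<close>)
  also have "\<dots> = signof \<pi> * (\<Prod>a = 0..<n. X \<sigma> a (\<pi> a))" by simp
  also have "(\<Prod>a = 0..<n. X \<sigma> a (\<pi> a)) = (\<Prod>a = 0..<q. X \<sigma> a (\<pi> a)) * (\<Prod>a = q..<n. X \<sigma> a (\<pi> a))"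
    using q_less by (simp add: prod.atLeastLessThan_concat)
  also have "(\<Prod>a = 0..<q. X \<sigma> a (\<pi> a)) = 1"
    using X_diag[OF \<sigma>(1)] \<pi> by (intro prod.neutral) (auto simp: permutes_def)
  also have "(\<Prod>a = q..<n. X \<sigma> a (\<pi> a)) = (\<Prod>a = q..<n. entry a (\<pi> a))"
    using X_eq_entry[OF \<sigma>(1) supp] supp_corank_max(1)[OF r \<sigma>(1) supp] by (intro prod.cong) auto
  finally show ?thesis by simp
qed

text \<open>The three even and the three odd permutations of three indices use the same nine entries, so
  their six terms cannot all be equal once signs are included: this is where the permanent differs
  from the determinant.\<close>

lemma corank_max_imp_le_2:
  assumes r: "n - q = m"
  shows "m \<le> 2"
proof (rule ccontr)
  assume "\<not> m \<le> 2"
  then have m3: "q + 2 < n" using r by simp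
  \<comment> \<open>Only permutations of the first three indices of the block are compared; the
    remaining diagonal entries form a common factor.\<close>
  define R where "R = (\<Prod>a=q+3..<n. entry a a)"
  have G: "signof \<pi> * (entry q (\<pi> q) * entry (q+1) (\<pi> (q+1)) * entry (q+2) (\<pi> (q+2)) * R) = \<kappa>"
    if p: "\<pi> permutes {q, q+1, q+2}" for \<pi>
  proof -
    have "\<pi> permutes {q..<n}" by (rule permutes_subset[OF p]) (use m3 in auto)
    note e = sign_mult_entries[OF r this]
    have "{q..<n} = insert q (insert (q+1) (insert (q+2) {q+3..<n}))" using m3 by auto
    then have "(\<Prod>a=q..<n. entry a (\<pi> a)) =
      entry q (\<pi> q) * (entry (q+1) (\<pi> (q+1)) * (entry (q+2) (\<pi> (q+2)) * (\<Prod>a=q+3..<n. entry a (\<pi> a))))"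
      by simp
    also have "(\<Prod>a=q+3..<n. entry a (\<pi> a)) = R"
      unfolding R_def using p by (intro prod.cong) (auto simp: permutes_def)
    finally show ?thesis using e by (simp add: mult.assoc)
  qed
  let ?u = q and ?v = "q + 1" and ?w = "q + 2"
  let ?t = "Transposition.transpose :: nat \<Rightarrow> nat \<Rightarrow> nat \<Rightarrow> nat"
  have tr: "?t a b permutes {q, q+1, q+2}" if "a \<in> {q, q+1, q+2}" "b \<in> {q, q+1, q+2}" for a b
    using that by (rule permutes_swap_id)
  have s: "signof (?t a b) = (-1 :: complex)" if "a \<noteq> b" for a b
    using that by (simp add: sign_swap_id)
  have sc: "signof (?t a b \<circ> ?t c d) = (1 :: complex)" if "a \<noteq> b" "c \<noteq> d" for a b c d
    using that by (simp add: sign_compose permutation_swap_id sign_swap_id)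
  note G1 = G[OF permutes_id]
    and G2 = G[OF permutes_compose[OF tr[of ?u ?v] tr[of ?v ?w]]]
    and G3 = G[OF permutes_compose[OF tr[of ?v ?w] tr[of ?u ?v]]]
    and G4 = G[OF tr[of ?u ?v]] and G5 = G[OF tr[of ?v ?w]] and G6 = G[OF tr[of ?u ?w]]
  have "\<kappa> * \<kappa> * \<kappa> = - (\<kappa> * \<kappa> * \<kappa>)"
  proof -
    have "\<kappa> * \<kappa> * \<kappa> =
       (entry ?u ?u * entry ?v ?v * entry ?w ?w * R) *
       (entry ?u ?v * entry ?v ?w * entry ?w ?u * R) *
       (entry ?u ?w * entry ?v ?u * entry ?w ?v * R)"
      using G1 G2 G3 by (simp add: sc Transposition.transpose_def)
    also have "\<dots> = 
       (entry ?u ?v * entry ?v ?u * entry ?w ?w * R) *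
       (entry ?u ?u * entry ?v ?w * entry ?w ?v * R) *
       (entry ?u ?w * entry ?v ?v * entry ?w ?u * R)" by (simp add: mult_ac)
    also have "\<dots> = (- \<kappa>) * (- \<kappa>) * (- \<kappa>)"
    proof (intro arg_cong2[of _ _ _ _ "(*)"])
      show "entry ?u ?v * entry ?v ?u * entry ?w ?w * R = - \<kappa>"
        using arg_cong[OF G4, of uminus] by (simp add: s Transposition.transpose_def)
      show "entry ?u ?u * entry ?v ?w * entry ?w ?v * R = - \<kappa>"
        using arg_cong[OF G5, of uminus] by (simp add: s Transposition.transpose_def)
      show "entry ?u ?w * entry ?v ?v * entry ?w ?u * R = - \<kappa>"
        using arg_cong[OF G6, of uminus] by (simp add: s Transposition.transpose_def)
    qed
    also have "\<dots> = - (\<kappa> * \<kappa> * \<kappa>)" by simp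
    finally show ?thesis .
  qed
  then show False using \<kappa> by simp
qed

theorem choose_le_size:
  assumes "3 \<le> m"
  shows "m choose k \<le> n"
  using corank_dichotomy corank_max_imp_le_2 choose_le_if_corank_1[of k] assms by fastforce

end

section \<open>Graded rank normal form\<close>

text \<open>The matrices of degree-preserving maps between graded spaces. The type of weights is
  arbitrary, so that the trivial grading is available too.\<close>

definition graded :: "nat \<Rightarrow> (nat \<Rightarrow> 'w) \<Rightarrow> (nat \<Rightarrow> 'w) \<Rightarrow> 'a::zero mat \<Rightarrow> bool" where
  "graded n \<beta> \<gamma> A \<longleftrightarrow> A \<in> carrier_mat n n \<and> (\<forall>i<n. \<forall>j<n. A $$ (i,j) \<noteq> 0 \<longrightarrow> \<beta> i = \<gamma> j)"

lemma gradedD: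
  assumes "graded n \<beta> \<gamma> A"
  shows "A \<in> carrier_mat n n" "i < n \<Longrightarrow> j < n \<Longrightarrow> A $$ (i,j) \<noteq> 0 \<Longrightarrow> \<beta> i = \<gamma> j"
  using assms by (auto simp: graded_def)

lemma graded_one: "graded n \<beta> \<beta> (1\<^sub>m n :: 'a::{zero,one} mat)"
  by (simp add: graded_def)

lemma mult_carrier_mat_square:
  "A \<in> carrier_mat n n \<Longrightarrow> B \<in> carrier_mat n n \<Longrightarrow> A * B \<in> carrier_mat n n"
  by (rule mult_carrier_mat)

lemma mult_mat_index:
  assumes "A \<in> carrier_mat n n" "B \<in> carrier_mat n n" "i < n" "j < n"
  shows "(A * B) $$ (i,j) = (\<Sum>l=0..<n. A $$ (i,l) * B $$ (l,j))"
  using assms by (auto simp: scalar_prod_def)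

lemma graded_mult:
  assumes A: "graded n \<beta> \<gamma> (A :: 'a::semiring_0 mat)" and B: "graded n \<gamma> \<delta> B"
  shows "graded n \<beta> \<delta> (A * B)"
  unfolding graded_def
proof (intro conjI allI impI)
  show "A * B \<in> carrier_mat n n" using gradedD(1)[OF A] gradedD(1)[OF B] by simp
  fix i j assume ij: "i < n" "j < n" "(A * B) $$ (i,j) \<noteq> 0"
  then have "(\<Sum>l=0..<n. A $$ (i,l) * B $$ (l,j)) \<noteq> 0"
    using mult_mat_index[OF gradedD(1)[OF A] gradedD(1)[OF B]] by simp
  then obtain l where "l \<in> {0..<n}" "A $$ (i,l) * B $$ (l,j) \<noteq> 0"
    by (rule sum.not_neutral_contains_not_neutral)
  then have l: "l < n" "A $$ (i,l) \<noteq> 0" "B $$ (l,j) \<noteq> 0" by auto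
  show "\<beta> i = \<delta> j" using gradedD(2)[OF A ij(1) l(1,2)] gradedD(2)[OF B l(1) ij(2) l(3)] by simp
qed

lemma graded_comp:
  assumes "graded n \<beta> \<gamma> A"
  shows "graded n (\<lambda>i. h (\<beta> i)) (\<lambda>i. h (\<gamma> i)) A"
  using assms by (auto simp: graded_def)

text \<open>A nonzero Leibniz term of an invertible graded matrix matches row weights with column
  weights bijectively. Thus base changes do not disturb the product identity of the pencil.\<close>

lemma prod_weights_eq:
  fixes P :: "'a::idom mat" and \<beta> :: "nat \<Rightarrow> 'b::comm_monoid_mult"
  assumes P: "graded n \<beta>' \<beta> P" and d: "det P \<noteq> 0"
  shows "(\<Prod>i=0..<n. \<beta>' i) = (\<Prod>i=0..<n. \<beta> i)"
proof -
  obtain \<pi> where \<pi>: "\<pi> permutes {0..<n}" "\<And>i. i < n \<Longrightarrow> P $$ (i, \<pi> i) \<noteq> 0"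
    using det_nonzero_ex_term[OF gradedD(1)[OF P] d] by blast
  have "\<beta>' i = \<beta> (\<pi> i)" if "i < n" for i
    using gradedD(2)[OF P that _ \<pi>(2)[OF that]] permutes_in_image[OF \<pi>(1), of i] that by simp
  then have "(\<Prod>i=0..<n. \<beta>' i) = (\<Prod>i=0..<n. \<beta> (\<pi> i))" by simp
  also have "\<dots> = (\<Prod>i=0..<n. \<beta> i)" using prod.permute[OF \<pi>(1), of \<beta>] by (simp add: comp_def)
  finally show ?thesis .
qed

section \<open>Elimination within a grading\<close>

definition swap_mat :: "nat \<Rightarrow> nat \<Rightarrow> nat \<Rightarrow> 'a::{zero,one} mat" where
  "swap_mat n a b = mat n n (\<lambda>(i,j). if j = Transposition.transpose a b i then 1 else 0)"

lemma transpose_less: "a < n \<Longrightarrow> b < n \<Longrightarrow> i < n \<Longrightarrow> Transposition.transpose a b i < (n::nat)"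
  by (simp add: Transposition.transpose_def)

lemma swap_mat_carrier [simp]: "swap_mat n a b \<in> carrier_mat n n"
  by (simp add: swap_mat_def)

lemma swap_mat_mult_left:
  assumes A: "(A :: 'a::semiring_1 mat) \<in> carrier_mat n n" and "a < n" "b < n" "i < n" "j < n"
  shows "(swap_mat n a b * A) $$ (i,j) = A $$ (Transposition.transpose a b i, j)"
proof -
  have "(swap_mat n a b * A) $$ (i,j) = (\<Sum>l=0..<n. (if l = Transposition.transpose a b i then A $$ (l,j) else 0))"
    unfolding mult_mat_index[OF swap_mat_carrier A assms(4,5)]
    by (rule sum.cong) (use assms in \<open>auto simp: swap_mat_def\<close>)
  then show ?thesis using transpose_less[OF assms(2-4)] by simp
qed

lemma swap_mat_mult_right:
  assumes A: "(A :: 'a::semiring_1 mat) \<in> carrier_mat n n" and "a < n" "b < n" "i < n" "j < n"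
  shows "(A * swap_mat n a b) $$ (i,j) = A $$ (i, Transposition.transpose a b j)"
proof -
  have "(A * swap_mat n a b) $$ (i,j) = (\<Sum>l=0..<n. (if l = Transposition.transpose a b j then A $$ (i,l) else 0))"
    unfolding mult_mat_index[OF A swap_mat_carrier assms(4,5)]
    by (rule sum.cong) (use assms in \<open>auto simp: swap_mat_def\<close>)
  then show ?thesis using transpose_less[of a n b j] assms by simp
qed

lemma det_swap_mat:
  assumes "a < n" "b < n"
  shows "det (swap_mat n a b :: 'a::idom mat) \<noteq> 0"
proof -
  have "swap_mat n a b * swap_mat n a b = (1\<^sub>m n :: 'a mat)"
    using assms by (intro eq_matI)
      (auto simp: swap_mat_mult_left transpose_less, auto simp: swap_mat_def transpose_less)
  then have "det (swap_mat n a b :: 'a mat) * det (swap_mat n a b :: 'a mat) = 1"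
    by (metis det_mult det_one swap_mat_carrier)
  then show ?thesis by auto
qed

lemma graded_swap_mat_left:
  "a < n \<Longrightarrow> b < n \<Longrightarrow> graded n (\<lambda>i. \<beta> (Transposition.transpose a b i)) \<beta> (swap_mat n a b)"
  by (auto simp: graded_def swap_mat_def)

lemma graded_swap_mat_right:
  "a < n \<Longrightarrow> b < n \<Longrightarrow> graded n \<beta> (\<lambda>i. \<beta> (Transposition.transpose a b i)) (swap_mat n a b)"
  by (auto simp: graded_def swap_mat_def)

definition rank_mat :: "nat \<Rightarrow> nat \<Rightarrow> 'a::{zero,one} mat" where
  "rank_mat n q = mat n n (\<lambda>(i,j). if i = j \<and> i < q then 1 else 0)"

lemma rank_mat_carrier [simp]: "rank_mat n q \<in> carrier_mat n n"
  by (simp add: rank_mat_def)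

text \<open>Gauss elimination, with \<open>k\<close> pivots already placed, never mixes weights: a
  nonzero entry used to clear a row or a column sits between equal weights. Only the swaps change
  the weights, and they merely permute them.\<close>

lemma graded_rank_normal_form:
  fixes A :: "'a::field mat"
  assumes "graded n \<beta> \<gamma> A" "k \<le> n"
    and "\<And>i j. i < n \<Longrightarrow> j < n \<Longrightarrow> i < k \<or> j < k \<Longrightarrow> A $$ (i,j) = (if i = j then 1 else 0)"
  shows "\<exists>P Q \<beta>' \<gamma>' q. graded n \<beta>' \<beta> P \<and> det P \<noteq> 0 \<and> graded n \<gamma> \<gamma>' Q \<and> det Q \<noteq> 0 \<and>
     q \<le> n \<and> P * A * Q = rank_mat n q"
  using assms
proof (induction "n - k" arbitrary: k A \<beta> \<gamma>)
  case (0 k A \<beta> \<gamma>)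
  then have "A = rank_mat n n" by (intro eq_matI) (auto simp: rank_mat_def dest: gradedD(1))
  then have "1\<^sub>m n * A * 1\<^sub>m n = rank_mat n n" using 0 gradedD(1) by (metis left_mult_one_mat right_mult_one_mat)
  then show ?case using graded_one[of n] det_one[of n] by (metis order_refl zero_neq_one)
next
  case (Suc d k A \<beta> \<gamma>)
  have A: "A \<in> carrier_mat n n" using gradedD(1)[OF Suc.prems(1)] .
  show ?case
  proof (cases "\<exists>a b. k \<le> a \<and> a < n \<and> k \<le> b \<and> b < n \<and> A $$ (a,b) \<noteq> 0")
    case False
    then have "A = rank_mat n k" using A Suc.prems(3)
      by (intro eq_matI) (auto simp: rank_mat_def not_less, (metis not_le)+)
    then have "1\<^sub>m n * A * 1\<^sub>m n = rank_mat n k" using A by (metis left_mult_one_mat right_mult_one_mat)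
    then show ?thesis using graded_one[of n] det_one[of n] Suc.prems(2) by (metis zero_neq_one)
  next
    case True
    then obtain a b where ab: "k \<le> a" "a < n" "k \<le> b" "b < n" and piv: "A $$ (a,b) \<noteq> 0" by blast
    have k: "k < n" using ab by simp
    let ?S = "swap_mat n k a :: 'a mat" and ?T = "swap_mat n k b :: 'a mat"
    define A1 where "A1 = ?S * A * ?T"
    define \<beta>1 where "\<beta>1 i = \<beta> (Transposition.transpose k a i)" for i
    define \<gamma>1 where "\<gamma>1 i = \<gamma> (Transposition.transpose k b i)" for i
    have A1: "A1 \<in> carrier_mat n n" using A by (simp add: A1_def mult_carrier_mat_square)
    have gS: "graded n \<beta>1 \<beta> ?S" unfolding \<beta>1_def by (rule graded_swap_mat_left[OF k ab(2)])
    have gT: "graded n \<gamma> \<gamma>1 ?T" unfolding \<gamma>1_def by (rule graded_swap_mat_right[OF k ab(4)])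
    have g1: "graded n \<beta>1 \<gamma>1 A1" unfolding A1_def
      by (rule graded_mult[OF graded_mult[OF gS Suc.prems(1)] gT])
    have A1_idx: "A1 $$ (i,j) = A $$ (Transposition.transpose k a i, Transposition.transpose k b j)"
      if "i < n" "j < n" for i j
      unfolding A1_def using that A k ab transpose_less[of k n b j]
      by (subst swap_mat_mult_right) (auto simp: swap_mat_mult_left mult_carrier_mat_square)
    define c where "c = A1 $$ (k,k)"
    have c: "c \<noteq> 0" unfolding c_def using piv k by (simp add: A1_idx)
    have A1_unit: "A1 $$ (i,j) = (if i = j then 1 else 0)" if "i < n" "j < n" "i < k \<or> j < k" for i j
    proof -
      have "Transposition.transpose k a i < k \<longleftrightarrow> i < k" "Transposition.transpose k b j < k \<longleftrightarrow> j < k"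
        using ab by (auto simp: Transposition.transpose_def)
      moreover have "i < k \<Longrightarrow> Transposition.transpose k a i = i" "j < k \<Longrightarrow> Transposition.transpose k b j = j"
        using ab by (auto simp: Transposition.transpose_def)
      moreover have "(i = j) = (Transposition.transpose k a i = Transposition.transpose k b j)"
        using that calculation by (metis nat_neq_iff)
      ultimately show ?thesis
        using that Suc.prems(3)[of "Transposition.transpose k a i" "Transposition.transpose k b j"]
          A1_idx transpose_less[of k n a i] transpose_less[of k n b j] k ab by auto
    qed
    \<comment> \<open>\<open>E\<close> normalizes the pivot and clears its column below;
      \<open>F\<close> clears its row to the right.\<close>
    define E where "E = mat n n (\<lambda>(i,j). if i = j then (if i = k then 1 / c else 1)
        else if j = k \<and> k < i then - A1 $$ (i,k) / c else 0)"
    define F where "F = mat n n (\<lambda>(i,j). if i = j then 1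
        else if i = k \<and> k < j then - A1 $$ (k,j) / c else 0)"
    have EF: "E \<in> carrier_mat n n" "F \<in> carrier_mat n n" by (simp_all add: E_def F_def)
    have detE: "det E \<noteq> 0"
    proof -
      have "det E = prod_list (diag_mat E)" by (rule det_lower_triangular[OF _ EF(1)]) (auto simp: E_def)
      also have "\<dots> = (\<Prod>i=0..<n. E $$ (i,i))" using EF(1) by (simp add: prod_list_diag_prod)
      also have "\<dots> \<noteq> 0" using c by (simp add: E_def)
      finally show ?thesis .
    qed
    have detF: "det F \<noteq> 0"
    proof -
      have "det F = prod_list (diag_mat F)"
        by (rule det_upper_triangular[OF _ EF(2)]) (auto simp: F_def upper_triangular_def)
      also have "\<dots> = (\<Prod>i=0..<n. F $$ (i,i))" using EF(2) by (simp add: prod_list_diag_prod)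
      also have "\<dots> \<noteq> 0" by (simp add: F_def)
      finally show ?thesis .
    qed
    have kk: "\<beta>1 k = \<gamma>1 k" using gradedD(2)[OF g1 k k] c c_def by simp
    \<comment> \<open>An entry of \<open>E\<close> below the pivot is nonzero only if
      \<open>A1\<close> is nonzero there, and then row \<open>i\<close> has the column weight of the
      pivot, which is its row weight by \<open>kk\<close>.\<close>
    have gE: "graded n \<beta>1 \<beta>1 E"
      using gradedD(2)[OF g1 _ k] kk by (auto simp: graded_def E_def split: if_splits)
    have gF: "graded n \<gamma>1 \<gamma>1 F"
      using gradedD(2)[OF g1 k] kk by (auto simp: graded_def F_def split: if_splits)
    have EA: "(E * A1) $$ (i,j) = (if i = k then A1 $$ (k,j) / c
        else if k < i then A1 $$ (i,j) - A1 $$ (i,k) / c * A1 $$ (k,j) else A1 $$ (i,j))"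
      if ij: "i < n" "j < n" for i j
    proof -
      have "(E * A1) $$ (i,j) = (\<Sum>l=0..<n. (if l = i then (if i = k then 1 / c else 1) * A1 $$ (l,j) else 0) +
         (if l = k then (if k < i then - A1 $$ (i,k) / c * A1 $$ (k,j) else 0) else 0))"
        unfolding mult_mat_index[OF EF(1) A1 ij] using ij by (intro sum.cong) (auto simp: E_def)
      then show ?thesis using ij k by (simp add: sum.distrib)
    qed
    define A2 where "A2 = E * A1 * F"
    have EAc: "E * A1 \<in> carrier_mat n n" using EF A1 by (simp add: mult_carrier_mat_square)
    have A2_idx: "A2 $$ (i,j) = (E * A1) $$ (i,j) +
        (if k < j then - (E * A1) $$ (i,k) * (A1 $$ (k,j) / c) else 0)" if ij: "i < n" "j < n" for i j
    proof -
      have "A2 $$ (i,j) = (\<Sum>l=0..<n. (if l = j then (E * A1) $$ (i,l) else 0) +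
         (if l = k then (if k < j then - (E * A1) $$ (i,k) * (A1 $$ (k,j) / c) else 0) else 0))"
        unfolding A2_def mult_mat_index[OF EAc EF(2) ij] using ij by (intro sum.cong) (auto simp: F_def)
      then show ?thesis using ij k by (simp add: sum.distrib)
    qed
    have g2: "graded n \<beta>1 \<gamma>1 A2" unfolding A2_def by (rule graded_mult[OF graded_mult[OF gE g1] gF])
    have unit: "A2 $$ (i,j) = (if i = j then 1 else 0)" if ij: "i < n" "j < n" "i < Suc k \<or> j < Suc k" for i j
    proof -
      have ckk: "A1 $$ (k,k) = c" by (simp add: c_def)
      consider "i < k" | "i = k" | "k < i" "j < k" | "k < i" "j = k" using ij(3) by linarith
      then show ?thesis
      proof cases
        case 1 then show ?thesis using ij k A1_unit[of i j] A1_unit[of i k] by (simp add: A2_idx EA)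
      next
        case 2 
        consider "j < k" | "j = k" | "k < j" by linarith
        then show ?thesis using ij k 2 c ckk A1_unit[of k j] by cases (simp_all add: A2_idx EA)
      next
        case 3 then show ?thesis using ij k A1_unit[of i j] A1_unit[of k j] by (simp add: A2_idx EA)
      next
        case 4 then show ?thesis using ij k ckk c by (simp add: A2_idx EA)
      qed
    qed
    have "d = n - Suc k" using Suc.hyps(2) by simp
    from Suc.hyps(1)[OF this g2 Suc_leI[OF k]] unit obtain P Q \<beta>' \<gamma>' q where
      IH: "graded n \<beta>' \<beta>1 P" "det P \<noteq> 0" "graded n \<gamma>1 \<gamma>' Q" "det Q \<noteq> 0" "q \<le> n" "P * A2 * Q = rank_mat n q"
      by blast
    have PQ: "P \<in> carrier_mat n n" "Q \<in> carrier_mat n n" using IH gradedD(1) by blast+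
    have "(P * E * ?S) * A * (?T * F * Q) = P * A2 * Q"
    proof -
      have "P * E * ?S * A * (?T * F * Q) = P * E * ?S * A * ?T * F * Q"
        using PQ EF A by (simp add: assoc_mult_mat[of _ n n _ n _ n] mult_carrier_mat_square)
      also have "\<dots> = P * A2 * Q" unfolding A2_def A1_def
        using PQ EF A by (simp add: assoc_mult_mat[of _ n n _ n _ n] mult_carrier_mat_square)
      finally show ?thesis .
    qed
    then have eq: "(P * E * ?S) * A * (?T * F * Q) = rank_mat n q" using IH(6) by simp
    have gP: "graded n \<beta>' \<beta> (P * E * ?S)" by (rule graded_mult[OF graded_mult[OF IH(1) gE] gS])
    have gQ: "graded n \<gamma> \<gamma>' (?T * F * Q)" by (rule graded_mult[OF graded_mult[OF gT gF] IH(3)])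
    have dP: "det (P * E * ?S) \<noteq> 0"
      using PQ EF IH(2) detE det_swap_mat[OF k ab(2), where 'a = 'a] by (simp add: det_mult[of _ n] mult_carrier_mat_square)
    have dQ: "det (?T * F * Q) \<noteq> 0"
      using PQ EF IH(4) detF det_swap_mat[OF k ab(4), where 'a = 'a] by (simp add: det_mult[of _ n] mult_carrier_mat_square)
    show ?thesis using gP dP gQ dQ IH(5) eq by blast
  qed
qed

section \<open>Gradings from Jordan normal forms\<close>

text \<open>What is needed of a Jordan form: triangularity, for an extremal choice of entries, and
  no coupling between different eigenvalues. The sizes of the blocks are forgotten.\<close>

definition jordan_like :: "'a::zero mat \<Rightarrow> bool" where
  "jordan_like J \<longleftrightarrow> upper_triangular J \<and>
    (\<forall>i<dim_row J. \<forall>j<dim_row J. J $$ (i,j) \<noteq> 0 \<longrightarrow> J $$ (i,i) = J $$ (j,j))"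

lemma jordan_matrix_same_diag:
  "i < sum_list (map fst n_as) \<Longrightarrow> j < sum_list (map fst n_as) \<Longrightarrow>
   jordan_matrix n_as $$ (i,j) \<noteq> 0 \<Longrightarrow> jordan_matrix n_as $$ (i,i) = jordan_matrix n_as $$ (j,j)"
proof (induction n_as arbitrary: i j)
  case (Cons na n_as)
  obtain n a where na: "na = (n,a)" by force
  let ?N = "sum_list (map fst n_as)"
  have c: "i < n + ?N" "j < n + ?N" using Cons.prems na by simp_all
  show ?case
    using Cons.prems(3) c Cons.IH[of "i - n" "j - n"]
    unfolding na jordan_matrix_Cons
    by (auto split: if_splits)
qed simp

lemma jordan_like_jordan_matrix: "jordan_like (jordan_matrix n_as)"
  unfolding jordan_like_def upper_triangular_def
  using jordan_matrix_upper_triangular jordan_matrix_same_diag by auto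

lemma ex_jordan_like:
  assumes A: "(A :: complex mat) \<in> carrier_mat n n"
  shows "\<exists>P Q J. P \<in> carrier_mat n n \<and> Q \<in> carrier_mat n n \<and> J \<in> carrier_mat n n \<and>
    P * Q = 1\<^sub>m n \<and> Q * P = 1\<^sub>m n \<and> A = P * J * Q \<and> jordan_like J"
proof -
  obtain as where "char_poly A = (\<Prod>a\<leftarrow>as. [:- a, 1:])" using char_poly_factorized[OF A] by auto
  from jordan_nf_exists[OF A this] obtain n_as where "jordan_nf A n_as" ..
  then obtain P Q where "similar_mat_wit A (jordan_matrix n_as) P Q"
    unfolding jordan_nf_def similar_mat_def by blast
  from similar_mat_witD2[OF A this] jordan_like_jordan_matrix[of n_as] show ?thesis by blast
qed

text \<open>Among the entries violating the grading take one in the last row and, in it, the first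
  column: there both sides of the equation reduce to a diagonal contribution.\<close>

lemma graded_intertwiner:
  fixes J :: "'a::field mat"
  assumes J: "J \<in> carrier_mat n n" "jordan_like J" and J': "J' \<in> carrier_mat n n" "jordan_like J'"
    and M: "M \<in> carrier_mat n n" and eq: "J * M = x \<cdot>\<^sub>m (M * J')"
  shows "graded n (\<lambda>i. J $$ (i,i)) (\<lambda>j. x * J' $$ (j,j)) M"
  unfolding graded_def
proof (intro conjI allI impI M, rule ccontr)
  let ?bad = "\<lambda>i j. i < n \<and> j < n \<and> M $$ (i,j) \<noteq> 0 \<and> J $$ (i,i) \<noteq> x * J' $$ (j,j)"
  fix i j assume "i < n" "j < n" "M $$ (i,j) \<noteq> 0" "J $$ (i,i) \<noteq> x * J' $$ (j,j)"
  then have ex: "\<exists>i. \<exists>j. ?bad i j" by blast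
  have bound: "\<And>i. \<exists>j. ?bad i j \<Longrightarrow> i \<le> n" by auto
  define a where "a = (GREATEST i. \<exists>j. ?bad i j)"
  have a: "\<exists>j. ?bad a j" unfolding a_def by (rule GreatestI_ex_nat[OF ex bound])
  have amax: "\<not> ?bad i j" if "a < i" for i j
  proof
    assume "?bad i j"
    then have "\<exists>j. ?bad i j" by blast
    then have "i \<le> a" unfolding a_def by (rule Greatest_le_nat) (rule bound)
    then show False using that by simp
  qed
  define b where "b = (LEAST j. ?bad a j)"
  have b: "?bad a b" unfolding b_def by (rule LeastI_ex[OF a])
  have bmin: "\<not> ?bad a j" if "j < b" for j using that unfolding b_def by (rule not_less_Least)
  have an: "a < n" and bn: "b < n" using b by auto
  have "(J * M) $$ (a,b) = (\<Sum>l=0..<n. if l = a then J $$ (a,a) * M $$ (a,b) else 0)"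
    unfolding mult_mat_index[OF J(1) M an bn]
  proof (rule sum.cong)
    fix l assume l: "l \<in> {0..<n}"
    show "J $$ (a,l) * M $$ (l,b) = (if l = a then J $$ (a,a) * M $$ (a,b) else 0)"
    proof (cases "l = a \<or> J $$ (a,l) = 0")
      case False
      then have "a < l" using J an l unfolding jordan_like_def upper_triangular_def
        by (metis carrier_matD(1) nat_neq_iff)
      moreover have "J $$ (l,l) = J $$ (a,a)" using J an l False by (auto simp: jordan_like_def)
      ultimately have "M $$ (l,b) = 0" using amax[of l b] b l by auto
      then show ?thesis using False by simp
    qed auto
  qed simp
  then have 1: "(J * M) $$ (a,b) = J $$ (a,a) * M $$ (a,b)" using an by simp
  have "(M * J') $$ (a,b) = (\<Sum>l=0..<n. if l = b then M $$ (a,b) * J' $$ (b,b) else 0)"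
    unfolding mult_mat_index[OF M J'(1) an bn]
  proof (rule sum.cong)
    fix l assume l: "l \<in> {0..<n}"
    show "M $$ (a,l) * J' $$ (l,b) = (if l = b then M $$ (a,b) * J' $$ (b,b) else 0)"
    proof (cases "l = b \<or> J' $$ (l,b) = 0")
      case False
      then have "l < b" using J' bn l unfolding jordan_like_def upper_triangular_def
        by (metis atLeastLessThan_iff carrier_matD(1) nat_neq_iff)
      moreover have "J' $$ (l,l) = J' $$ (b,b)" using J' bn l False by (auto simp: jordan_like_def)
      ultimately have "M $$ (a,l) = 0" using bmin[of l] b l by auto
      then show ?thesis using False by simp
    qed auto
  qed simp
  then have 2: "(M * J') $$ (a,b) = M $$ (a,b) * J' $$ (b,b)" using bn by simp
  have "(J * M) $$ (a,b) = x * (M * J') $$ (a,b)" unfolding eq using M J' an bn by simp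
  then have "J $$ (a,a) * M $$ (a,b) = (x * J' $$ (b,b)) * M $$ (a,b)" unfolding 1 2 by simp
  then show False using b by simp
qed

lemma det_nonzero_ex_inverse:
  fixes C :: "'a::field mat"
  assumes C: "C \<in> carrier_mat n n" and d: "det C \<noteq> 0"
  shows "\<exists>D. D \<in> carrier_mat n n \<and> C * D = 1\<^sub>m n \<and> D * C = 1\<^sub>m n"
  using det_non_zero_imp_unit[OF C d, of undefined]
  by (auto simp: Units_def ring_mat_def)

text \<open>The diagonals of the Jordan forms of \<open>B\<close> and of the inverse of \<open>C\<close> provide the weights.\<close>

lemma ex_graded_basis:
  fixes B C :: "complex mat"
  assumes B: "B \<in> carrier_mat n n" "det B \<noteq> 0" and C: "C \<in> carrier_mat n n" "det C \<noteq> 0"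
  shows "\<exists>P Q \<beta> \<gamma>. P \<in> carrier_mat n n \<and> Q \<in> carrier_mat n n \<and> det P \<noteq> 0 \<and> det Q \<noteq> 0 \<and>
    (\<forall>i<n. \<beta> i \<noteq> 0 \<and> \<gamma> i \<noteq> 0) \<and> (\<Prod>i=0..<n. \<beta> i) = det B * det C * (\<Prod>i=0..<n. \<gamma> i) \<and>
    (\<forall>M\<in>carrier_mat n n. \<forall>x. B * M * C = x \<cdot>\<^sub>m M \<longrightarrow> graded n \<beta> (\<lambda>j. x * \<gamma> j) (P * M * Q))"
proof -
  obtain D where D: "D \<in> carrier_mat n n" "C * D = 1\<^sub>m n" "D * C = 1\<^sub>m n"
    using det_nonzero_ex_inverse[OF C] by blast
  obtain P P' J where P: "P \<in> carrier_mat n n" "P' \<in> carrier_mat n n" "J \<in> carrier_mat n n"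
    "P * P' = 1\<^sub>m n" "P' * P = 1\<^sub>m n" "B = P * J * P'" "jordan_like J"
    using ex_jordan_like[OF B(1)] by blast
  obtain Q Q' K where Q: "Q \<in> carrier_mat n n" "Q' \<in> carrier_mat n n" "K \<in> carrier_mat n n"
    "Q * Q' = 1\<^sub>m n" "Q' * Q = 1\<^sub>m n" "D = Q * K * Q'" "jordan_like K"
    using ex_jordan_like[OF D(1)] by blast
  note car = P(1-3) Q(1-3) B(1) C(1) D(1) mult_carrier_mat_square
  have dP: "det P * det P' = 1" using det_mult[OF P(1,2)] P(4) by simp
  have dQ: "det Q * det Q' = 1" using det_mult[OF Q(1,2)] Q(4) by simp
  have dD: "det C * det D = 1" using det_mult[OF C(1) D(1)] D(2) by simp
  have "det B = det P * det J * det P'" unfolding P(6) using car by (simp add: det_mult[of _ n])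
  then have "det B = det J * (det P * det P')" by (simp add: mult_ac)
  then have dJ: "det B = det J" using dP by simp
  have "det D = det Q * det K * det Q'" unfolding Q(6) using car by (simp add: det_mult[of _ n])
  then have "det D = det K * (det Q * det Q')" by (simp add: mult_ac)
  then have dK: "det D = det K" using dQ by simp
  have diag: "det L = (\<Prod>i=0..<n. L $$ (i,i))" if "L \<in> carrier_mat n n" "jordan_like L" for L :: "complex mat"
  proof -
    have "upper_triangular L" using that(2) by (simp add: jordan_like_def)
    from det_upper_triangular[OF this that(1)] show ?thesis using that(1) by (simp add: prod_list_diag_prod)
  qed
  have eqJ: "(\<Prod>i=0..<n. J $$ (i,i)) = det B" using diag[OF P(3,7)] dJ by simp
  have eqK: "(\<Prod>i=0..<n. K $$ (i,i)) = det D" using diag[OF Q(3,7)] dK by simp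
  \<comment> \<open>With \<open>D\<close> inverse to \<open>C\<close> the relation reads
    \<open>B * M = x M D\<close>. Conjugation turns it into an intertwining relation between the two
    Jordan forms.\<close>
  have gr: "graded n (\<lambda>i. J $$ (i,i)) (\<lambda>j. x * K $$ (j,j)) (P' * M * Q)"
    if M: "M \<in> carrier_mat n n" and e: "B * M * C = x \<cdot>\<^sub>m M" for M x
  proof (rule graded_intertwiner[OF P(3,7) Q(3,7)])
    show "P' * M * Q \<in> carrier_mat n n" using car M by simp
    have "J * (P' * M * Q) = (P' * P) * J * P' * M * (C * D) * Q"
      unfolding P(5) D(2) using car M by (simp add: assoc_mult_mat[of _ n n _ n _ n])
    also have "\<dots> = P' * (P * J * P' * M * C) * D * Q"
      using car M by (simp add: assoc_mult_mat[of _ n n _ n _ n])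
    also have "\<dots> = P' * (x \<cdot>\<^sub>m M) * D * Q" using e unfolding P(6) by simp
    also have "\<dots> = P' * (x \<cdot>\<^sub>m M) * Q * K * (Q' * Q)"
    proof -
      have "P' * N * (Q * K * Q') * Q = P' * N * Q * K * (Q' * Q)" if "N \<in> carrier_mat n n" for N
        using car that by (simp add: assoc_mult_mat[of _ n n _ n _ n])
      from this[of "x \<cdot>\<^sub>m M"] show ?thesis unfolding Q(6) using M by simp
    qed
    also have "\<dots> = x \<cdot>\<^sub>m (P' * M * Q * K)"
      unfolding Q(5) using car M
      by (simp add: mult_smult_distrib[of _ n n _ n] mult_smult_assoc_mat[of _ n n _ n])
    finally show "J * (P' * M * Q) = x \<cdot>\<^sub>m (P' * M * Q * K)" .
  qed
  have nz: "\<forall>i<n. J $$ (i,i) \<noteq> 0 \<and> K $$ (i,i) \<noteq> 0"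
  proof -
    have "(\<Prod>i=0..<n. J $$ (i,i)) \<noteq> 0" "(\<Prod>i=0..<n. K $$ (i,i)) \<noteq> 0" using eqJ eqK B dD by auto
    then show ?thesis by simp
  qed
  have prods: "(\<Prod>i=0..<n. J $$ (i,i)) = det B * det C * (\<Prod>i=0..<n. K $$ (i,i))"
    unfolding eqJ eqK using dD by (simp add: mult.assoc)
  have dets: "det P' \<noteq> 0" "det Q \<noteq> 0" using dP dQ by auto
  show ?thesis
    by (rule exI[of _ P'], rule exI[of _ Q], rule exI[of _ "\<lambda>i. J $$ (i,i)"], rule exI[of _ "\<lambda>i. K $$ (i,i)"])
      (intro conjI ballI allI impI P(2) Q(1) dets nz[rule_format, THEN conjunct1] nz[rule_format, THEN conjunct2] prods gr)
qed

section \<open>Matrices of rank at most one\<close>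

definition mat_linear :: "nat \<Rightarrow> nat \<Rightarrow> ('a::semiring_1 mat \<Rightarrow> 'a mat) \<Rightarrow> bool" where
  "mat_linear m n f \<longleftrightarrow> (\<forall>X\<in>carrier_mat m m. f X \<in> carrier_mat n n) \<and>
     (\<forall>X\<in>carrier_mat m m. \<forall>Y\<in>carrier_mat m m. f (X + Y) = f X + f Y) \<and>
     (\<forall>X\<in>carrier_mat m m. \<forall>c. f (c \<cdot>\<^sub>m X) = c \<cdot>\<^sub>m f X)"

lemma mat_linearD:
  assumes "mat_linear m n f"
  shows "X \<in> carrier_mat m m \<Longrightarrow> f X \<in> carrier_mat n n"
    "X \<in> carrier_mat m m \<Longrightarrow> Y \<in> carrier_mat m m \<Longrightarrow> f (X + Y) = f X + f Y"
    "X \<in> carrier_mat m m \<Longrightarrow> f (c \<cdot>\<^sub>m X) = c \<cdot>\<^sub>m f X"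
  using assms by (auto simp: mat_linear_def)

lemma mat_linear_zero:
  assumes "mat_linear m n f"
  shows "f (0\<^sub>m m m) = 0\<^sub>m n n"
proof -
  have "0 \<cdot>\<^sub>m 0\<^sub>m m m = (0\<^sub>m m m :: 'a mat)" by auto
  then have "f (0\<^sub>m m m) = 0 \<cdot>\<^sub>m f (0\<^sub>m m m)" using mat_linearD(3)[OF assms, of "0\<^sub>m m m" 0] by simp
  also have "\<dots> = 0\<^sub>m n n" using mat_linearD(1)[OF assms, of "0\<^sub>m m m"] by auto
  finally show ?thesis .
qed

definition outer :: "nat \<Rightarrow> (nat \<Rightarrow> 'a::times) \<Rightarrow> (nat \<Rightarrow> 'a) \<Rightarrow> 'a mat" where
  "outer n u v = mat n n (\<lambda>(i,j). u i * v j)"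

lemma outer_carrier [simp]: "outer n u v \<in> carrier_mat n n"
  by (simp add: outer_def)

lemma outer_dim [simp]: "dim_row (outer n u v) = n" "dim_col (outer n u v) = n"
  by (simp_all add: outer_def)

lemma outer_index [simp]: "i < n \<Longrightarrow> j < n \<Longrightarrow> outer n u v $$ (i,j) = u i * v j"
  by (simp add: outer_def)

definition unit_fun :: "nat \<Rightarrow> nat \<Rightarrow> 'a::zero_neq_one" where
  "unit_fun i = (\<lambda>k. if k = i then 1 else 0)"

text \<open>Written as outer products so that the rank one criterion for sums of outer products
  applies to matrix units.\<close>

abbreviation unit_mat :: "nat \<Rightarrow> nat \<Rightarrow> nat \<Rightarrow> 'a::semiring_1 mat" where
  "unit_mat n i j \<equiv> outer n (unit_fun i) (unit_fun j)"

lemma mat_linear_expand: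
  assumes f: "mat_linear m n f" and X: "X \<in> carrier_mat m m" and rs: "r < n" "s < n"
  shows "f X $$ (r,s) = (\<Sum>i=0..<m. \<Sum>j=0..<m. X $$ (i,j) * f (unit_mat m i j) $$ (r,s))"
proof -
  \<comment> \<open>Truncations of \<open>X\<close> to a set of positions, so that linearity can be
    applied one entry at a time.\<close>
  define R where "R S = mat m m (\<lambda>(i,j). if (i,j) \<in> S then X $$ (i,j) else 0)" for S
  have R: "R S \<in> carrier_mat m m" for S by (simp add: R_def)
  have "f (R S) $$ (r,s) = (\<Sum>z\<in>S. X $$ z * f (unit_mat m (fst z) (snd z)) $$ (r,s))"
    if "finite S" "S \<subseteq> {0..<m} \<times> {0..<m}" for S
    using that
  proof (induction S rule: finite_induct)
    case empty
    have "R {} = 0\<^sub>m m m" by (intro eq_matI) (auto simp: R_def)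
    then show ?case using mat_linear_zero[OF f] rs by simp
  next
    case (insert z S)
    obtain i j where z: "z = (i,j)" by force
    have ij: "i < m" "j < m" using insert.prems z by auto
    have "R (insert z S) = R S + X $$ z \<cdot>\<^sub>m unit_mat m i j"
      using insert.hyps z by (intro eq_matI) (auto simp: R_def unit_fun_def)
    then have "f (R (insert z S)) = f (R S) + X $$ z \<cdot>\<^sub>m f (unit_mat m i j)"
      using mat_linearD[OF f] R by simp
    moreover have "f (unit_mat m i j) \<in> carrier_mat n n" "f (R S) \<in> carrier_mat n n"
      using mat_linearD(1)[OF f] R by auto
    ultimately have "f (R (insert z S)) $$ (r,s) = f (R S) $$ (r,s) + X $$ z * f (unit_mat m i j) $$ (r,s)"
      using rs by simp
    then show ?case using insert z by (simp add: add.commute)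
  qed
  from this[of "{0..<m} \<times> {0..<m}"]
  have "f (R ({0..<m} \<times> {0..<m})) $$ (r,s) =
     (\<Sum>z\<in>{0..<m} \<times> {0..<m}. X $$ z * f (unit_mat m (fst z) (snd z)) $$ (r,s))" by simp
  moreover have "R ({0..<m} \<times> {0..<m}) = X" using X by (intro eq_matI) (auto simp: R_def)
  ultimately show ?thesis by (simp add: sum.cartesian_product case_prod_beta)
qed

text \<open>Rank at most one, in polynomial form.\<close>

definition minors_zero :: "nat \<Rightarrow> 'a::times mat \<Rightarrow> bool" where
  "minors_zero n X \<longleftrightarrow> (\<forall>i<n. \<forall>j<n. \<forall>k<n. \<forall>l<n. X $$ (i,j) * X $$ (k,l) = X $$ (i,l) * X $$ (k,j))"

text \<open>The determinant is affine in the direction \<open>X\<close> if and only if \<open>X\<close> has rank at most one.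
  Testing the parameters 0, 1 and 2 suffices.\<close>

definition det_affine :: "nat \<Rightarrow> complex mat \<Rightarrow> bool" where
  "det_affine n X \<longleftrightarrow> (\<forall>Y\<in>carrier_mat n n. det (Y + 2 \<cdot>\<^sub>m X) = 2 * det (Y + X) - det Y)"

lemma minors_zero_outer: "minors_zero n (outer n u v :: 'a::comm_semiring_1 mat)"
  by (auto simp: minors_zero_def mult_ac)

lemma minors_zero_imp_outer:
  fixes X :: "'a::field mat"
  assumes X: "X \<in> carrier_mat n n" and mz: "minors_zero n X"
  shows "\<exists>u v. X = outer n u v"
proof (cases "\<exists>k<n. \<exists>l<n. X $$ (k,l) \<noteq> 0")
  case True
  then obtain k l where kl: "k < n" "l < n" "X $$ (k,l) \<noteq> 0" by blast
  have "X = outer n (\<lambda>i. X $$ (i,l)) (\<lambda>j. X $$ (k,j) / X $$ (k,l))"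
  proof (rule eq_matI)
    fix i j assume "i < dim_row (outer n (\<lambda>i. X $$ (i,l)) (\<lambda>j. X $$ (k,j) / X $$ (k,l)))"
      "j < dim_col (outer n (\<lambda>i. X $$ (i,l)) (\<lambda>j. X $$ (k,j) / X $$ (k,l)))"
    then have ij: "i < n" "j < n" by (auto simp: outer_def)
    have "X $$ (i,j) * X $$ (k,l) = X $$ (i,l) * X $$ (k,j)" using mz ij kl by (auto simp: minors_zero_def)
    then show "X $$ (i,j) = outer n (\<lambda>i. X $$ (i,l)) (\<lambda>j. X $$ (k,j) / X $$ (k,l)) $$ (i,j)"
      using ij kl by (simp add: field_simps)
  qed (use X in \<open>auto simp: outer_def\<close>)
  then show ?thesis by blast
next
  case False
  then have "X = outer n (\<lambda>_. 0) (\<lambda>_. 0)" using X by (intro eq_matI) (auto simp: outer_def)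
  then show ?thesis by blast
qed

text \<open>Only the entry at (0,0) changes, and it does not enter the cofactors of its own
  row.\<close>

lemma det_add_rank_mat_1:
  fixes W :: "'a::comm_ring_1 mat"
  assumes W: "W \<in> carrier_mat n n" and n: "0 < n"
  shows "det (W + c \<cdot>\<^sub>m rank_mat n 1) = det W + c * cofactor W 0 0"
proof -
  let ?V = "W + c \<cdot>\<^sub>m rank_mat n 1"
  have V: "?V \<in> carrier_mat n n" using W by simp
  have cof: "cofactor ?V 0 j = cofactor W 0 j" if "j < n" for j
  proof -
    have "mat_delete ?V 0 j = mat_delete W 0 j"
      using W n that by (intro eq_matI) (auto simp: mat_delete_def rank_mat_def)
    then show ?thesis by (simp add: cofactor_def)
  qed
  have "det ?V = (\<Sum>j<n. ?V $$ (0,j) * cofactor W 0 j)"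
    using laplace_expansion_row[OF V n] cof by simp
  also have "\<dots> = (\<Sum>j<n. W $$ (0,j) * cofactor W 0 j + (if j = 0 then c * cofactor W 0 0 else 0))"
    using W n by (intro sum.cong) (auto simp: rank_mat_def algebra_simps)
  also have "\<dots> = det W + c * cofactor W 0 0"
    using n laplace_expansion_row[OF W n] by (simp add: sum.distrib)
  finally show ?thesis .
qed

text \<open>The graded normal form for the one-element grading.\<close>

lemma rank_normal_form:
  fixes X :: "complex mat"
  assumes X: "X \<in> carrier_mat n n"
  shows "\<exists>P Q q. P \<in> carrier_mat n n \<and> Q \<in> carrier_mat n n \<and> det P \<noteq> 0 \<and> det Q \<noteq> 0 \<and> q \<le> n \<and>
    X = P * rank_mat n q * Q"
proof -
  have "graded n (\<lambda>_. ()) (\<lambda>_. ()) X" using X by (simp add: graded_def)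
  from graded_rank_normal_form[OF this, of 0] obtain P Q \<beta>' \<gamma>' q where
    "graded n \<beta>' (\<lambda>_. ()) P" "det P \<noteq> 0" "graded n (\<lambda>_. ()) \<gamma>' Q" "det Q \<noteq> 0" "q \<le> n"
    and e: "P * X * Q = rank_mat n q" by auto
  note P = gradedD(1)[OF this(1)] this(2) and Q = gradedD(1)[OF this(3)] this(4) and q = this(5)
  obtain P' where P': "P' \<in> carrier_mat n n" "P * P' = 1\<^sub>m n" "P' * P = 1\<^sub>m n"
    using det_nonzero_ex_inverse[OF P] by blast
  obtain Q' where Q': "Q' \<in> carrier_mat n n" "Q * Q' = 1\<^sub>m n" "Q' * Q = 1\<^sub>m n"
    using det_nonzero_ex_inverse[OF Q] by blast
  have "P' * rank_mat n q * Q' = (P' * P) * X * (Q * Q')"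
    unfolding e[symmetric] using P(1) Q(1) P'(1) Q'(1) X
    by (simp add: assoc_mult_mat[of _ n n _ n _ n] mult_carrier_mat_square)
  then have "X = P' * rank_mat n q * Q'" using P'(3) Q'(2) X by simp
  moreover have "det P * det P' = 1" using det_mult[OF P(1) P'(1)] P'(2) by simp
  moreover have "det Q * det Q' = 1" using det_mult[OF Q(1) Q'(1)] Q'(2) by simp
  ultimately show ?thesis using P'(1) Q'(1) q by (intro exI[of _ P'] exI[of _ Q'] exI[of _ q]) auto
qed

text \<open>Multiplication by invertible matrices reduces both sides to the condition
  \<open>q\<close> \<le> 1 on the rank \<open>q\<close>. This expresses rank one through
  determinants and linear operations alone, which a linear preserver of the determinant
  respects.\<close>

lemma det_affine_iff_minors_zero:
  assumes X: "X \<in> carrier_mat n n"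
  shows "det_affine n X \<longleftrightarrow> minors_zero n X"
proof -
  obtain P Q q where P: "P \<in> carrier_mat n n" "det P \<noteq> 0" and Q: "Q \<in> carrier_mat n n" "det Q \<noteq> 0"
    and q: "q \<le> n" and e: "X = P * rank_mat n q * Q" using rank_normal_form[OF X] by blast
  obtain P' where P': "P' \<in> carrier_mat n n" "P * P' = 1\<^sub>m n" "P' * P = 1\<^sub>m n"
    using det_nonzero_ex_inverse[OF P] by blast
  obtain Q' where Q': "Q' \<in> carrier_mat n n" "Q * Q' = 1\<^sub>m n" "Q' * Q = 1\<^sub>m n"
    using det_nonzero_ex_inverse[OF Q] by blast
  have lin: "P * W * Q + c \<cdot>\<^sub>m X = P * (W + c \<cdot>\<^sub>m rank_mat n q) * Q" if "W \<in> carrier_mat n n" for W c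
  proof -
    have "P * (W + c \<cdot>\<^sub>m rank_mat n q) = P * W + c \<cdot>\<^sub>m (P * rank_mat n q)"
      using that P(1) by (simp add: mult_add_distrib_mat[of _ n n _ n] mult_smult_distrib[of _ n n _ n])
    then show ?thesis unfolding e using that P(1) Q(1)
      by (simp add: add_mult_distrib_mat[of _ n n _ _ n] mult_smult_assoc_mat[of _ n n _ n] mult_carrier_mat_square)
  qed
  have det3: "det (P * W * Q) = det P * det W * det Q" if "W \<in> carrier_mat n n" for W
    using that P(1) Q(1) by (simp add: det_mult[of _ n] mult_carrier_mat_square)
  have det_lin: "det (P * W * Q + c \<cdot>\<^sub>m X) = det P * det (W + c \<cdot>\<^sub>m rank_mat n q) * det Q"
    if "W \<in> carrier_mat n n" for W c
    unfolding lin[OF that] by (rule det3) (use that in simp)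
  have one: "1 \<cdot>\<^sub>m X = X" using X by auto
  have aff_q: "q \<le> 1" if aff: "det_affine n X"
  proof (rule ccontr)
    assume q2: "\<not> q \<le> 1"
    \<comment> \<open>The complementary projection: along the line through it the determinant is
      \<open>c ^ q\<close>. Affinity at 0, 1 and 2 then demands 2^q = 2, impossible for
      \<open>q\<close> \<ge> 2.\<close>
    define D where "D = mat n n (\<lambda>(i,j). if i = j \<and> q \<le> i then 1 else 0 :: complex)"
    have D: "D \<in> carrier_mat n n" by (simp add: D_def)
    have dd: "det (D + c \<cdot>\<^sub>m rank_mat n q) = c ^ q" for c
    proof -
      have c: "D + c \<cdot>\<^sub>m rank_mat n q \<in> carrier_mat n n" using D by simp
      have "upper_triangular (D + c \<cdot>\<^sub>m rank_mat n q)" by (auto simp: D_def rank_mat_def upper_triangular_def)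
      from det_upper_triangular[OF this c]
      have "det (D + c \<cdot>\<^sub>m rank_mat n q) = (\<Prod>i=0..<n. if i < q then c else 1)"
        using D by (auto simp: prod_list_diag_prod D_def rank_mat_def intro!: prod.cong)
      also have "\<dots> = (\<Prod>i=0..<q. if i < q then c else 1) * (\<Prod>i=q..<n. if i < q then c else 1)"
        using q by (intro prod.atLeastLessThan_concat[symmetric]) auto
      also have "\<dots> = c ^ q" by simp
      finally show ?thesis .
    qed
    have "P * D * Q \<in> carrier_mat n n" using D P(1) Q(1) by simp
    then have "det (P * D * Q + 2 \<cdot>\<^sub>m X) = 2 * det (P * D * Q + X) - det (P * D * Q)"
      using aff by (simp add: det_affine_def)
    moreover have "det (P * D * Q) = det (P * D * Q + 0 \<cdot>\<^sub>m X)"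
    proof -
      have "P * D * Q + 0 \<cdot>\<^sub>m X = P * D * Q" using X D P(1) Q(1) by (intro eq_matI) auto
      then show ?thesis by simp
    qed
    ultimately have "det P * 2 ^ q * det Q = 2 * (det P * 1 * det Q) - det P * 0 ^ q * det Q"
      using det_lin[OF D, of 2] det_lin[OF D, of 1] det_lin[OF D, of 0] dd[of 2] dd[of 1] dd[of 0] one by simp
    then have "(2 ^ q - 2) * (det P * det Q) = 0" using q2 by (simp add: algebra_simps power_0_left)
    then have "(2::complex) ^ q = 2 ^ 1" using P(2) Q(2) by simp
    then have "2 ^ q = (2 ^ 1 :: nat)" by (metis of_nat_eq_iff of_nat_numeral of_nat_power)
    then show False using q2 power_inject_exp[of "2::nat" q 1] by simp
  qed
  have q_aff: "det_affine n X" if q1: "q \<le> 1"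
    unfolding det_affine_def
  proof
    fix Y :: "complex mat" assume Y: "Y \<in> carrier_mat n n"
    define W where "W = P' * Y * Q'"
    have W: "W \<in> carrier_mat n n" using Y P' Q' by (simp add: W_def)
    have "P * W * Q = (P * P') * Y * (Q' * Q)" unfolding W_def
      using P(1) Q(1) P'(1) Q'(1) Y by (simp add: assoc_mult_mat[of _ n n _ n _ n] mult_carrier_mat_square)
    then have YW: "P * W * Q = Y" using P'(2) Q'(3) Y by simp
    have "\<exists>k. \<forall>c. det (W + c \<cdot>\<^sub>m rank_mat n q) = det W + c * k"
    proof (cases "q = 0")
      case True
      have "W + c \<cdot>\<^sub>m rank_mat n q = W" for c using W True by (intro eq_matI) (auto simp: rank_mat_def)
      then show ?thesis by (intro exI[of _ 0]) simp
    next
      case False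
      then have "q = 1" using q1 by simp
      then show ?thesis using det_add_rank_mat_1[OF W] q by (intro exI[of _ "cofactor W 0 0"]) simp
    qed
    then obtain k where k: "\<And>c. det (W + c \<cdot>\<^sub>m rank_mat n q) = det W + c * k" by blast
    have "det Y = det P * det W * det Q" using det3[OF W] YW by simp
    moreover have "det (Y + 2 \<cdot>\<^sub>m X) = det P * (det W + 2 * k) * det Q"
      using det_lin[OF W, of 2] k[of 2] YW by simp
    moreover have "det (Y + X) = det P * (det W + k) * det Q"
      using det_lin[OF W, of 1] k[of 1] YW one by simp
    ultimately show "det (Y + 2 \<cdot>\<^sub>m X) = 2 * det (Y + X) - det Y" by (simp add: algebra_simps)
  qed
  have q_mz: "minors_zero n X" if q1: "q \<le> 1"
  proof (cases "q = 0")
    case True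
    then have "X = P * 0\<^sub>m n n * Q" unfolding e by (intro arg_cong[of _ _ "\<lambda>R. P * R * Q"] eq_matI) (auto simp: rank_mat_def)
    then have "X = 0\<^sub>m n n" using P(1) Q(1) by simp
    then show ?thesis by (simp add: minors_zero_def)
  next
    case False
    then have q: "q = 1" and n: "0 < n" using q1 q by auto
    have R: "rank_mat n q = unit_mat n 0 0" unfolding q by (intro eq_matI) (auto simp: rank_mat_def outer_def unit_fun_def)
    have "X $$ (i,j) = P $$ (i,0) * Q $$ (0,j)" if ij: "i < n" "j < n" for i j
    proof -
      have PR: "(P * rank_mat n q) $$ (i,l) = (if l = 0 then P $$ (i,0) else 0)" if "l < n" for l
      proof -
        have "(P * rank_mat n q) $$ (i,l) = (\<Sum>k=0..<n. if k = 0 then (if l = 0 then P $$ (i,0) else 0) else 0)"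
          unfolding mult_mat_index[OF P(1) rank_mat_carrier ij(1) that] unfolding q
          using ij that by (intro sum.cong) (auto simp: rank_mat_def)
        then show ?thesis using n by simp
      qed
      have "X $$ (i,j) = (\<Sum>l=0..<n. if l = 0 then P $$ (i,0) * Q $$ (0,j) else 0)"
        unfolding e using P(1) PR
        by (subst mult_mat_index[OF mult_carrier_mat_square[OF P(1) rank_mat_carrier] Q(1) ij]) (rule sum.cong, simp_all)
      then show ?thesis using n by simp
    qed
    then show ?thesis by (simp add: minors_zero_def mult_ac)
  qed
  have mz_q: "q \<le> 1" if mz: "minors_zero n X"
  proof (rule ccontr)
    assume q2: "\<not> q \<le> 1"
    obtain u v where uv: "X = outer n u v" using minors_zero_imp_outer[OF X mz] by blast
    have R: "rank_mat n q = P' * X * Q'"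
    proof -
      have "P' * X * Q' = (P' * P) * rank_mat n q * (Q * Q')" unfolding e
        using P(1) Q(1) P'(1) Q'(1) by (simp add: assoc_mult_mat[of _ n n _ n _ n] mult_carrier_mat_square)
      moreover have "(rank_mat n q :: complex mat) \<in> carrier_mat n n" by simp
      ultimately show ?thesis using P'(3) Q'(2) by (metis left_mult_one_mat right_mult_one_mat)
    qed
    have "rank_mat n q $$ (i,j) = (\<Sum>k=0..<n. P' $$ (i,k) * u k) * (\<Sum>l=0..<n. v l * Q' $$ (l,j))"
      if ij: "i < n" "j < n" for i j
    proof -
      have "(P' * X) $$ (i,l) = (\<Sum>k=0..<n. P' $$ (i,k) * u k) * v l" if l: "l < n" for l
        unfolding mult_mat_index[OF P'(1) X ij(1) l] using l uv by (simp add: sum_distrib_right mult.assoc)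
      then show ?thesis unfolding R using P'(1) X
        by (subst mult_mat_index[OF _ Q'(1) ij]) (auto simp: mult_carrier_mat_square sum_distrib_left mult.assoc intro!: sum.cong)
    qed
    note r = this
    have n: "0 < n" "1 < n" using q q2 by auto
    have "rank_mat n q $$ (0,0) * rank_mat n q $$ (1,1) = (rank_mat n q $$ (0,1) * rank_mat n q $$ (1,0) :: complex)"
      using r[of 0 0] r[of 1 1] r[of 0 1] r[of 1 0] n by (simp add: mult_ac)
    then show False using n q2 by (simp add: rank_mat_def)
  qed
  show ?thesis using aff_q q_aff q_mz mz_q by blast
qed

section \<open>Linear preservers of the determinant\<close>

text \<open>The zero vector is parallel to every vector, so chaining two such relations requires a
  nonzero vector in the middle.\<close>

definition parallel :: "nat \<Rightarrow> (nat \<Rightarrow> 'a::times) \<Rightarrow> (nat \<Rightarrow> 'a) \<Rightarrow> bool" where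
  "parallel n u v \<longleftrightarrow> (\<forall>i<n. \<forall>k<n. u i * v k = u k * v i)"

lemma parallel_refl: "parallel n u (u :: nat \<Rightarrow> 'a::ab_semigroup_mult)"
  by (simp add: parallel_def mult.commute)

lemma parallel_sym: "parallel n u v \<Longrightarrow> parallel n v (u :: nat \<Rightarrow> 'a::ab_semigroup_mult)"
  unfolding parallel_def by (metis mult.commute)

lemma parallel_scale:
  fixes u v :: "nat \<Rightarrow> 'a::field"
  assumes "parallel n u v" "\<exists>i<n. u i \<noteq> 0"
  shows "\<exists>c. \<forall>i<n. v i = c * u i"
proof -
  obtain k where k: "k < n" "u k \<noteq> 0" using assms(2) by blast
  have "v i = (v k / u k) * u i" if "i < n" for i
  proof -
    have "u i * v k = u k * v i" using assms(1) that k(1) unfolding parallel_def by blast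
    then show ?thesis using k(2) by (simp add: field_simps)
  qed
  then show ?thesis by blast
qed

lemma parallel_trans:
  fixes u v w :: "nat \<Rightarrow> 'a::field"
  assumes "parallel n u v" "parallel n v w" "\<exists>i<n. v i \<noteq> 0"
  shows "parallel n u w"
proof -
  obtain c where c: "\<And>i. i < n \<Longrightarrow> u i = c * v i" using parallel_scale[OF parallel_sym[OF assms(1)] assms(3)] by blast
  obtain d where d: "\<And>i. i < n \<Longrightarrow> w i = d * v i" using parallel_scale[OF assms(2,3)] by blast
  show ?thesis unfolding parallel_def by (simp add: c d)
qed

text \<open>Each 2 by 2 minor of the sum factors into a minor of the left vectors and a minor of the
  right vectors.\<close>

lemma minors_zero_outer_add:
  fixes a b c d :: "nat \<Rightarrow> 'a::idom"
  shows "minors_zero n (outer n a b + outer n c d) \<longleftrightarrow> parallel n a c \<or> parallel n b d"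
proof -
  let ?X = "outer n a b + outer n c d"
  have minor: "?X $$ (i,j) * ?X $$ (k,l) - ?X $$ (i,l) * ?X $$ (k,j) =
     (a i * c k - a k * c i) * (b j * d l - b l * d j)"
    if "i < n" "j < n" "k < n" "l < n" for i j k l
    using that by (simp add: algebra_simps)
  show ?thesis
  proof
    assume mz: "minors_zero n ?X"
    show "parallel n a c \<or> parallel n b d"
    proof (rule ccontr)
      assume "\<not> ?thesis"
      then obtain i k j l where "i < n" "k < n" "a i * c k \<noteq> a k * c i" "j < n" "l < n" "b j * d l \<noteq> b l * d j"
        unfolding parallel_def by blast
      moreover from this have "?X $$ (i,j) * ?X $$ (k,l) = ?X $$ (i,l) * ?X $$ (k,j)"
        using mz unfolding minors_zero_def by blast
      ultimately show False using minor[of i j k l] by simp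
    qed
  next
    assume "parallel n a c \<or> parallel n b d"
    then have "(a i * c k - a k * c i) * (b j * d l - b l * d j) = 0"
      if "i < n" "j < n" "k < n" "l < n" for i j k l
      using that by (auto simp: parallel_def)
    then have "?X $$ (i,j) * ?X $$ (k,l) = ?X $$ (i,l) * ?X $$ (k,j)"
      if "i < n" "j < n" "k < n" "l < n" for i j k l
      using minor[OF that] that by (metis eq_iff_diff_eq_0)
    then show "minors_zero n ?X" unfolding minors_zero_def by blast
  qed
qed

text \<open>Applied to the matrix units, with the relations of having parallel left and parallel right factors under
  a linear map that preserves rank one.\<close>

lemma grid_relations_aux:
  fixes A B :: "nat \<Rightarrow> nat \<Rightarrow> nat \<Rightarrow> nat \<Rightarrow> bool"
  assumes sA: "\<And>i j k l. A i j k l \<Longrightarrow> A k l i j" and sB: "\<And>i j k l. B i j k l \<Longrightarrow> B k l i j"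
    and tA: "\<And>i j k l r s. i < n \<Longrightarrow> j < n \<Longrightarrow> k < n \<Longrightarrow> l < n \<Longrightarrow> r < n \<Longrightarrow> s < n \<Longrightarrow> A i j k l \<Longrightarrow> A k l r s \<Longrightarrow> A i j r s"
    and tB: "\<And>i j k l r s. i < n \<Longrightarrow> j < n \<Longrightarrow> k < n \<Longrightarrow> l < n \<Longrightarrow> r < n \<Longrightarrow> s < n \<Longrightarrow> B i j k l \<Longrightarrow> B k l r s \<Longrightarrow> B i j r s"
    and share: "\<And>i j k l. i < n \<Longrightarrow> j < n \<Longrightarrow> k < n \<Longrightarrow> l < n \<Longrightarrow> A i j k l \<or> B i j k l \<longleftrightarrow> i = k \<or> j = l"
    and rA: "\<And>i j. A i j i j" and rB: "\<And>i j. B i j i j"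
    and ex: "r0 < n" "j0 < n" "k0 < n" "j0 \<noteq> k0" "A r0 j0 r0 k0"
  shows "(\<forall>i<n. \<forall>j<n. \<forall>k<n. A i j i k) \<and> (\<forall>i<n. \<forall>k<n. \<forall>j<n. B i j k j)"
proof -
  \<comment> \<open>One \<open>A\<close>-related pair in a row propagates. A further
    \<open>A\<close>-relation down the column would, by transitivity, connect two positions in
    different rows and columns, so the column must be \<open>B\<close>-related. The next steps
    exchange the roles in the same way.\<close>
  have col: "B r0 j0 i j0" if i: "i < n" for i
  proof (cases "i = r0")
    case True then show ?thesis using rB by simp
  next
    case False
    have "\<not> A r0 j0 i j0"
    proof
      assume "A r0 j0 i j0"
      then have "A r0 k0 i j0" using tA[OF ex(1,3) ex(1,2) i ex(2)] sA[OF ex(5)] by blast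
      then show False using share[OF ex(1,3) i ex(2)] False ex(4) by blast
    qed
    then show ?thesis using share[OF ex(1,2) i ex(2)] by blast
  qed
  have row': "A i j0 i l" if i: "i < n" and l: "l < n" and ne: "i \<noteq> r0" for i l
  proof (cases "l = j0")
    case True then show ?thesis using rA by simp
  next
    case False
    have "\<not> B i j0 i l"
    proof
      assume "B i j0 i l"
      then have "B r0 j0 i l" using tB[OF ex(1,2) i ex(2) i l col[OF i]] by blast
      then show False using share[OF ex(1,2) i l] ne False by blast
    qed
    then show ?thesis using share[OF i ex(2) i l] by blast
  qed
  have row: "A i j0 i l" if i: "i < n" and l: "l < n" for i l
  proof (cases "i = r0")
    case False then show ?thesis using row' i l by blast
  next
    case True
    show ?thesis
    proof (cases "l = j0")
      case True then show ?thesis using rA by simp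
    next
      case False
      have "\<exists>i'<n. i' \<noteq> r0" using ex(2-4) by (metis)
      then obtain i' where i': "i' < n" "i' \<noteq> r0" by blast
      have "\<not> B r0 j0 r0 l"
      proof
        assume "B r0 j0 r0 l"
        then have "B i' j0 r0 l" using tB[OF i'(1) ex(2) ex(1,2) ex(1) l] sB[OF col[OF i'(1)]] by blast
        then show False using share[OF i'(1) ex(2) ex(1) l] i'(2) False by blast
      qed
      then show ?thesis using share[OF ex(1,2) ex(1) l] True by blast
    qed
  qed
  have rows: "A i j i k" if "i < n" "j < n" "k < n" for i j k
    using tA[OF that(1,2,1) ex(2) that(1,3)] sA[OF row[OF that(1,2)]] row[OF that(1,3)] by blast
  have "B i j k j" if i: "i < n" and k: "k < n" and j: "j < n" for i j k
  proof (cases "i = k")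
    case True then show ?thesis using rB by simp
  next
    case False
    have "\<exists>l<n. l \<noteq> j" using ex(2-4) by metis
    then obtain l where l: "l < n" "l \<noteq> j" by blast
    have "\<not> A i j k j"
    proof
      assume "A i j k j"
      then have "A i l k j" using tA[OF i l(1) i j k j rows[OF i l(1) j]] by blast
      then show False using share[OF i l(1) k j] False l(2) by blast
    qed
    then show ?thesis using share[OF i j k j] by blast
  qed
  then show ?thesis using rows by blast
qed

text \<open>The two alternatives are the two forms of a determinant preserver, without and with
  transposition. A single pair of neighbours decides between them.\<close>

lemma grid_relations:
  fixes A B :: "nat \<Rightarrow> nat \<Rightarrow> nat \<Rightarrow> nat \<Rightarrow> bool"
  assumes sA: "\<And>i j k l. A i j k l \<Longrightarrow> A k l i j" and sB: "\<And>i j k l. B i j k l \<Longrightarrow> B k l i j"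
    and tA: "\<And>i j k l r s. i < n \<Longrightarrow> j < n \<Longrightarrow> k < n \<Longrightarrow> l < n \<Longrightarrow> r < n \<Longrightarrow> s < n \<Longrightarrow> A i j k l \<Longrightarrow> A k l r s \<Longrightarrow> A i j r s"
    and tB: "\<And>i j k l r s. i < n \<Longrightarrow> j < n \<Longrightarrow> k < n \<Longrightarrow> l < n \<Longrightarrow> r < n \<Longrightarrow> s < n \<Longrightarrow> B i j k l \<Longrightarrow> B k l r s \<Longrightarrow> B i j r s"
    and share: "\<And>i j k l. i < n \<Longrightarrow> j < n \<Longrightarrow> k < n \<Longrightarrow> l < n \<Longrightarrow> A i j k l \<or> B i j k l \<longleftrightarrow> i = k \<or> j = l"
    and rA: "\<And>i j. A i j i j" and rB: "\<And>i j. B i j i j"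
  shows "(\<forall>i<n. \<forall>j<n. \<forall>k<n. A i j i k) \<and> (\<forall>i<n. \<forall>k<n. \<forall>j<n. B i j k j) \<or>
    (\<forall>i<n. \<forall>j<n. \<forall>k<n. B i j i k) \<and> (\<forall>i<n. \<forall>k<n. \<forall>j<n. A i j k j)"
proof (cases "n \<le> 1")
  case True
  then have "i = k" if "i < n" "k < n" for i k using that by simp
  then have "\<forall>i<n. \<forall>j<n. \<forall>k<n. A i j i k" "\<forall>i<n. \<forall>k<n. \<forall>j<n. B i j k j" using rA rB by blast+
  then show ?thesis by blast
next
  case False
  then have n: "0 < n" "1 < n" by auto
  have "A 0 0 0 1 \<or> B 0 0 0 1" using share[of 0 0 0 1] n by blast
  then show ?thesis
  proof
    assume "A 0 0 0 1"
    have "(\<forall>i<n. \<forall>j<n. \<forall>k<n. A i j i k) \<and> (\<forall>i<n. \<forall>k<n. \<forall>j<n. B i j k j)"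
      by (rule grid_relations_aux[of A B]) (fact sA sB tA tB share rA rB n zero_neq_one \<open>A 0 0 0 1\<close>)+
    then show ?thesis by blast
  next
    assume "B 0 0 0 1"
    have "(\<forall>i<n. \<forall>j<n. \<forall>k<n. B i j i k) \<and> (\<forall>i<n. \<forall>k<n. \<forall>j<n. A i j k j)"
    proof (rule grid_relations_aux[of B A])
      show "B i j k l \<or> A i j k l \<longleftrightarrow> i = k \<or> j = l" if "i < n" "j < n" "k < n" "l < n" for i j k l
        using share[OF that] by blast
    qed (fact sA sB tA tB rA rB n zero_neq_one \<open>B 0 0 0 1\<close>)+
    then show ?thesis by blast
  qed
qed

text \<open>Rows share a left vector and columns a right vector, so the image of the matrix unit at
  (i,j) is c(i,j) u(i) v(j). The scalars form a matrix of rank one and can be absorbed into the two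
  families of vectors.\<close>

lemma mat_linear_eq_mult:
  fixes g :: "complex mat \<Rightarrow> complex mat"
  assumes g: "mat_linear n n g" and n: "0 < n"
    and mz: "\<And>X. X \<in> carrier_mat n n \<Longrightarrow> minors_zero n X \<Longrightarrow> minors_zero n (g X)"
    and T: "\<And>i j. i < n \<Longrightarrow> j < n \<Longrightarrow> g (unit_mat n i j) = outer n (a i j) (b i j)"
    and nz: "\<And>i j. i < n \<Longrightarrow> j < n \<Longrightarrow> \<exists>k<n. a i j k \<noteq> 0" "\<And>i j. i < n \<Longrightarrow> j < n \<Longrightarrow> \<exists>k<n. b i j k \<noteq> 0"
    and rows: "\<And>i j k. i < n \<Longrightarrow> j < n \<Longrightarrow> k < n \<Longrightarrow> parallel n (a i j) (a i k)"
    and cols: "\<And>i j k. i < n \<Longrightarrow> j < n \<Longrightarrow> k < n \<Longrightarrow> parallel n (b i j) (b k j)"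
    and na: "\<And>i k j. i < n \<Longrightarrow> j < n \<Longrightarrow> k < n \<Longrightarrow> i \<noteq> k \<Longrightarrow> \<not> parallel n (a i j) (a k j)"
    and nb: "\<And>i k j. i < n \<Longrightarrow> j < n \<Longrightarrow> k < n \<Longrightarrow> j \<noteq> k \<Longrightarrow> \<not> parallel n (b i j) (b i k)"
  shows "\<exists>U V. U \<in> carrier_mat n n \<and> V \<in> carrier_mat n n \<and> (\<forall>X\<in>carrier_mat n n. g X = U * X * V)"
proof -
  define u v where "u i = a i 0" and "v j = b 0 j" for i j
  have "\<exists>c. c \<noteq> 0 \<and> (\<forall>r<n. \<forall>s<n. g (unit_mat n i j) $$ (r,s) = c * u i r * v j s)" if ij: "i < n" "j < n" for i j
  proof -
    obtain c where c: "\<forall>r<n. a i j r = c * u i r" unfolding u_def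
      using parallel_scale[OF rows[OF ij(1) n ij(2)] nz(1)[OF ij(1) n]] by blast
    obtain d where d: "\<forall>s<n. b i j s = d * v j s" unfolding v_def
      using parallel_scale[OF cols[OF n ij(2) ij(1)] nz(2)[OF n ij(2)]] by blast
    have "c \<noteq> 0" "d \<noteq> 0" using c d nz(1)[OF ij] nz(2)[OF ij] by auto
    moreover have "\<forall>r<n. \<forall>s<n. g (unit_mat n i j) $$ (r,s) = (c * d) * u i r * v j s"
      using c d T[OF ij] by (simp add: mult_ac)
    ultimately show ?thesis by (intro exI[of _ "c * d"]) simp
  qed
  then have "\<forall>i\<in>{0..<n}. \<forall>j\<in>{0..<n}. \<exists>c. c \<noteq> 0 \<and> (\<forall>r<n. \<forall>s<n. g (unit_mat n i j) $$ (r,s) = c * u i r * v j s)"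
    by simp
  then obtain c where c_all: "\<forall>i\<in>{0..<n}. \<forall>j\<in>{0..<n}. c i j \<noteq> 0 \<and>
      (\<forall>r<n. \<forall>s<n. g (unit_mat n i j) $$ (r,s) = c i j * u i r * v j s)"
    unfolding bchoice_iff by blast
  have c: "\<And>i j. i < n \<Longrightarrow> j < n \<Longrightarrow> c i j \<noteq> 0" using c_all by simp
  have gc: "\<And>i j r s. i < n \<Longrightarrow> j < n \<Longrightarrow> r < n \<Longrightarrow> s < n \<Longrightarrow> g (unit_mat n i j) $$ (r,s) = c i j * u i r * v j s"
    using c_all[rule_format] by simp
  \<comment> \<open>Tested on the rank one sum of the four matrix units in rows i, k and columns j,
    l. Its image has rank at most one; as the left vectors are not parallel, the right ones are, and
    a minor of \<open>c\<close> is left.\<close>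
  have rank1: "c i j * c k l = c i l * c k j" if ij: "i < n" "j < n" "k < n" "l < n" for i j k l
  proof (cases "i = k \<or> j = l")
    case False
    let ?p = "\<lambda>x. unit_fun i x + unit_fun k x" and ?q = "\<lambda>x. unit_fun j x + unit_fun l x"
    have "outer n ?p ?q = unit_mat n i j + unit_mat n i l + (unit_mat n k j + unit_mat n k l :: complex mat)"
      by (intro eq_matI) (auto simp: algebra_simps)
    then have "g (outer n ?p ?q) = g (unit_mat n i j) + g (unit_mat n i l) + (g (unit_mat n k j) + g (unit_mat n k l))"
      by (simp add: mat_linearD(2)[OF g])
    also have "\<dots> = outer n (u i) (\<lambda>s. c i j * v j s + c i l * v l s) + outer n (u k) (\<lambda>s. c k j * v j s + c k l * v l s)"
    proof -
      have "dim_row (g (unit_mat n x y)) = n" "dim_col (g (unit_mat n x y)) = n" for x y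
        using mat_linearD(1)[OF g outer_carrier, of "unit_fun x" "unit_fun y"] by auto
      then show ?thesis using ij gc by (intro eq_matI) (auto simp: algebra_simps)
    qed
    finally have "minors_zero n (outer n (u i) (\<lambda>s. c i j * v j s + c i l * v l s) +
        outer n (u k) (\<lambda>s. c k j * v j s + c k l * v l s))"
      using mz[OF outer_carrier minors_zero_outer, of ?p ?q] by simp
    then have "parallel n (\<lambda>s. c i j * v j s + c i l * v l s) (\<lambda>s. c k j * v j s + c k l * v l s)"
      unfolding minors_zero_outer_add using na[OF ij(1) n ij(3)] False unfolding u_def by blast
    then have par: "(c i j * v j s + c i l * v l s) * (c k j * v j t + c k l * v l t) =
       (c i j * v j t + c i l * v l t) * (c k j * v j s + c k l * v l s)" if "s < n" "t < n" for s t
      using that unfolding parallel_def by blast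
    have "\<not> parallel n (v j) (v l)" unfolding v_def using nb[OF n ij(2,4)] False by blast
    then obtain s t where st: "s < n" "t < n" "v j s * v l t \<noteq> v j t * v l s" unfolding parallel_def by blast
    have "(c i j * c k l - c i l * c k j) * (v j s * v l t - v j t * v l s) = 0"
      using par[OF st(1,2)] by (simp add: algebra_simps)
    then show ?thesis using st(3) by simp
  qed auto
  \<comment> \<open>The rank one matrix \<open>c\<close> splits as c(i,j) = c(i,0) c(0,j) / c(0,0),
    one factor for each side.\<close>
  define U where "U = mat n n (\<lambda>(r,i). u i r * (c i 0 / c 0 0))"
  define V where "V = mat n n (\<lambda>(j,s). c 0 j * v j s)"
  have U: "U \<in> carrier_mat n n" and V: "V \<in> carrier_mat n n" by (simp_all add: U_def V_def)
  have "g X = U * X * V" if X: "X \<in> carrier_mat n n" for X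
  proof (rule eq_matI)
    fix r s assume "r < dim_row (U * X * V)" "s < dim_col (U * X * V)"
    then have rs: "r < n" "s < n" using U V by auto
    have UX: "U * X \<in> carrier_mat n n" using U X by simp
    have "(U * X * V) $$ (r,s) = (\<Sum>j=0..<n. (\<Sum>i=0..<n. U $$ (r,i) * X $$ (i,j)) * V $$ (j,s))"
      unfolding mult_mat_index[OF UX V rs] using mult_mat_index[OF U X rs(1)] by (intro sum.cong) auto
    also have "\<dots> = (\<Sum>j=0..<n. \<Sum>i=0..<n. X $$ (i,j) * g (unit_mat n i j) $$ (r,s))"
      unfolding sum_distrib_right
    proof (intro sum.cong refl)
      fix i j assume "i \<in> {0..<n}" "j \<in> {0..<n}"
      then have ij: "i < n" "j < n" by auto
      have "c i j = c i 0 * c 0 j / c 0 0" using rank1[OF ij(1) n n ij(2)] rank1[OF ij n n] c[OF n n]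
        by (simp add: field_simps)
      then show "U $$ (r,i) * X $$ (i,j) * V $$ (j,s) = X $$ (i,j) * g (unit_mat n i j) $$ (r,s)"
        using ij rs gc[OF ij rs] by (simp add: U_def V_def)
    qed
    also have "\<dots> = g X $$ (r,s)" unfolding mat_linear_expand[OF g X rs] by (rule sum.swap)
    finally show "g X $$ (r,s) = (U * X * V) $$ (r,s)" by simp
  qed (use U V mat_linearD(1)[OF g X] in auto)
  then show ?thesis using U V by blast
qed

text \<open>\<open>det_affine\<close> is transported along \<open>g\<close>. Since \<open>g\<close>
  maps onto all matrices, quantifying over base points and over their images is the same.\<close>

lemma det_preserver_minors_zero:
  fixes g :: "complex mat \<Rightarrow> complex mat"
  assumes g: "mat_linear n n g" and bij: "bij_betw g (carrier_mat n n) (carrier_mat n n)"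
    and c: "c \<noteq> 0" and det: "\<And>X. X \<in> carrier_mat n n \<Longrightarrow> det (g X) = c * det X"
    and X: "X \<in> carrier_mat n n"
  shows "minors_zero n (g X) \<longleftrightarrow> minors_zero n X"
proof -
  have gX: "g X \<in> carrier_mat n n" using mat_linearD(1)[OF g X] .
  have img: "g ` carrier_mat n n = carrier_mat n n" using bij by (simp add: bij_betw_def)
  have "det_affine n (g X) \<longleftrightarrow> (\<forall>Y\<in>carrier_mat n n. det (g Y + 2 \<cdot>\<^sub>m g X) = 2 * det (g Y + g X) - det (g Y))"
    unfolding det_affine_def by (subst img[symmetric]) simp
  also have "\<dots> \<longleftrightarrow> (\<forall>Y\<in>carrier_mat n n. c * det (Y + 2 \<cdot>\<^sub>m X) = c * (2 * det (Y + X) - det Y))"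
  proof (intro ball_cong refl)
    fix Y :: "complex mat" assume Y: "Y \<in> carrier_mat n n"
    have "g Y + 2 \<cdot>\<^sub>m g X = g (Y + 2 \<cdot>\<^sub>m X)" "g Y + g X = g (Y + X)"
      using mat_linearD(2,3)[OF g] X Y by simp_all
    then show "(det (g Y + 2 \<cdot>\<^sub>m g X) = 2 * det (g Y + g X) - det (g Y)) =
        (c * det (Y + 2 \<cdot>\<^sub>m X) = c * (2 * det (Y + X) - det Y))"
      using det X Y by (simp add: algebra_simps)
  qed
  also have "\<dots> \<longleftrightarrow> det_affine n X" using c by (simp add: det_affine_def)
  finally show ?thesis using det_affine_iff_minors_zero[OF X] det_affine_iff_minors_zero[OF gX] by simp
qed

text \<open>Frobenius' theorem. Images of matrix units are again outer products, and two matrix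
  units have a sum of rank at most one exactly if they share a row or a column. The induced pattern
  on left and right vectors is that of \<open>grid_relations\<close>.\<close>

theorem det_preserver:
  fixes g :: "complex mat \<Rightarrow> complex mat"
  assumes g: "mat_linear n n g" and bij: "bij_betw g (carrier_mat n n) (carrier_mat n n)"
    and c: "c \<noteq> 0" and det: "\<And>X. X \<in> carrier_mat n n \<Longrightarrow> det (g X) = c * det X" and n: "0 < n"
  shows "\<exists>U V. U \<in> carrier_mat n n \<and> V \<in> carrier_mat n n \<and>
     ((\<forall>X\<in>carrier_mat n n. g X = U * X * V) \<or> (\<forall>X\<in>carrier_mat n n. g X = U * X\<^sup>T * V))"
proof -
  have mz: "minors_zero n (g X) \<longleftrightarrow> minors_zero n X" if "X \<in> carrier_mat n n" for X
    by (rule det_preserver_minors_zero[OF g bij c det that])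
  have inj: "X = Y" if "g X = g Y" "X \<in> carrier_mat n n" "Y \<in> carrier_mat n n" for X Y
    using bij that by (auto simp: bij_betw_def inj_on_def)
  have "\<forall>i\<in>{0..<n}. \<forall>j\<in>{0..<n}. \<exists>z. g (unit_mat n i j) = outer n (fst z) (snd z)"
  proof (intro ballI)
    fix i j
    have "minors_zero n (g (unit_mat n i j))" using mz[OF outer_carrier] minors_zero_outer by blast
    then obtain u v where "g (unit_mat n i j) = outer n u v"
      using minors_zero_imp_outer[OF mat_linearD(1)[OF g outer_carrier]] by blast
    then show "\<exists>z. g (unit_mat n i j) = outer n (fst z) (snd z)" by (intro exI[of _ "(u,v)"]) simp
  qed
  then obtain z where z: "\<And>i j. i < n \<Longrightarrow> j < n \<Longrightarrow> g (unit_mat n i j) = outer n (fst (z i j)) (snd (z i j))"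
    unfolding bchoice_iff by auto
  define a b where "a i j = fst (z i j)" and "b i j = snd (z i j)" for i j
  have T: "g (unit_mat n i j) = outer n (a i j) (b i j)" if "i < n" "j < n" for i j
    using z[OF that] by (simp add: a_def b_def)
  have unz: "unit_mat n i j \<noteq> (0\<^sub>m n n :: complex mat)" if "i < n" "j < n" for i j
  proof
    assume "unit_mat n i j = (0\<^sub>m n n :: complex mat)"
    then have "unit_mat n i j $$ (i,j) = (0\<^sub>m n n :: complex mat) $$ (i,j)" by simp
    then show False using that by (simp add: unit_fun_def)
  qed
  have nz: "(\<exists>k<n. a i j k \<noteq> 0) \<and> (\<exists>k<n. b i j k \<noteq> 0)" if ij: "i < n" "j < n" for i j
  proof (rule ccontr)
    assume "\<not> ?thesis"
    then have "outer n (a i j) (b i j) = 0\<^sub>m n n" by (intro eq_matI) auto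
    then have "g (unit_mat n i j) = g (0\<^sub>m n n)" using T[OF ij] mat_linear_zero[OF g] by simp
    then show False using inj[of "unit_mat n i j" "0\<^sub>m n n"] unz[OF ij] by simp
  qed
  note nza = nz[THEN conjunct1] and nzb = nz[THEN conjunct2]
  have pu: "parallel n (unit_fun i) (unit_fun k :: nat \<Rightarrow> complex) \<longleftrightarrow> i = k" if "i < n" "k < n" for i k
  proof
    assume p: "parallel n (unit_fun i) (unit_fun k :: nat \<Rightarrow> complex)"
    then have "(unit_fun i i :: complex) * unit_fun k k = unit_fun i k * unit_fun k i"
      using that unfolding parallel_def by blast
    then show "i = k" by (simp add: unit_fun_def split: if_splits)
  qed (simp add: parallel_refl)
  have share: "parallel n (a i j) (a k l) \<or> parallel n (b i j) (b k l) \<longleftrightarrow> i = k \<or> j = l"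
    if ij: "i < n" "j < n" "k < n" "l < n" for i j k l
  proof -
    have "parallel n (a i j) (a k l) \<or> parallel n (b i j) (b k l) \<longleftrightarrow> minors_zero n (g (unit_mat n i j + unit_mat n k l))"
      unfolding mat_linearD(2)[OF g outer_carrier outer_carrier] T[OF ij(1,2)] T[OF ij(3,4)] minors_zero_outer_add ..
    also have "\<dots> \<longleftrightarrow> minors_zero n (unit_mat n i j + unit_mat n k l :: complex mat)" by (rule mz) simp
    also have "\<dots> \<longleftrightarrow> i = k \<or> j = l" unfolding minors_zero_outer_add using pu ij by simp
    finally show ?thesis .
  qed
  \<comment> \<open>If both factors were parallel, the images would be proportional, contrary to
    injectivity.\<close>
  have excl: "i = k \<and> j = l" if ij: "i < n" "j < n" "k < n" "l < n"
    and p: "parallel n (a i j) (a k l)" "parallel n (b i j) (b k l)" for i j k l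
  proof -
    obtain x where x: "\<forall>r<n. a k l r = x * a i j r" using parallel_scale[OF p(1) nza[OF ij(1,2)]] by blast
    obtain y where y: "\<forall>r<n. b k l r = y * b i j r" using parallel_scale[OF p(2) nzb[OF ij(1,2)]] by blast
    have "outer n (a k l) (b k l) = (x * y) \<cdot>\<^sub>m outer n (a i j) (b i j)"
      using x y by (intro eq_matI) auto
    then have "g (unit_mat n k l) = g ((x * y) \<cdot>\<^sub>m unit_mat n i j)"
      using T[OF ij(1,2)] T[OF ij(3,4)] mat_linearD(3)[OF g outer_carrier] by simp
    then have "unit_mat n k l = (x * y) \<cdot>\<^sub>m unit_mat n i j" by (rule inj) auto
    then have "(unit_mat n k l :: complex mat) $$ (k,l) = ((x * y) \<cdot>\<^sub>m unit_mat n i j) $$ (k,l)" by simp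
    then show ?thesis using ij by (simp add: unit_fun_def split: if_splits)
  qed
  let ?A = "\<lambda>i j k l. parallel n (a i j) (a k l)" and ?B = "\<lambda>i j k l. parallel n (b i j) (b k l)"
  have "(\<forall>i<n. \<forall>j<n. \<forall>k<n. ?A i j i k) \<and> (\<forall>i<n. \<forall>k<n. \<forall>j<n. ?B i j k j) \<or>
    (\<forall>i<n. \<forall>j<n. \<forall>k<n. ?B i j i k) \<and> (\<forall>i<n. \<forall>k<n. \<forall>j<n. ?A i j k j)"
  proof (rule grid_relations)
    show "?A i j k l \<Longrightarrow> ?A k l i j" "?B i j k l \<Longrightarrow> ?B k l i j" for i j k l by (rule parallel_sym, assumption)+
    show "?A i j r s" if "k < n" "l < n" "?A i j k l" "?A k l r s" for i j k l r s
      by (rule parallel_trans[OF that(3,4) nza[OF that(1,2)]])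
    show "?B i j r s" if "k < n" "l < n" "?B i j k l" "?B k l r s" for i j k l r s
      by (rule parallel_trans[OF that(3,4) nzb[OF that(1,2)]])
  qed (use share in \<open>simp_all add: parallel_refl\<close>)
  then show ?thesis
  proof
    assume *: "(\<forall>i<n. \<forall>j<n. \<forall>k<n. ?A i j i k) \<and> (\<forall>i<n. \<forall>k<n. \<forall>j<n. ?B i j k j)"
    have "\<exists>U V. U \<in> carrier_mat n n \<and> V \<in> carrier_mat n n \<and> (\<forall>X\<in>carrier_mat n n. g X = U * X * V)"
    proof (rule mat_linear_eq_mult[OF g n _ T nza nzb])
      show "minors_zero n (g X)" if "X \<in> carrier_mat n n" "minors_zero n X" for X using mz that by blast
      show "\<not> ?A i j k j" if "i < n" "j < n" "k < n" "i \<noteq> k" for i j k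
        using excl[of i j k j] * that by blast
      show "\<not> ?B i j i k" if "i < n" "j < n" "k < n" "j \<noteq> k" for i j k
        using excl[of i j i k] * that by blast
    qed (use * in blast)+
    then show ?thesis by blast
  next
    assume *: "(\<forall>i<n. \<forall>j<n. \<forall>k<n. ?B i j i k) \<and> (\<forall>i<n. \<forall>k<n. \<forall>j<n. ?A i j k j)"
    \<comment> \<open>Transposing the argument reduces the second pattern to the first.\<close>
    define g' where "g' X = g (X\<^sup>T)" for X
    have "\<exists>U V. U \<in> carrier_mat n n \<and> V \<in> carrier_mat n n \<and> (\<forall>X\<in>carrier_mat n n. g' X = U * X * V)"
    proof (rule mat_linear_eq_mult[where a = "\<lambda>i j. a j i" and b = "\<lambda>i j. b j i", OF _ n])
      show "mat_linear n n g'" unfolding mat_linear_def g'_def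
      proof (intro conjI ballI allI)
        fix X Y :: "complex mat" and x assume X: "X \<in> carrier_mat n n" 
        show "g (X\<^sup>T) \<in> carrier_mat n n" using mat_linearD(1)[OF g] X by simp
        show "g ((x \<cdot>\<^sub>m X)\<^sup>T) = x \<cdot>\<^sub>m g (X\<^sup>T)"
        proof -
          have "(x \<cdot>\<^sub>m X)\<^sup>T = x \<cdot>\<^sub>m X\<^sup>T" by (intro eq_matI) auto
          then show ?thesis using mat_linearD(3)[OF g, of "X\<^sup>T" x] X by simp
        qed
        assume Y: "Y \<in> carrier_mat n n"
        show "g ((X + Y)\<^sup>T) = g (X\<^sup>T) + g (Y\<^sup>T)"
          using mat_linearD(2)[OF g, of "X\<^sup>T" "Y\<^sup>T"] X Y by (simp add: transpose_add)
      qed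
      show "minors_zero n (g' X)" if X: "X \<in> carrier_mat n n" "minors_zero n X" for X
      proof -
        have "minors_zero n (X\<^sup>T)" using X by (auto simp: minors_zero_def mult.commute)
        then show ?thesis unfolding g'_def using mz[of "X\<^sup>T"] X by simp
      qed
      show "g' (unit_mat n i j) = outer n (a j i) (b j i)" if "i < n" "j < n" for i j
      proof -
        have "(unit_mat n i j)\<^sup>T = (unit_mat n j i :: complex mat)" by (intro eq_matI) (auto simp: mult.commute)
        then show ?thesis unfolding g'_def using T[OF that(2,1)] by simp
      qed
      show "\<exists>k<n. a j i k \<noteq> 0" "\<exists>k<n. b j i k \<noteq> 0" if "i < n" "j < n" for i j
        using nza[OF that(2,1)] nzb[OF that(2,1)] by auto
      show "\<not> parallel n (a j i) (a j k)" if "i < n" "j < n" "k < n" "i \<noteq> k" for i j k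
        using excl[of j i j k] * that by blast
      show "\<not> parallel n (b j i) (b k i)" if "i < n" "j < n" "k < n" "j \<noteq> k" for i j k
        using excl[of j i k i] * that by blast
    qed (use * in blast)+
    then obtain U V where UV: "U \<in> carrier_mat n n" "V \<in> carrier_mat n n"
      "\<And>X. X \<in> carrier_mat n n \<Longrightarrow> g (X\<^sup>T) = U * X * V" unfolding g'_def by blast
    have "g X = U * X\<^sup>T * V" if "X \<in> carrier_mat n n" for X
      using UV(3)[of "X\<^sup>T"] that by simp
    then show ?thesis using UV(1,2) by blast
  qed
qed

section \<open>Equivariant representations of the permanent\<close>

lemma module_hom_mat_iff:
  "f \<in> LinearCombinations.module_hom class_ring (Mat_space m) (Mat_space n) \<longleftrightarrow> mat_linear m n f"
  by (auto simp: LinearCombinations.module_hom_def mat_linear_def module_mat_simps)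

section \<open>Scalings and permutation matrices as test elements\<close>

lemma perm_scale:
  assumes y: "y \<in> carrier_mat m m"
  shows "perm (mat m m (\<lambda>(i,j). a i * b j * y $$ (i,j))) = (\<Prod>i=0..<m. a i) * (\<Prod>j=0..<m. b j) * perm y"
proof -
  have "(\<Prod>i=0..<m. mat m m (\<lambda>(i,j). a i * b j * y $$ (i,j)) $$ (i, \<sigma> i)) =
      (\<Prod>i=0..<m. a i) * (\<Prod>j=0..<m. b j) * (\<Prod>i=0..<m. y $$ (i, \<sigma> i))" if \<sigma>: "\<sigma> permutes {0..<m}" for \<sigma>
  proof -
    have "(\<Prod>i=0..<m. mat m m (\<lambda>(i,j). a i * b j * y $$ (i,j)) $$ (i, \<sigma> i)) =
        (\<Prod>i=0..<m. a i * b (\<sigma> i) * y $$ (i, \<sigma> i))"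
      using permutes_in_image[OF \<sigma>] by (intro prod.cong) auto
    also have "\<dots> = (\<Prod>i=0..<m. a i) * (\<Prod>i=0..<m. b (\<sigma> i)) * (\<Prod>i=0..<m. y $$ (i, \<sigma> i))"
      by (simp add: prod.distrib)
    also have "(\<Prod>i=0..<m. b (\<sigma> i)) = (\<Prod>j=0..<m. b j)" using prod.permute[OF \<sigma>, of b] by (simp add: comp_def)
    finally show ?thesis .
  qed
  note scale = this
  have "perm (mat m m (\<lambda>(i,j). a i * b j * y $$ (i,j))) =
      (\<Sum>\<sigma> | \<sigma> permutes {0..<m}. (\<Prod>i=0..<m. a i) * (\<Prod>j=0..<m. b j) * (\<Prod>i=0..<m. y $$ (i, \<sigma> i)))"
    unfolding perm_def dim_row_mat by (rule sum.cong[OF refl]) (rule scale, simp)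
  then show ?thesis using y by (simp add: perm_def sum_distrib_left)
qed

definition perm_mat :: "nat \<Rightarrow> (nat \<Rightarrow> nat) \<Rightarrow> complex mat" where
  "perm_mat m \<sigma> = mat m m (\<lambda>(i,j). if j = \<sigma> i then 1 else 0)"

lemma perm_mat_carrier [simp]: "perm_mat m \<sigma> \<in> carrier_mat m m"
  by (simp add: perm_mat_def)

lemma perm_perm_mat:
  assumes \<sigma>: "\<sigma> permutes {0..<m}"
  shows "perm (perm_mat m \<sigma>) = 1"
proof -
  have "(\<Prod>i=0..<m. perm_mat m \<sigma> $$ (i, \<tau> i)) = (if \<tau> = \<sigma> then 1 else 0)" if \<tau>: "\<tau> permutes {0..<m}" for \<tau>
  proof (cases "\<tau> = \<sigma>")
    case True
    then show ?thesis using permutes_in_image[OF \<sigma>] by (auto simp: perm_mat_def intro!: prod.neutral)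
  next
    case False
    then obtain i where i: "\<tau> i \<noteq> \<sigma> i" by blast
    then have "i < m" using \<sigma> \<tau> by (metis atLeastLessThan_iff le0 permutes_not_in)
    then have "perm_mat m \<sigma> $$ (i, \<tau> i) = 0" using i permutes_in_image[OF \<tau>, of i] by (simp add: perm_mat_def)
    then show ?thesis using False \<open>i < m\<close> by (auto intro!: prod_zero)
  qed
  then have "perm (perm_mat m \<sigma>) = (\<Sum>\<tau> | \<tau> permutes {0..<m}. if \<tau> = \<sigma> then 1 else 0)"
    unfolding perm_def by (intro sum.cong) (auto simp: perm_mat_def)
  then show ?thesis using \<sigma> by (simp add: finite_permutations)
qed

text \<open>The restriction selects the extensional representative that \<open>GL\<close> asks
  for.\<close>

definition scaling :: "nat \<Rightarrow> (nat \<Rightarrow> complex) \<Rightarrow> (nat \<Rightarrow> complex) \<Rightarrow> complex mat \<Rightarrow> complex mat" where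
  "scaling m a b = restrict (\<lambda>y. mat m m (\<lambda>(i,j). a i * b j * y $$ (i,j))) (carrier_mat m m)"

lemma scaling_carrier: "y \<in> carrier_mat m m \<Longrightarrow> scaling m a b y \<in> carrier_mat m m"
  by (simp add: scaling_def)

lemma perm_scaling:
  "y \<in> carrier_mat m m \<Longrightarrow> perm (scaling m a b y) = (\<Prod>i=0..<m. a i) * (\<Prod>j=0..<m. b j) * perm y"
  by (simp add: scaling_def perm_scale)

lemma scaling_unit_mat:
  "i < m \<Longrightarrow> j < m \<Longrightarrow> scaling m a b (unit_mat m i j) = (a i * b j) \<cdot>\<^sub>m unit_mat m i j"
  by (intro eq_matI) (auto simp: scaling_def unit_fun_def)

lemma scaling_inverse:
  assumes "\<And>i. i < m \<Longrightarrow> a i \<noteq> 0 \<and> b i \<noteq> 0" "y \<in> carrier_mat m m"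
  shows "scaling m a b (scaling m (\<lambda>i. 1 / a i) (\<lambda>j. 1 / b j) y) = y"
    "scaling m (\<lambda>i. 1 / a i) (\<lambda>j. 1 / b j) (scaling m a b y) = y"
  using assms by (auto simp: scaling_def intro!: eq_matI)

lemma scaling_in_proj_sym_group:
  assumes nz: "\<And>i. i < m \<Longrightarrow> a i \<noteq> 0 \<and> b i \<noteq> 0"
  shows "scaling m a b \<in> proj_sym_group (Mat_space m) perm"
proof -
  let ?h = "scaling m a b" and ?k = "scaling m (\<lambda>i. 1 / a i) (\<lambda>j. 1 / b j)" and ?C = "carrier_mat m m :: complex mat set"
  have bij: "bij_betw ?h ?C ?C"
    by (rule bij_betw_byWitness[where f' = ?k]) (use scaling_inverse[OF nz] scaling_carrier in auto)
  have lin: "mat_linear m m ?h"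
    unfolding mat_linear_def by (auto simp: scaling_def intro!: eq_matI simp: algebra_simps)
  have inv: "inv_into ?C ?h y = ?k y" if y: "y \<in> ?C" for y
    using inv_into_f_eq[of ?h ?C "?k y" y] bij scaling_inverse(1)[OF nz y] scaling_carrier[OF y]
    by (simp add: bij_betw_def)
  let ?c = "(\<Prod>i=0..<m. 1 / a i) * (\<Prod>j=0..<m. 1 / b j)"
  have "?c \<noteq> 0" using nz by simp
  moreover have "perm (inv_into ?C ?h y) = ?c * perm y" if "y \<in> ?C" for y
    using inv[OF that] perm_scaling[OF that] by simp
  moreover have "?h \<in> extensional ?C" by (simp add: scaling_def)
  ultimately show ?thesis using bij lin
    unfolding proj_sym_group_def GL_def module_hom_mat_iff module_mat_simps by blast
qed

text \<open>\<open>inv_into\<close> picks some preimage of \<open>g (A y)\<close>, which exists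
  because \<open>g\<close> preserves the image of \<open>A\<close>; applying \<open>A\<close>
  recovers \<open>g (A y)\<close>.\<close>

lemma rho_bar_intertwines:
  assumes g: "g ` (A ` carrier V) = A ` carrier V" and h: "rho_bar V A g = h" and y: "y \<in> carrier V"
  shows "g (A y) = A (h y)"
proof -
  have "g (A y) \<in> A ` carrier V" using g y by blast
  then have "A (inv_into (carrier V) A (g (A y))) = g (A y)" by (rule f_inv_into_f)
  then show ?thesis using h y by (auto simp: rho_bar_def)
qed

lemma proj_sym_group_det:
  assumes "g \<in> proj_sym_group (Mat_space n) det"
  shows "mat_linear n n g" "bij_betw g (carrier_mat n n) (carrier_mat n n)"
    "\<exists>c. c \<noteq> 0 \<and> (\<forall>X\<in>carrier_mat n n. det (g X) = c * det X)"
proof -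
  let ?C = "carrier_mat n n :: complex mat set"
  show lin: "mat_linear n n g" and bij: "bij_betw g ?C ?C"
    using assms unfolding proj_sym_group_def GL_def module_hom_mat_iff module_mat_simps by blast+
  obtain c where c: "c \<noteq> 0" "\<And>y. y \<in> ?C \<Longrightarrow> det (inv_into ?C g y) = c * det y"
    using assms unfolding proj_sym_group_def module_mat_simps by blast
  have "det (g X) = (1 / c) * det X" if X: "X \<in> ?C" for X
  proof -
    have "inv_into ?C g (g X) = X" using bij X by (simp add: bij_betw_def)
    then show ?thesis using c(2)[OF mat_linearD(1)[OF lin X]] c(1) by simp
  qed
  then show "\<exists>c. c \<noteq> 0 \<and> (\<forall>X\<in>?C. det (g X) = c * det X)" using c(1) by (intro exI[of _ "1 / c"]) simp
qed

text \<open>Squaring removes the transpose from Frobenius' description of the determinant preservers.\<close>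

lemma det_preserver_square:
  fixes g :: "complex mat \<Rightarrow> complex mat"
  assumes g: "mat_linear n n g" and bij: "bij_betw g (carrier_mat n n) (carrier_mat n n)"
    and c: "c \<noteq> 0" and det: "\<And>X. X \<in> carrier_mat n n \<Longrightarrow> det (g X) = c * det X" and n: "0 < n"
  shows "\<exists>B C. B \<in> carrier_mat n n \<and> C \<in> carrier_mat n n \<and> det B * det C = c\<^sup>2 \<and>
     (\<forall>X\<in>carrier_mat n n. g (g X) = B * X * C)"
proof -
  obtain U V where UV: "U \<in> carrier_mat n n" "V \<in> carrier_mat n n"
    and or: "(\<forall>X\<in>carrier_mat n n. g X = U * X * V) \<or> (\<forall>X\<in>carrier_mat n n. g X = U * X\<^sup>T * V)"
    using det_preserver[OF g bij c det n] by blast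
  have "g (1\<^sub>m n) = U * V"
  proof -
    have "U * 1\<^sub>m n * V = U * V" using UV by simp
    then show ?thesis using or transpose_one one_carrier_mat by metis
  qed
  then have "det U * det V = det (g (1\<^sub>m n))" using det_mult[OF UV] by simp
  \<comment> \<open>The identity is symmetric, so both forms of \<open>g\<close> have the same value
    there.\<close>
  then have dUV: "det U * det V = c" using det[of "1\<^sub>m n"] by simp
  from or show ?thesis
  proof
    assume e: "\<forall>X\<in>carrier_mat n n. g X = U * X * V"
    have "g (g X) = (U * U) * X * (V * V)" if X: "X \<in> carrier_mat n n" for X
    proof -
      have "U * X * V \<in> carrier_mat n n" using X UV by simp
      then have "g (g X) = U * (U * X * V) * V" using e X by metis
      also have "\<dots> = (U * U) * X * (V * V)" using X UV
        by (simp add: assoc_mult_mat[of _ n n _ n _ n] mult_carrier_mat_square)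
      finally show ?thesis .
    qed
    moreover have "det (U * U) * det (V * V) = c\<^sup>2"
      using UV unfolding dUV[symmetric] by (simp add: det_mult[of _ n] power2_eq_square mult_ac)
    ultimately show ?thesis using UV
      by (intro exI[of _ "U * U"] exI[of _ "V * V"]) (simp add: mult_carrier_mat_square)
  next
    assume e: "\<forall>X\<in>carrier_mat n n. g X = U * X\<^sup>T * V"
    have "g (g X) = (U * V\<^sup>T) * X * (U\<^sup>T * V)" if X: "X \<in> carrier_mat n n" for X
    proof -
      have "(U * X\<^sup>T * V)\<^sup>T = V\<^sup>T * (U * X\<^sup>T)\<^sup>T"
        by (rule transpose_mult[of _ n n _ n]) (use UV X in \<open>simp_all add: mult_carrier_mat_square\<close>)
      also have "(U * X\<^sup>T)\<^sup>T = X * U\<^sup>T" using transpose_mult[of U n n "X\<^sup>T" n] UV X by simp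
      finally have t: "(U * X\<^sup>T * V)\<^sup>T = V\<^sup>T * (X * U\<^sup>T)" .
      have "U * X\<^sup>T * V \<in> carrier_mat n n" using X UV by simp
      then have "g (g X) = U * (U * X\<^sup>T * V)\<^sup>T * V" using e X by metis
      also have "\<dots> = (U * V\<^sup>T) * X * (U\<^sup>T * V)" unfolding t using X UV
        by (simp add: assoc_mult_mat[of _ n n _ n _ n] mult_carrier_mat_square)
      finally show ?thesis .
    qed
    moreover have "det (U * V\<^sup>T) * det (U\<^sup>T * V) = c\<^sup>2"
      using UV unfolding dUV[symmetric] by (simp add: det_mult[of _ n] det_transpose[of _ n] power2_eq_square mult_ac)
    ultimately show ?thesis using UV
      by (intro exI[of _ "U * V\<^sup>T"] exI[of _ "U\<^sup>T * V"]) (simp add: mult_carrier_mat_square)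
  qed
qed

lemma mat_linear_mult_both:
  fixes A :: "complex mat \<Rightarrow> complex mat"
  assumes A: "mat_linear m n A" and P: "P \<in> carrier_mat n n" and Q: "Q \<in> carrier_mat n n"
  shows "mat_linear m n (\<lambda>y. P * A y * Q)"
  unfolding mat_linear_def
proof (intro conjI ballI allI)
  fix X Y :: "complex mat" and c assume X: "X \<in> carrier_mat m m"
  have AX: "A X \<in> carrier_mat n n" using mat_linearD(1)[OF A X] .
  show "P * A X * Q \<in> carrier_mat n n" using P Q AX by simp
  show "P * A (c \<cdot>\<^sub>m X) * Q = c \<cdot>\<^sub>m (P * A X * Q)"
    unfolding mat_linearD(3)[OF A X] using P Q AX
    by (simp add: mult_smult_distrib[of _ n n _ n] mult_smult_assoc_mat[of _ n n _ n] mult_carrier_mat_square)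
  assume Y: "Y \<in> carrier_mat m m"
  have AY: "A Y \<in> carrier_mat n n" using mat_linearD(1)[OF A Y] .
  show "P * A (X + Y) * Q = P * A X * Q + P * A Y * Q"
    unfolding mat_linearD(2)[OF A X Y] using P Q AX AY
    by (simp add: mult_add_distrib_mat[of _ n n _ n] add_mult_distrib_mat[of _ n n _ _ n] mult_carrier_mat_square)
qed

lemma ex_distinct_primes: "\<exists>p. distinct_primes p"
proof -
  obtain p :: "nat \<Rightarrow> nat" where "inj p" "range p \<subseteq> {q. prime q}"
    using infinite_countable_subset[OF primes_infinite] by blast
  then show ?thesis unfolding distinct_primes_def by blast
qed

text \<open>Turns an equivariant representation into a \<open>weighted_pencil\<close>. The squared
  lift fixes \<Lambda> and multiplies the coefficient matrix of the variable at (i,j) by its weight,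
  so both are homogeneous in the bases of \<open>ex_graded_basis\<close>. The normal form of
  \<Lambda> is then taken within the grading.\<close>

theorem choose_le_equivariant_size:
  assumes m3: "3 \<le> m" and rep: "equivariant_det_rep (Mat_space m) perm n \<Lambda> A"
  shows "m choose l \<le> n"
proof -
  obtain p where "distinct_primes p" using ex_distinct_primes by blast
  then interpret distinct_primes p .
  define a b where "a i = (of_nat (p i) :: complex)" and "b j = (of_nat (p (m + j)) :: complex)" for i j
  define h where "h = scaling m a b"
  have ab: "a i \<noteq> 0 \<and> b i \<noteq> 0" for i
    using prime_gt_0_nat[OF prime[of i]] prime_gt_0_nat[OF prime[of "m + i"]] by (simp add: a_def b_def)
  have wt: "(of_nat (wt m i j) :: complex) = (a i * b j) * (a i * b j)" for i j
    by (simp add: wt_def a_def b_def power2_eq_square)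
  have L: "\<Lambda> \<in> carrier_mat n n" and A: "mat_linear m n A"
    and det: "\<And>y. y \<in> carrier_mat m m \<Longrightarrow> perm y = det (\<Lambda> + A y)"
    and eq: "rho_bar (Mat_space m) A ` rep_group (Mat_space m) n \<Lambda> A = proj_sym_group (Mat_space m) perm"
    using rep unfolding equivariant_det_rep_def det_rep_def module_hom_mat_iff module_mat_simps by blast+
  have Ac: "A y \<in> carrier_mat n n" if "y \<in> carrier_mat m m" for y using mat_linearD(1)[OF A that] .
  have "h \<in> proj_sym_group (Mat_space m) perm" unfolding h_def by (rule scaling_in_proj_sym_group) (rule ab)
  then obtain g where g: "g \<in> rep_group (Mat_space m) n \<Lambda> A" and hg: "rho_bar (Mat_space m) A g = h"
    using eq by (metis imageE)
  have gP: "g \<in> proj_sym_group (Mat_space n) det" and gL: "g \<Lambda> = \<Lambda>"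
    and gA: "g ` (A ` carrier (Mat_space m)) = A ` carrier (Mat_space m)"
    using g unfolding rep_group_def by blast+
  note lin = proj_sym_group_det(1)[OF gP] and bij = proj_sym_group_det(2)[OF gP]
  obtain c where c: "c \<noteq> 0" "\<And>X. X \<in> carrier_mat n n \<Longrightarrow> det (g X) = c * det X"
    using proj_sym_group_det(3)[OF gP] by blast
  have gAh: "g (A y) = A (h y)" if "y \<in> carrier_mat m m" for y
    by (rule rho_bar_intertwines[OF gA hg]) (use that in \<open>simp add: module_mat_simps\<close>)
  have hc: "h y \<in> carrier_mat m m" if "y \<in> carrier_mat m m" for y
    unfolding h_def by (rule scaling_carrier[OF that])
  \<comment> \<open>The empty determinant is 1, whereas the permanent vanishes at 0.\<close>
  have n: "0 < n"
  proof (rule ccontr)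
    assume "\<not> 0 < n"
    then have "det (\<Lambda> + A (0\<^sub>m m m)) = 1" using L Ac[of "0\<^sub>m m m"] by (intro det_dim_zero) auto
    then have "perm (0\<^sub>m m m) = 1" using det[of "0\<^sub>m m m"] by simp
    moreover have "perm (0\<^sub>m m m) = 0" unfolding perm_def
    proof (rule sum.neutral, rule ballI, rule prod_zero)
      fix \<sigma> assume "\<sigma> \<in> {\<sigma>. \<sigma> permutes {0..<dim_row (0\<^sub>m m m :: complex mat)}}"
      then have "\<sigma> permutes {0..<m}" by simp
      then have "\<sigma> 0 < m" using permutes_in_image[of \<sigma> "{0..<m}" 0] m3 by simp
      then show "\<exists>i\<in>{0..<dim_row (0\<^sub>m m m :: complex mat)}. (0\<^sub>m m m :: complex mat) $$ (i, \<sigma> i) = 0"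
        using m3 by (intro bexI[of _ 0]) auto
    qed simp
    ultimately show False by simp
  qed
  obtain B C where B: "B \<in> carrier_mat n n" and C: "C \<in> carrier_mat n n" and BC: "det B * det C = c\<^sup>2"
    and gg: "\<And>X. X \<in> carrier_mat n n \<Longrightarrow> g (g X) = B * X * C"
    using det_preserver_square[OF lin bij c n] by blast
  have dBC: "det B \<noteq> 0" "det C \<noteq> 0" using BC c(1) by auto
  obtain P Q \<beta> \<gamma> where P: "P \<in> carrier_mat n n" "det P \<noteq> 0" and Q: "Q \<in> carrier_mat n n" "det Q \<noteq> 0"
    and nz: "\<forall>i<n. \<beta> i \<noteq> 0 \<and> \<gamma> i \<noteq> 0"
    and prods: "(\<Prod>i=0..<n. \<beta> i) = det B * det C * (\<Prod>i=0..<n. \<gamma> i)"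
    and gr: "\<forall>M\<in>carrier_mat n n. \<forall>x. B * M * C = x \<cdot>\<^sub>m M \<longrightarrow> graded n \<beta> (\<lambda>j. x * \<gamma> j) (P * M * Q)"
    using ex_graded_basis[OF B dBC(1) C dBC(2)] by (elim exE conjE) (rule that)
  have "B * \<Lambda> * C = 1 \<cdot>\<^sub>m \<Lambda>"
  proof -
    have "1 \<cdot>\<^sub>m \<Lambda> = \<Lambda>" by (intro eq_matI) auto
    then show ?thesis using gg[OF L] gL by simp
  qed
  then have "graded n \<beta> (\<lambda>j. 1 * \<gamma> j) (P * \<Lambda> * Q)" using gr L by blast
  then have grL: "graded n \<beta> \<gamma> (P * \<Lambda> * Q)" by simp
  have grA: "graded n \<beta> (\<lambda>s. of_nat (wt m i j) * \<gamma> s) (P * A (unit_mat m i j) * Q)" if ij: "i < m" "j < m" for i j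
  proof -
    let ?E = "unit_mat m i j :: complex mat"
    have "B * A ?E * C = g (g (A ?E))" using gg[OF Ac[OF outer_carrier]] by simp
    also have "\<dots> = A (h (h ?E))" using gAh hc by simp
    also have "h (h ?E) = (a i * b j) \<cdot>\<^sub>m ((a i * b j) \<cdot>\<^sub>m ?E)"
    proof -
      have "h ((a i * b j) \<cdot>\<^sub>m ?E) = (a i * b j) \<cdot>\<^sub>m h ?E"
        by (intro eq_matI) (auto simp: h_def scaling_def)
      then show ?thesis unfolding h_def scaling_unit_mat[OF ij] by simp
    qed
    also have "A \<dots> = (a i * b j) \<cdot>\<^sub>m ((a i * b j) \<cdot>\<^sub>m A ?E)" using mat_linearD(3)[OF A] by simp
    also have "\<dots> = of_nat (wt m i j) \<cdot>\<^sub>m A ?E" unfolding wt by (intro eq_matI) auto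
    finally show ?thesis using gr Ac[OF outer_carrier] by blast
  qed
  obtain P' Q' \<beta>' \<gamma>' q where P': "graded n \<beta>' \<beta> P'" "det P' \<noteq> 0" and Q': "graded n \<gamma> \<gamma>' Q'" "det Q' \<noteq> 0"
    and q: "q \<le> n" and nf: "P' * (P * \<Lambda> * Q) * Q' = rank_mat n q"
    using graded_rank_normal_form[OF grL, of 0] by auto
  note P'c = gradedD(1)[OF P'(1)] and Q'c = gradedD(1)[OF Q'(1)]
  define f where "f y = P' * (P * A y * Q) * Q'" for y
  have f: "mat_linear m n f" unfolding f_def
    by (rule mat_linear_mult_both[OF mat_linear_mult_both[OF A P(1) Q(1)] P'c Q'c])
  have grf: "graded n \<beta>' (\<lambda>s. of_nat (wt m i j) * \<gamma>' s) (f (unit_mat m i j))" if ij: "i < m" "j < m" for i j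
    unfolding f_def by (rule graded_mult[OF graded_mult[OF P'(1) grA[OF ij]] graded_comp[OF Q'(1)]])
  have prods': "(\<Prod>i=0..<n. \<beta>' i) = (\<Prod>i=0..<n. \<beta> i)" "(\<Prod>i=0..<n. \<gamma> i) = (\<Prod>i=0..<n. \<gamma>' i)"
    using prod_weights_eq[OF P'] prod_weights_eq[OF Q'] by simp_all
  have nz': "\<beta>' i \<noteq> 0" "\<gamma>' i \<noteq> 0" if "i < n" for i
  proof -
    have "(\<Prod>i=0..<n. \<beta> i) \<noteq> 0" "(\<Prod>i=0..<n. \<gamma> i) \<noteq> 0" using nz by auto
    then have "(\<Prod>i=0..<n. \<beta>' i) \<noteq> 0" "(\<Prod>i=0..<n. \<gamma>' i) \<noteq> 0" unfolding prods' by auto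
    then show "\<beta>' i \<noteq> 0" "\<gamma>' i \<noteq> 0" using that by auto
  qed
  have const: "\<beta>' i = \<gamma>' i" if "i < q" for i
  proof -
    have "graded n \<beta>' \<gamma>' (rank_mat n q :: complex mat)"
      unfolding nf[symmetric] by (rule graded_mult[OF graded_mult[OF P'(1) grL] Q'(1)])
    from gradedD(2)[OF this, of i i] that q show ?thesis by (simp add: rank_mat_def)
  qed
  \<comment> \<open>Applying the lift twice at the identity matrix computes the multiplier of the
    determinant. With \<open>prods\<close> this becomes the assumption \<open>total\<close> of the
    pencil.\<close>
  have c2: "c\<^sup>2 = (\<Prod>i=0..<m. of_nat (wt m i i))"
  proof -
    let ?I = "perm_mat m id"
    have "perm (h (h ?I)) = det (g (g (\<Lambda> + A ?I)))"
    proof -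
      have "g (\<Lambda> + A y) = \<Lambda> + A (h y)" if "y \<in> carrier_mat m m" for y
        using mat_linearD(2)[OF lin L Ac[OF that]] gL gAh[OF that] by simp
      then show ?thesis using det[of "h (h ?I)"] hc by simp
    qed
    also have "\<dots> = c * (c * det (\<Lambda> + A ?I))" using c(2) L Ac[of ?I] mat_linearD(1)[OF lin] by simp
    also have "\<dots> = c\<^sup>2" using det[of ?I] perm_perm_mat[OF permutes_id] by (simp add: power2_eq_square)
    finally have "c\<^sup>2 = (\<Prod>i=0..<m. a i) * (\<Prod>j=0..<m. b j) * ((\<Prod>i=0..<m. a i) * (\<Prod>j=0..<m. b j) * 1)"
      using perm_scaling[of ?I m a b] perm_scaling[OF scaling_carrier, of ?I m a b] perm_perm_mat[OF permutes_id, of m]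
      unfolding h_def by simp
    then show ?thesis unfolding wt by (simp add: prod.distrib mult_ac)
  qed
  \<comment> \<open>The determinant of the base changes, hence the value of the normalized pencil at
    every permutation matrix.\<close>
  define \<kappa> where "\<kappa> = det P' * det P * det Q * det Q'"
  interpret weighted_pencil p m n q \<beta>' \<gamma>' "\<lambda>i j r s. f (unit_mat m i j) $$ (r,s)" \<kappa>
  proof
    show "0 < m" "q \<le> n" using m3 q by auto
    show "\<beta>' r \<noteq> 0" "\<gamma>' r \<noteq> 0" if "r < n" for r using nz'[OF that] by auto
    show "\<beta>' r = of_nat (wt m i j) * \<gamma>' s"
      if "i < m" "j < m" "r < n" "s < n" "f (unit_mat m i j) $$ (r,s) \<noteq> 0" for i j r s
      by (rule gradedD(2)[OF grf[OF that(1,2)] that(3-5)])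
    show "\<beta>' r = \<gamma>' r" if "r < q" for r by (rule const[OF that])
    show "(\<Prod>r=0..<n. \<beta>' r) = (\<Prod>i=0..<m. of_nat (wt m i i)) * (\<Prod>r=0..<n. \<gamma>' r)"
      using prods prods' BC c2 by simp
    show "\<kappa> \<noteq> 0" using P(2) Q(2) P'(2) Q'(2) by (simp add: \<kappa>_def)
    fix \<sigma> assume \<sigma>: "\<sigma> permutes {0..<m}"
    let ?y = "perm_mat m \<sigma>"
    have Ay: "A ?y \<in> carrier_mat n n" by (rule Ac) simp
    have exp: "f ?y $$ (r,s) = (\<Sum>i=0..<m. f (unit_mat m i (\<sigma> i)) $$ (r,s))" if "r < n" "s < n" for r s
    proof -
      have "f ?y $$ (r,s) = (\<Sum>i=0..<m. \<Sum>j=0..<m. ?y $$ (i,j) * f (unit_mat m i j) $$ (r,s))"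
        by (rule mat_linear_expand[OF f perm_mat_carrier that])
      also have "\<dots> = (\<Sum>i=0..<m. \<Sum>j=0..<m. if j = \<sigma> i then f (unit_mat m i j) $$ (r,s) else 0)"
        by (intro sum.cong) (auto simp: perm_mat_def)
      also have "\<dots> = (\<Sum>i=0..<m. f (unit_mat m i (\<sigma> i)) $$ (r,s))"
        using permutes_in_image[OF \<sigma>] by (intro sum.cong) auto
      finally show ?thesis .
    qed
    have sum: "P' * (P * (\<Lambda> + A ?y) * Q) * Q' = rank_mat n q + f ?y"
      unfolding nf[symmetric] f_def using P(1) Q(1) P'c Q'c L Ay
      by (simp add: mult_add_distrib_mat[of _ n n _ n] add_mult_distrib_mat[of _ n n _ _ n] mult_carrier_mat_square)
    have fy: "f ?y \<in> carrier_mat n n" by (rule mat_linearD(1)[OF f]) simp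
    have "mat n n (\<lambda>(r,s). (if r = s \<and> r < q then 1 else 0) + (\<Sum>i=0..<m. f (unit_mat m i (\<sigma> i)) $$ (r,s))) =
        rank_mat n q + f ?y"
      using fy by (intro eq_matI) (auto simp: rank_mat_def exp)
    then have "det (mat n n (\<lambda>(r,s). (if r = s \<and> r < q then 1 else 0) + (\<Sum>i=0..<m. f (unit_mat m i (\<sigma> i)) $$ (r,s)))) =
        det (P' * (P * (\<Lambda> + A ?y) * Q) * Q')" using sum by simp
    also have "\<dots> = \<kappa> * det (\<Lambda> + A ?y)"
      using P(1) Q(1) P'c Q'c L Ay by (simp add: det_mult[of _ n] mult_carrier_mat_square \<kappa>_def mult_ac)
    also have "\<dots> = \<kappa>" using det[of ?y] perm_perm_mat[OF \<sigma>] by simp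
    finally show "det (mat n n (\<lambda>(r,s). (if r = s \<and> r < q then 1 else 0) +
        (\<Sum>i=0..<m. f (unit_mat m i (\<sigma> i)) $$ (r,s)))) = \<kappa>" .
  qed
  show ?thesis by (rule choose_le_size[OF m3])
qed

section \<open>Comparison with polynomial growth\<close>

text \<open>A finite infimum of sizes is attained, so it is the size of an actual
  representation.\<close>

lemma edc_perm_ge:
  assumes m: "3 \<le> m" and k: "edc (Mat_space m) perm = enat k"
  shows "m choose l \<le> k"
proof -
  let ?S = "{enat n | n. \<exists>\<Lambda> A. equivariant_det_rep (Mat_space m) perm n \<Lambda> A}"
  have ne: "?S \<noteq> {}"
  proof
    assume "?S = {}"
    then have "edc (Mat_space m) perm = \<infinity>" unfolding edc_def by (simp add: Inf_enat_def)
    then show False using k by simp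
  qed
  then obtain s where "s \<in> ?S" by blast
  then have "(LEAST x. x \<in> ?S) \<in> ?S" by (rule LeastI)
  then have "Inf ?S \<in> ?S" unfolding Inf_enat_def using ne by presburger
  then have "enat k \<in> ?S" using k unfolding edc_def by simp
  then obtain \<Lambda> A where "equivariant_det_rep (Mat_space m) perm k \<Lambda> A" by auto
  then show ?thesis by (rule choose_le_equivariant_size[OF m])
qed

lemma dc_le:
  assumes "det_rep V P n \<Lambda> A" and "dc V P = enat d"
  shows "d \<le> n"
proof -
  have "dc V P \<le> enat n" unfolding dc_def by (rule Inf_lower) (use assms(1) in blast)
  then show ?thesis using assms(2) by simp
qed

text \<open>A monotone majorant: the polynomial itself need not be monotone, so an upper bound for
  its argument could not be inserted directly.\<close>

lemma poly_le_power:
  fixes p :: "real poly"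
  shows "\<exists>C\<ge>0. \<forall>x\<ge>0. poly p x \<le> C * (1 + x) ^ degree p"
proof (intro exI conjI allI impI)
  show "0 \<le> (\<Sum>i\<le>degree p. \<bar>coeff p i\<bar>)" by (simp add: sum_nonneg)
  fix x :: real assume x: "0 \<le> x"
  have "poly p x = (\<Sum>i\<le>degree p. coeff p i * x ^ i)" by (rule poly_altdef)
  also have "\<dots> \<le> (\<Sum>i\<le>degree p. \<bar>coeff p i\<bar> * (1 + x) ^ degree p)"
  proof (rule sum_mono)
    fix i assume i: "i \<in> {..degree p}"
    have "x ^ i \<le> (1 + x) ^ i" using x by (intro power_mono) auto
    also have "\<dots> \<le> (1 + x) ^ degree p" using x i by (intro power_increasing) auto
    finally have "\<bar>coeff p i\<bar> * x ^ i \<le> \<bar>coeff p i\<bar> * (1 + x) ^ degree p" by (intro mult_left_mono) auto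
    moreover have "coeff p i * x ^ i \<le> \<bar>coeff p i\<bar> * x ^ i" using x by (intro mult_right_mono) auto
    ultimately show "coeff p i * x ^ i \<le> \<bar>coeff p i\<bar> * (1 + x) ^ degree p" by linarith
  qed
  finally show "poly p x \<le> (\<Sum>i\<le>degree p. \<bar>coeff p i\<bar>) * (1 + x) ^ degree p"
    by (simp add: sum_distrib_right)
qed

text \<open>A row of m + 1 binomial coefficients sums to 2^m, and the central one is the
  largest.\<close>

lemma two_power_le_central_binomial: "2 ^ m \<le> (m + 1) * (m choose (m div 2))"
proof -
  have "2 ^ m = (\<Sum>k\<le>m. m choose k)" by (simp add: choose_row_sum)
  also have "\<dots> \<le> (\<Sum>k\<le>m. m choose (m div 2))" by (intro sum_mono binomial_maximum)
  finally show ?thesis by simp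
qed

lemma eventually_power_less_exp: "\<forall>\<^sub>F m in sequentially. C * (1 + real m) ^ D < 2 ^ m"
proof -
  have "(\<lambda>m. C * (1 + real m) ^ D / 2 ^ m) \<longlonglongrightarrow> 0" by real_asymp
  then have "\<forall>\<^sub>F m in sequentially. C * (1 + real m) ^ D / 2 ^ m < 1" by (rule order_tendstoD) simp
  then show ?thesis by (rule eventually_mono) (simp add: field_simps)
qed

theorem corollary2p3:
  assumes "\<exists>e :: real poly. \<forall>m \<ge> 1. \<exists>k d :: nat.
      edc (Mat_space m) perm = enat k \<and> dc (Mat_space m) perm = enat d \<and>
      real k \<le> poly e (real d)"
  shows "\<forall>n :: nat \<Rightarrow> nat.
      (\<forall>m \<ge> 1. \<exists>\<Lambda> A. det_rep (Mat_space m) perm (n m) \<Lambda> A) \<longrightarrow>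
      (\<forall>p :: real poly. \<forall>\<^sub>F m in sequentially. real (n m) > poly p (real m))"
proof (intro allI impI)
  fix n :: "nat \<Rightarrow> nat" and p :: "real poly"
  assume n: "\<forall>m \<ge> 1. \<exists>\<Lambda> A. det_rep (Mat_space m) perm (n m) \<Lambda> A"
  obtain e :: "real poly" where e: "\<And>m. 1 \<le> m \<Longrightarrow> \<exists>k d :: nat. edc (Mat_space m) perm = enat k \<and>
      dc (Mat_space m) perm = enat d \<and> real k \<le> poly e (real d)" using assms by blast
  obtain C where C: "0 \<le> C" "\<And>x. 0 \<le> x \<Longrightarrow> poly e x \<le> C * (1 + x) ^ degree e"
    using poly_le_power[of e] by blast
  obtain C' where C': "0 \<le> C'" "\<And>x. 0 \<le> x \<Longrightarrow> poly p x \<le> C' * (1 + x) ^ degree p"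
    using poly_le_power[of p] by blast
  \<comment> \<open>If the size is at most \<open>poly p m\<close>, then 1 + d is at most (1 + C')
    (1 + m)^(degree p); inserting this in the majorant of \<open>e\<close> gives \<open>?K\<close>
    and the product of degrees. The extra 1 in \<open>?D\<close> pays for the factor m + 1 of the
    central binomial estimate.\<close>
  let ?K = "C * (1 + C') ^ degree e" and ?D = "degree p * degree e + 1"
  show "\<forall>\<^sub>F m in sequentially. real (n m) > poly p (real m)"
    \<comment> \<open>The lower bound for equivariant sizes is available from three rows on.\<close>
    using eventually_power_less_exp[of ?K ?D] eventually_ge_at_top[of 3]
  proof eventually_elim
    case (elim m)
    obtain k d where k: "edc (Mat_space m) perm = enat k" and d: "dc (Mat_space m) perm = enat d"
      and kd: "real k \<le> poly e (real d)" using e[of m] elim by auto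
    obtain \<Lambda> A where "det_rep (Mat_space m) perm (n m) \<Lambda> A" using n elim by force
    then have dn: "d \<le> n m" using d by (rule dc_le)
    show ?case
    proof (rule ccontr)
      assume "\<not> poly p (real m) < real (n m)"
      then have "real d \<le> C' * (1 + real m) ^ degree p" using C'(2)[of "real m"] dn by simp
      moreover have "1 \<le> (1 + real m) ^ degree p" by (intro one_le_power) simp
      ultimately have "1 + real d \<le> (1 + C') * (1 + real m) ^ degree p"
        unfolding distrib_right by linarith
      then have "(1 + real d) ^ degree e \<le> ((1 + C') * (1 + real m) ^ degree p) ^ degree e"
        by (intro power_mono) auto
      then have "C * (1 + real d) ^ degree e \<le> C * ((1 + C') * (1 + real m) ^ degree p) ^ degree e"
        using C(1) by (intro mult_left_mono)
      then have k_le: "real k \<le> ?K * (1 + real m) ^ (degree p * degree e)"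
        using kd C(2)[of "real d"] by (simp add: power_mult_distrib power_mult[symmetric] mult_ac)
      have "2 ^ m \<le> (m + 1) * k"
        using two_power_le_central_binomial[of m] edc_perm_ge[OF elim(2) k, of "m div 2"]
        by (meson le_trans mult_le_mono2)
      then have "2 ^ m \<le> real ((m + 1) * k)" by (metis of_nat_le_iff of_nat_numeral of_nat_power)
      also have "\<dots> \<le> (1 + real m) * (?K * (1 + real m) ^ (degree p * degree e))"
        using mult_left_mono[OF k_le, of "1 + real m"] by (simp add: algebra_simps)
      also have "\<dots> = ?K * (1 + real m) ^ ?D" by simp
      finally show False using elim(1) by simp
    qed
  qed
qed

end
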